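(* Let $R$ be a commutative ring and $\mathcal{P}$ an operad over $R$. For each $R$-module $V$, let $\partial_V:\mathsf{S}(\mathcal{P},V)\to\mathsf{S}(\mathcal{P},V\times V)$ be the $R$-linear map such that $$\partial_V(\mu;v_1,\dots,v_n)=\sum_{i=1}^n\big(\mu;(v_1,0),\dots,(0,v_i),\dots,(v_n,0)\big),$$ where in the $i$-th summand the first injection $V\to V\times V$ is applied to all the inputs except the $i$-th, to which the second injection is applied. Then $\partial$ is a differential combinator transformation for the monad $(\mathsf{S}(\mathcal{P},-),\gamma,\eta)$ on the category $\mathsf{MOD}_R$ of $R$-modules, and thus $(\mathsf{S}(\mathcal{P},-),\gamma,\eta,\partial)$ is a coCartesian differential monad.
   Context: $R$ is a commutative ring. An operad $\mathcal{P}$ is a symmetric operad in $R$-modules: $R$-modules $\mathcal{P}(n)$, $n\ge0$, with right $\Sigma(n)$-actions, a unit $1_{\mathcal{P}}\in\mathcal{P}(1)$ and partial compositions satisfying the usual equivariance, associativity and unit axioms; $\mu(\nu_1,\dots,\nu_k)$ denotes the complete composition. The monad of $\mathcal{P}$ on $\mathsf{MOD}_R$: $\mathsf{S}(\mathcal{P},V)=\bigoplus_{n\ge0}(\mathcal{P}(n)\otimes V^{\otimes n})_{\Sigma(n)}$ (coinvariants for the diagonal action), with $(\mu;v_1,\dots,v_n)$ the class of $\mu\otimes v_1\otimes\cdots\otimes v_n$; $\mathsf{S}(\mathcal{P},f)(\mu;v_1,\dots,v_n)=(\mu;f(v_1),\dots,f(v_n))$; unit $\eta_V(v)=(1_{\mathcal{P}};v)$;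 multiplication $\gamma_V(\mu;(\nu_1;v_{1,1},\dots,v_{1,n_1}),\dots,(\nu_k;v_{k,1},\dots,v_{k,n_k}))=(\mu(\nu_1,\dots,\nu_k);v_{1,1},\dots,v_{k,n_k})$. Semi-additive category: category with finite biproducts (written $\times$, with projections $\pi_j$ and pairing $\langle-,\dots,-\rangle$), hence enriched in commutative monoids. A differential combinator transformation on a monad $(\mathsf{S},\mu,\eta)$ on a semi-additive category is a natural transformation $\partial_A:\mathsf{S}(A)\to\mathsf{S}(A\times A)$ such that: [DC.1] $\mathsf{S}(\pi_1)\circ\partial_A=0$; [DC.2] $\mathsf{S}(\langle\pi_1,\pi_2,\pi_2\rangle)\circ\partial_A=\mathsf{S}(\langle\pi_1,\pi_2,0\rangle)\circ\partial_A+\mathsf{S}(\langle\pi_1,0,\pi_2\rangle)\circ\partial_A$; [DC.3] $\partial_A\circ\eta_A=\eta_{A\times A}\circ\langle0,1_A\rangle$; [DC.4] $\partial_A\circ\mu_A=\mu_{A\times A}\circ\mathsf{S}\big(\mathsf{S}(\langle1_A,0\rangle)\circ\pi_1+\partial_A\circ\pi_2\big)\circ\partial_{\mathsf{S}(A)}$; [DC.5] $\mathsf{S}(\langle\pi_1,\pi_4\rangle)\circ\partial_{A\times A}\circ\partial_A=\partial_A$; [DC.6] $\mathsf{S}(\langle\pi_1,\pi_3,\pi_2,\pi_4\rangle)\circ\partial_{A\times A}\circ\partial_A=\partial_{A\times A}\circ\partial_A$. A coCartesian differential monad is a monad on a semi-additive category together with a differential combinator transformation. *)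

theory Defs
  imports
    "HOL-Algebra.Module"
    "HOL-Algebra.AbelCoset"
    "HOL-Combinatorics.Permutations"
    "HOL-Library.Infinite_Typeclass"
begin

section \<open>Semi-additive categories\<close>

record ('o, 'm) category =
  Ob :: "'o set"
  Arr :: "'m set"
  Dom :: "'m \<Rightarrow> 'o"
  Cod :: "'m \<Rightarrow> 'o"
  Ident :: "'o \<Rightarrow> 'm" (\<open>\<I>\<index>\<close>)
  Comp :: "'m \<Rightarrow> 'm \<Rightarrow> 'm" (infixr \<open>\<cdot>\<index>\<close> 75)

definition Hom :: "('o, 'm, 'z) category_scheme \<Rightarrow> 'o \<Rightarrow> 'o \<Rightarrow> 'm set" where
  "Hom C A B = {f \<in> Arr C. Dom C f = A \<and> Cod C f = B}"

locale category =
  fixes C :: "('o, 'm, 'z) category_scheme" (structure)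
  assumes dom_in_Ob: "f \<in> Arr C \<Longrightarrow> Dom C f \<in> Ob C"
    and cod_in_Ob: "f \<in> Arr C \<Longrightarrow> Cod C f \<in> Ob C"
    and ident_in_Hom: "A \<in> Ob C \<Longrightarrow> \<I> A \<in> Hom C A A"
    and comp_in_Hom: "\<lbrakk>f \<in> Hom C A B; g \<in> Hom C B D\<rbrakk> \<Longrightarrow> g \<cdot> f \<in> Hom C A D"
    and comp_assoc: "\<lbrakk>f \<in> Hom C A B; g \<in> Hom C B D; h \<in> Hom C D E\<rbrakk> \<Longrightarrow>
      (h \<cdot> g) \<cdot> f = h \<cdot> (g \<cdot> f)"
    and comp_ident_right: "f \<in> Hom C A B \<Longrightarrow> f \<cdot> \<I> A = f"
    and comp_ident_left: "f \<in> Hom C A B \<Longrightarrow> \<I> B \<cdot> f = f"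

record ('o, 'm) biprod_category = "('o, 'm) category" +
  Zero_ob :: "'o"
  Prod :: "'o \<Rightarrow> 'o \<Rightarrow> 'o" (infixl \<open>\<boxtimes>\<index>\<close> 80)
  Pr1 :: "'o \<Rightarrow> 'o \<Rightarrow> 'm"
  Pr2 :: "'o \<Rightarrow> 'o \<Rightarrow> 'm"
  In1 :: "'o \<Rightarrow> 'o \<Rightarrow> 'm"
  In2 :: "'o \<Rightarrow> 'o \<Rightarrow> 'm"

definition zero_arr :: "('o, 'm, 'z) biprod_category_scheme \<Rightarrow> 'o \<Rightarrow> 'o \<Rightarrow> 'm" where
  "zero_arr C A B =
    Comp C (THE g. g \<in> Hom C (Zero_ob C) B) (THE f. f \<in> Hom C A (Zero_ob C))"

definition pairing :: "('o, 'm, 'z) biprod_category_scheme \<Rightarrow> 'm \<Rightarrow> 'm \<Rightarrow> 'm"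
    (\<open>\<langle>_, _\<rangle>\<index>\<close>) where
  "pairing C f g = (THE h. h \<in> Hom C (Dom C f) (Prod C (Cod C f) (Cod C g)) \<and>
     Comp C (Pr1 C (Cod C f) (Cod C g)) h = f \<and> Comp C (Pr2 C (Cod C f) (Cod C g)) h = g)"

definition copairing :: "('o, 'm, 'z) biprod_category_scheme \<Rightarrow> 'm \<Rightarrow> 'm \<Rightarrow> 'm" where
  "copairing C f g = (THE h. h \<in> Hom C (Prod C (Dom C f) (Dom C g)) (Cod C f) \<and>
     Comp C h (In1 C (Dom C f) (Dom C g)) = f \<and> Comp C h (In2 C (Dom C f) (Dom C g)) = g)"

text \<open>The commutative monoid structure on the hom-sets that is induced by the biproducts:
  \<open>f + g\<close> is the pairing of \<open>f\<close> and \<open>g\<close> followed by the codiagonal.\<close>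

definition arr_add :: "('o, 'm, 'z) biprod_category_scheme \<Rightarrow> 'm \<Rightarrow> 'm \<Rightarrow> 'm"
    (infixl \<open>\<boxplus>\<index>\<close> 65) where
  "arr_add C f g =
    Comp C (copairing C (Ident C (Cod C f)) (Ident C (Cod C f))) (pairing C f g)"

locale semi_additive_category = category C
  for C :: "('o, 'm, 'z) biprod_category_scheme" (structure) +
  assumes zero_in_Ob: "Zero_ob C \<in> Ob C"
    and zero_terminal: "A \<in> Ob C \<Longrightarrow> \<exists>!f. f \<in> Hom C A (Zero_ob C)"
    and zero_initial: "A \<in> Ob C \<Longrightarrow> \<exists>!f. f \<in> Hom C (Zero_ob C) A"
    and prod_in_Ob: "\<lbrakk>A \<in> Ob C; B \<in> Ob C\<rbrakk> \<Longrightarrow> A \<boxtimes> B \<in> Ob C"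
    and pr1_in_Hom: "\<lbrakk>A \<in> Ob C; B \<in> Ob C\<rbrakk> \<Longrightarrow> Pr1 C A B \<in> Hom C (A \<boxtimes> B) A"
    and pr2_in_Hom: "\<lbrakk>A \<in> Ob C; B \<in> Ob C\<rbrakk> \<Longrightarrow> Pr2 C A B \<in> Hom C (A \<boxtimes> B) B"
    and in1_in_Hom: "\<lbrakk>A \<in> Ob C; B \<in> Ob C\<rbrakk> \<Longrightarrow> In1 C A B \<in> Hom C A (A \<boxtimes> B)"
    and in2_in_Hom: "\<lbrakk>A \<in> Ob C; B \<in> Ob C\<rbrakk> \<Longrightarrow> In2 C A B \<in> Hom C B (A \<boxtimes> B)"
    and product: "\<lbrakk>A \<in> Ob C; B \<in> Ob C; f \<in> Hom C X A; g \<in> Hom C X B\<rbrakk> \<Longrightarrow>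
      \<exists>!h. h \<in> Hom C X (A \<boxtimes> B) \<and> Pr1 C A B \<cdot> h = f \<and> Pr2 C A B \<cdot> h = g"
    and coproduct: "\<lbrakk>A \<in> Ob C; B \<in> Ob C; f \<in> Hom C A X; g \<in> Hom C B X\<rbrakk> \<Longrightarrow>
      \<exists>!h. h \<in> Hom C (A \<boxtimes> B) X \<and> h \<cdot> In1 C A B = f \<and> h \<cdot> In2 C A B = g"
    and pr1_in1: "\<lbrakk>A \<in> Ob C; B \<in> Ob C\<rbrakk> \<Longrightarrow> Pr1 C A B \<cdot> In1 C A B = \<I> A"
    and pr2_in2: "\<lbrakk>A \<in> Ob C; B \<in> Ob C\<rbrakk> \<Longrightarrow> Pr2 C A B \<cdot> In2 C A B = \<I> B"
    and pr2_in1: "\<lbrakk>A \<in> Ob C; B \<in> Ob C\<rbrakk> \<Longrightarrow> Pr2 C A B \<cdot> In1 C A B = zero_arr C A B"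
    and pr1_in2: "\<lbrakk>A \<in> Ob C; B \<in> Ob C\<rbrakk> \<Longrightarrow> Pr1 C A B \<cdot> In2 C A B = zero_arr C B A"


section \<open>Monads and differential combinator transformations\<close>

locale monad = category C
  for C :: "('o, 'm, 'z) category_scheme" (structure) +
  fixes S :: "'o \<Rightarrow> 'o" and Sm :: "'m \<Rightarrow> 'm" and \<mu> :: "'o \<Rightarrow> 'm" and \<eta> :: "'o \<Rightarrow> 'm"
  assumes functor_ob: "A \<in> Ob C \<Longrightarrow> S A \<in> Ob C"
    and functor_arr: "f \<in> Hom C A B \<Longrightarrow> Sm f \<in> Hom C (S A) (S B)"
    and functor_ident: "A \<in> Ob C \<Longrightarrow> Sm (\<I> A) = \<I> (S A)"
    and functor_comp: "\<lbrakk>f \<in> Hom C A B; g \<in> Hom C B D\<rbrakk> \<Longrightarrow> Sm (g \<cdot> f) = Sm g \<cdot> Sm f"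
    and mult_in_Hom: "A \<in> Ob C \<Longrightarrow> \<mu> A \<in> Hom C (S (S A)) (S A)"
    and mult_natural: "f \<in> Hom C A B \<Longrightarrow> \<mu> B \<cdot> Sm (Sm f) = Sm f \<cdot> \<mu> A"
    and unit_in_Hom: "A \<in> Ob C \<Longrightarrow> \<eta> A \<in> Hom C A (S A)"
    and unit_natural: "f \<in> Hom C A B \<Longrightarrow> \<eta> B \<cdot> f = Sm f \<cdot> \<eta> A"
    and mult_assoc: "A \<in> Ob C \<Longrightarrow> \<mu> A \<cdot> Sm (\<mu> A) = \<mu> A \<cdot> \<mu> (S A)"
    and mult_unit_left: "A \<in> Ob C \<Longrightarrow> \<mu> A \<cdot> \<eta> (S A) = \<I> (S A)"
    and mult_unit_right: "A \<in> Ob C \<Longrightarrow> \<mu> A \<cdot> Sm (\<eta> A) = \<I> (S A)"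

text \<open>Triple products are \<open>(A \<times> A) \<times> A\<close> and fourfold products are
  \<open>(A \<times> A) \<times> (A \<times> A)\<close>; so on the latter the four projections are the composites
  \<open>\<pi>\<^sub>1 \<pi>\<^sub>1\<close>, \<open>\<pi>\<^sub>2 \<pi>\<^sub>1\<close>, \<open>\<pi>\<^sub>1 \<pi>\<^sub>2\<close>, \<open>\<pi>\<^sub>2 \<pi>\<^sub>2\<close>.\<close>

definition pairing3 :: "('o, 'm, 'z) biprod_category_scheme \<Rightarrow> 'm \<Rightarrow> 'm \<Rightarrow> 'm \<Rightarrow> 'm"
    (\<open>\<langle>_, _, _\<rangle>\<index>\<close>) where
  "pairing3 C f g h = pairing C (pairing C f g) h"

definition pairing4 :: "('o, 'm, 'z) biprod_category_scheme \<Rightarrow> 'm \<Rightarrow> 'm \<Rightarrow> 'm \<Rightarrow> 'm \<Rightarrow> 'm"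
    (\<open>\<langle>_, _, _, _\<rangle>\<index>\<close>) where
  "pairing4 C f g h k = pairing C (pairing C f g) (pairing C h k)"

definition quad1 :: "('o, 'm, 'z) biprod_category_scheme \<Rightarrow> 'o \<Rightarrow> 'm" where
  "quad1 C A = Comp C (Pr1 C A A) (Pr1 C (Prod C A A) (Prod C A A))"

definition quad2 :: "('o, 'm, 'z) biprod_category_scheme \<Rightarrow> 'o \<Rightarrow> 'm" where
  "quad2 C A = Comp C (Pr2 C A A) (Pr1 C (Prod C A A) (Prod C A A))"

definition quad3 :: "('o, 'm, 'z) biprod_category_scheme \<Rightarrow> 'o \<Rightarrow> 'm" where
  "quad3 C A = Comp C (Pr1 C A A) (Pr2 C (Prod C A A) (Prod C A A))"

definition quad4 :: "('o, 'm, 'z) biprod_category_scheme \<Rightarrow> 'o \<Rightarrow> 'm" where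
  "quad4 C A = Comp C (Pr2 C A A) (Pr2 C (Prod C A A) (Prod C A A))"

locale differential_combinator_transformation =
  semi_additive_category C + monad C S Sm \<mu> \<eta>
  for C :: "('o, 'm, 'z) biprod_category_scheme" (structure)
    and S :: "'o \<Rightarrow> 'o" and Sm :: "'m \<Rightarrow> 'm" and \<mu> :: "'o \<Rightarrow> 'm" and \<eta> :: "'o \<Rightarrow> 'm" +
  fixes D :: "'o \<Rightarrow> 'm"
  assumes d_in_Hom: "A \<in> Ob C \<Longrightarrow> D A \<in> Hom C (S A) (S (A \<boxtimes> A))"
    and d_natural: "f \<in> Hom C A B \<Longrightarrow>
      D B \<cdot> Sm f = Sm \<langle>f \<cdot> Pr1 C A A, f \<cdot> Pr2 C A A\<rangle> \<cdot> D A"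
    and DC1: "A \<in> Ob C \<Longrightarrow> Sm (Pr1 C A A) \<cdot> D A = zero_arr C (S A) (S A)"
    and DC2: "A \<in> Ob C \<Longrightarrow>
      Sm \<langle>Pr1 C A A, Pr2 C A A, Pr2 C A A\<rangle> \<cdot> D A =
      Sm \<langle>Pr1 C A A, Pr2 C A A, zero_arr C (A \<boxtimes> A) A\<rangle> \<cdot> D A \<boxplus>
      Sm \<langle>Pr1 C A A, zero_arr C (A \<boxtimes> A) A, Pr2 C A A\<rangle> \<cdot> D A"
    and DC3: "A \<in> Ob C \<Longrightarrow> D A \<cdot> \<eta> A = \<eta> (A \<boxtimes> A) \<cdot> \<langle>zero_arr C A A, \<I> A\<rangle>"
    and DC4: "A \<in> Ob C \<Longrightarrow>
      D A \<cdot> \<mu> A =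
      \<mu> (A \<boxtimes> A) \<cdot>
        Sm (Sm \<langle>\<I> A, zero_arr C A A\<rangle> \<cdot> Pr1 C (S A) (S A) \<boxplus> D A \<cdot> Pr2 C (S A) (S A)) \<cdot>
        D (S A)"
    and DC5: "A \<in> Ob C \<Longrightarrow>
      Sm \<langle>quad1 C A, quad4 C A\<rangle> \<cdot> D (A \<boxtimes> A) \<cdot> D A = D A"
    and DC6: "A \<in> Ob C \<Longrightarrow>
      Sm \<langle>quad1 C A, quad3 C A, quad2 C A, quad4 C A\<rangle> \<cdot> D (A \<boxtimes> A) \<cdot> D A =
      D (A \<boxtimes> A) \<cdot> D A"

locale coCartesian_differential_monad =
  semi_additive_category C + monad C S Sm \<mu> \<eta> +
  differential_combinator_transformation C S Sm \<mu> \<eta> D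
  for C :: "('o, 'm, 'z) biprod_category_scheme" (structure)
    and S :: "'o \<Rightarrow> 'o" and Sm :: "'m \<Rightarrow> 'm" and \<mu> :: "'o \<Rightarrow> 'm" and \<eta> :: "'o \<Rightarrow> 'm"
    and D :: "'o \<Rightarrow> 'm"


section \<open>Constructions with modules\<close>

text \<open>The ring-multiplicative fields of a module record play no role for modules and are
  left unspecified throughout.\<close>

definition mk_module ::
    "'b set \<Rightarrow> 'b \<Rightarrow> ('b \<Rightarrow> 'b \<Rightarrow> 'b) \<Rightarrow> ('a \<Rightarrow> 'b \<Rightarrow> 'b) \<Rightarrow> ('a, 'b) module" where
  "mk_module A z pl sm = \<lparr>carrier = A, monoid.mult = undefined, one = undefined,
     ring.zero = z, add = pl, smult = sm\<rparr>"

definition linear_maps ::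
    "('a, 'c) ring_scheme \<Rightarrow> ('a, 'b) module \<Rightarrow> ('a, 'd) module \<Rightarrow> ('b \<Rightarrow> 'd) set" where
  "linear_maps R M N = {f \<in> carrier M \<rightarrow>\<^sub>E carrier N.
     (\<forall>x\<in>carrier M. \<forall>y\<in>carrier M. f (x \<oplus>\<^bsub>M\<^esub> y) = f x \<oplus>\<^bsub>N\<^esub> f y) \<and>
     (\<forall>a\<in>carrier R. \<forall>x\<in>carrier M. f (a \<odot>\<^bsub>M\<^esub> x) = a \<odot>\<^bsub>N\<^esub> f x)}"

definition generated_submodule ::
    "('a, 'c) ring_scheme \<Rightarrow> ('a, 'b) module \<Rightarrow> 'b set \<Rightarrow> 'b set" where
  "generated_submodule R M G = \<Inter>{N. submodule N R M \<and> G \<subseteq> N}"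

definition quotient_module :: "('a, 'b) module \<Rightarrow> 'b set \<Rightarrow> ('a, 'b set) module" where
  "quotient_module M N = mk_module (a_rcosets\<^bsub>M\<^esub> N) N (set_add M)
     (\<lambda>a K. \<Union>x\<in>K. N +>\<^bsub>M\<^esub> (a \<odot>\<^bsub>M\<^esub> x))"

definition free_module :: "('a, 'c) ring_scheme \<Rightarrow> 'x set \<Rightarrow> ('a, 'x \<Rightarrow> 'a) module" where
  "free_module R X = mk_module
     {c. (\<forall>x. c x \<in> carrier R) \<and> finite {x. c x \<noteq> \<zero>\<^bsub>R\<^esub>} \<and> {x. c x \<noteq> \<zero>\<^bsub>R\<^esub>} \<subseteq> X}
     (\<lambda>_. \<zero>\<^bsub>R\<^esub>) (\<lambda>c d x. c x \<oplus>\<^bsub>R\<^esub> d x) (\<lambda>a c x. a \<otimes>\<^bsub>R\<^esub> c x)"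

definition free_basis :: "('a, 'c) ring_scheme \<Rightarrow> 'x \<Rightarrow> 'x \<Rightarrow> 'a" where
  "free_basis R x = (\<lambda>y. if y = x then \<one>\<^bsub>R\<^esub> else \<zero>\<^bsub>R\<^esub>)"

definition direct_sum ::
    "(nat \<Rightarrow> ('a, 'b) module) \<Rightarrow> ('a, nat \<Rightarrow> 'b) module" where
  "direct_sum M = mk_module
     {c. (\<forall>n. c n \<in> carrier (M n)) \<and> finite {n. c n \<noteq> \<zero>\<^bsub>M n\<^esub>}}
     (\<lambda>n. \<zero>\<^bsub>M n\<^esub>) (\<lambda>c d n. c n \<oplus>\<^bsub>M n\<^esub> d n) (\<lambda>a c n. a \<odot>\<^bsub>M n\<^esub> c n)"

definition prod_module ::
    "('a, 'b) module \<Rightarrow> ('a, 'd) module \<Rightarrow> ('a, 'b \<times> 'd) module" where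
  "prod_module M N = mk_module (carrier M \<times> carrier N) (\<zero>\<^bsub>M\<^esub>, \<zero>\<^bsub>N\<^esub>)
     (\<lambda>(x, y) (x', y'). (x \<oplus>\<^bsub>M\<^esub> x', y \<oplus>\<^bsub>N\<^esub> y')) (\<lambda>a (x, y). (a \<odot>\<^bsub>M\<^esub> x, a \<odot>\<^bsub>N\<^esub> y))"

text \<open>The tensor product of a finite list of modules (on one common type): the free module
  on the tuples of elements modulo the multilinearity relations.\<close>

definition tensor_relations ::
    "('a, 'c) ring_scheme \<Rightarrow> ('a, 'b) module list \<Rightarrow> ('b list \<Rightarrow> 'a) set" where
  "tensor_relations R Ms = (let T = listset (map carrier Ms); F = free_module R T in
     {free_basis R (xs[i := x \<oplus>\<^bsub>Ms ! i\<^esub> y]) \<ominus>\<^bsub>F\<^esub>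
        (free_basis R (xs[i := x]) \<oplus>\<^bsub>F\<^esub> free_basis R (xs[i := y])) | xs i x y.
        xs \<in> T \<and> i < length Ms \<and> x \<in> carrier (Ms ! i) \<and> y \<in> carrier (Ms ! i)} \<union>
     {free_basis R (xs[i := a \<odot>\<^bsub>Ms ! i\<^esub> x]) \<ominus>\<^bsub>F\<^esub> a \<odot>\<^bsub>F\<^esub> free_basis R (xs[i := x]) | xs i a x.
        xs \<in> T \<and> i < length Ms \<and> a \<in> carrier R \<and> x \<in> carrier (Ms ! i)})"

definition tensor_kernel ::
    "('a, 'c) ring_scheme \<Rightarrow> ('a, 'b) module list \<Rightarrow> ('b list \<Rightarrow> 'a) set" where
  "tensor_kernel R Ms =
     generated_submodule R (free_module R (listset (map carrier Ms))) (tensor_relations R Ms)"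

definition tensor_module ::
    "('a, 'c) ring_scheme \<Rightarrow> ('a, 'b) module list \<Rightarrow> ('a, ('b list \<Rightarrow> 'a) set) module" where
  "tensor_module R Ms =
     quotient_module (free_module R (listset (map carrier Ms))) (tensor_kernel R Ms)"

definition pure_tensor ::
    "('a, 'c) ring_scheme \<Rightarrow> ('a, 'b) module list \<Rightarrow> 'b list \<Rightarrow> ('b list \<Rightarrow> 'a) set" where
  "pure_tensor R Ms xs =
     tensor_kernel R Ms +>\<^bsub>free_module R (listset (map carrier Ms))\<^esub> free_basis R xs"


section \<open>The category of modules\<close>

text \<open>The objects are the \<open>R\<close>-modules whose underlying set is a subset of an arbitrary infinite
  type \<open>'u\<close>, which plays the role of a universe (any given module has an isomorphic copy there once \<open>'u\<close>
  is chosen large enough). Constructions that leave \<open>'u\<close> (pairs, cosets,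
  direct sums) are moved back along an injection of their carrier into \<open>'u\<close>; for the
  constructions below such an injection exists because \<open>'u\<close> is infinite.\<close>

definition code :: "('a, 'b) module \<Rightarrow> 'b \<Rightarrow> 'u" where
  "code M = (SOME e. inj_on e (carrier M))"

definition decode :: "('a, 'b) module \<Rightarrow> 'u \<Rightarrow> 'b" where
  "decode M = inv_into (carrier M) (code M)"

definition copy_module :: "('a, 'b) module \<Rightarrow> ('a, 'u) module" where
  "copy_module M = mk_module (code M ` carrier M) (code M \<zero>\<^bsub>M\<^esub>)
     (\<lambda>x y. code M (decode M x \<oplus>\<^bsub>M\<^esub> decode M y)) (\<lambda>a x. code M (a \<odot>\<^bsub>M\<^esub> decode M x))"

record ('a, 'u) module_arr =
  src :: "('a, 'u) module"
  tgt :: "('a, 'u) module"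
  app :: "'u \<Rightarrow> 'u"

definition biprod_module :: "('a, 'u) module \<Rightarrow> ('a, 'u) module \<Rightarrow> ('a, 'u) module" where
  "biprod_module M N = copy_module (prod_module M N)"

definition MOD ::
    "('a, 'c) ring_scheme \<Rightarrow> (('a, 'u) module, ('a, 'u) module_arr) biprod_category" where
  "MOD R = \<lparr>
     Ob = {M. Module.module R M},
     Arr = {f. Module.module R (src f) \<and> Module.module R (tgt f) \<and>
       app f \<in> linear_maps R (src f) (tgt f)},
     Dom = src,
     Cod = tgt,
     Ident = (\<lambda>M. \<lparr>src = M, tgt = M, app = (\<lambda>x\<in>carrier M. x)\<rparr>),
     Comp = (\<lambda>g f. \<lparr>src = src f, tgt = tgt g, app = compose (carrier (src f)) (app g) (app f)\<rparr>),
     Zero_ob = mk_module {undefined} undefined (\<lambda>_ _. undefined) (\<lambda>_ _. undefined),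
     Prod = biprod_module,
     Pr1 = (\<lambda>M N. \<lparr>src = biprod_module M N, tgt = M,
       app = (\<lambda>x\<in>carrier (biprod_module M N). fst (decode (prod_module M N) x))\<rparr>),
     Pr2 = (\<lambda>M N. \<lparr>src = biprod_module M N, tgt = N,
       app = (\<lambda>x\<in>carrier (biprod_module M N). snd (decode (prod_module M N) x))\<rparr>),
     In1 = (\<lambda>M N. \<lparr>src = M, tgt = biprod_module M N,
       app = (\<lambda>x\<in>carrier M. code (prod_module M N) (x, \<zero>\<^bsub>N\<^esub>))\<rparr>),
     In2 = (\<lambda>M N. \<lparr>src = N, tgt = biprod_module M N,
       app = (\<lambda>y\<in>carrier N. code (prod_module M N) (\<zero>\<^bsub>M\<^esub>, y))\<rparr>)\<rparr>"


section \<open>Operads\<close>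

text \<open>Inputs are numbered from \<open>0\<close>. \<open>act P n \<nu> \<sigma>\<close> is the right action \<open>\<nu> \<sigma>\<close> of a permutation of
  \<open>{..<n}\<close>, and \<open>pcomp P m n i \<mu> \<nu>\<close> is the partial composition of \<open>\<mu> \<in> P(m)\<close> with
  \<open>\<nu> \<in> P(n)\<close> at input \<open>i\<close>. Everything carries its arity explicitly, since the carriers of
  the modules \<open>P(n)\<close> need not be disjoint.\<close>

record ('a, 'u) operad_data =
  ops :: "nat \<Rightarrow> ('a, 'u) module"
  act :: "nat \<Rightarrow> 'u \<Rightarrow> (nat \<Rightarrow> nat) \<Rightarrow> 'u"
  unit_op :: "'u"
  pcomp :: "nat \<Rightarrow> nat \<Rightarrow> nat \<Rightarrow> 'u \<Rightarrow> 'u \<Rightarrow> 'u"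

text \<open>The action is normalised so that, in an endomorphism operad,
  \<open>(\<mu> \<sigma>) (v\<^sub>0, \<dots>) = \<mu> (w\<^sub>0, \<dots>)\<close> where \<open>w (\<sigma> i) = v i\<close>. Then
  \<open>(\<mu> \<sigma>) \<circ>\<^sub>i (\<nu> \<tau>) = (\<mu> \<circ>\<^sub>\<sigma>\<^sub>(\<^sub>i\<^sub>) \<nu>) (\<sigma> \<circ>\<^sub>i \<tau>)\<close> for the following permutation \<open>\<sigma> \<circ>\<^sub>i \<tau>\<close> of
  \<open>{..<m + n - 1}\<close>: it maps the block of length \<open>n\<close> at position \<open>i\<close> to the one at position
  \<open>\<sigma> i\<close> by means of \<open>\<tau>\<close>, and the remaining positions as \<open>\<sigma>\<close> does.\<close>

definition perm_pcomp ::
    "nat \<Rightarrow> nat \<Rightarrow> nat \<Rightarrow> (nat \<Rightarrow> nat) \<Rightarrow> (nat \<Rightarrow> nat) \<Rightarrow> nat \<Rightarrow> nat" where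
  "perm_pcomp m n i \<sigma> \<tau> j =
     (if m + n - 1 \<le> j then j
      else if i \<le> j \<and> j < i + n then \<sigma> i + \<tau> (j - i)
      else let k = \<sigma> (if j < i then j else j + 1 - n)
           in if k < \<sigma> i then k else k + n - 1)"

locale operad = cring R
  for R :: "('a, 'c) ring_scheme" (structure) +
  fixes P :: "('a, 'u) operad_data"
  assumes ops_module: "Module.module R (ops P n)"
    and act_closed: "\<lbrakk>\<sigma> permutes {..<n}; \<mu> \<in> carrier (ops P n)\<rbrakk> \<Longrightarrow>
      act P n \<mu> \<sigma> \<in> carrier (ops P n)"
    and act_add: "\<lbrakk>\<sigma> permutes {..<n}; \<mu> \<in> carrier (ops P n); \<nu> \<in> carrier (ops P n)\<rbrakk> \<Longrightarrow>
      act P n (\<mu> \<oplus>\<^bsub>ops P n\<^esub> \<nu>) \<sigma> = act P n \<mu> \<sigma> \<oplus>\<^bsub>ops P n\<^esub> act P n \<nu> \<sigma>"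
    and act_smult: "\<lbrakk>\<sigma> permutes {..<n}; a \<in> carrier R; \<mu> \<in> carrier (ops P n)\<rbrakk> \<Longrightarrow>
      act P n (a \<odot>\<^bsub>ops P n\<^esub> \<mu>) \<sigma> = a \<odot>\<^bsub>ops P n\<^esub> act P n \<mu> \<sigma>"
    and act_id: "\<mu> \<in> carrier (ops P n) \<Longrightarrow> act P n \<mu> id = \<mu>"
    and act_comp: "\<lbrakk>\<sigma> permutes {..<n}; \<tau> permutes {..<n}; \<mu> \<in> carrier (ops P n)\<rbrakk> \<Longrightarrow>
      act P n (act P n \<mu> \<sigma>) \<tau> = act P n \<mu> (\<sigma> \<circ> \<tau>)"
    and unit_closed: "unit_op P \<in> carrier (ops P 1)"
    and pcomp_closed: "\<lbrakk>i < m; \<mu> \<in> carrier (ops P m); \<nu> \<in> carrier (ops P n)\<rbrakk> \<Longrightarrow>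
      pcomp P m n i \<mu> \<nu> \<in> carrier (ops P (m + n - 1))"
    and pcomp_add_left:
      "\<lbrakk>i < m; \<mu> \<in> carrier (ops P m); \<mu>' \<in> carrier (ops P m); \<nu> \<in> carrier (ops P n)\<rbrakk> \<Longrightarrow>
      pcomp P m n i (\<mu> \<oplus>\<^bsub>ops P m\<^esub> \<mu>') \<nu> =
        pcomp P m n i \<mu> \<nu> \<oplus>\<^bsub>ops P (m + n - 1)\<^esub> pcomp P m n i \<mu>' \<nu>"
    and pcomp_add_right:
      "\<lbrakk>i < m; \<mu> \<in> carrier (ops P m); \<nu> \<in> carrier (ops P n); \<nu>' \<in> carrier (ops P n)\<rbrakk> \<Longrightarrow>
      pcomp P m n i \<mu> (\<nu> \<oplus>\<^bsub>ops P n\<^esub> \<nu>') =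
        pcomp P m n i \<mu> \<nu> \<oplus>\<^bsub>ops P (m + n - 1)\<^esub> pcomp P m n i \<mu> \<nu>'"
    and pcomp_smult_left:
      "\<lbrakk>i < m; a \<in> carrier R; \<mu> \<in> carrier (ops P m); \<nu> \<in> carrier (ops P n)\<rbrakk> \<Longrightarrow>
      pcomp P m n i (a \<odot>\<^bsub>ops P m\<^esub> \<mu>) \<nu> = a \<odot>\<^bsub>ops P (m + n - 1)\<^esub> pcomp P m n i \<mu> \<nu>"
    and pcomp_smult_right:
      "\<lbrakk>i < m; a \<in> carrier R; \<mu> \<in> carrier (ops P m); \<nu> \<in> carrier (ops P n)\<rbrakk> \<Longrightarrow>
      pcomp P m n i \<mu> (a \<odot>\<^bsub>ops P n\<^esub> \<nu>) = a \<odot>\<^bsub>ops P (m + n - 1)\<^esub> pcomp P m n i \<mu> \<nu>"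
    and pcomp_equivariant:
      "\<lbrakk>i < m; \<sigma> permutes {..<m}; \<tau> permutes {..<n};
        \<mu> \<in> carrier (ops P m); \<nu> \<in> carrier (ops P n)\<rbrakk> \<Longrightarrow>
      pcomp P m n i (act P m \<mu> \<sigma>) (act P n \<nu> \<tau>) =
        act P (m + n - 1) (pcomp P m n (\<sigma> i) \<mu> \<nu>) (perm_pcomp m n i \<sigma> \<tau>)"
    and pcomp_assoc_sequential:
      "\<lbrakk>i < l; j < m; \<xi> \<in> carrier (ops P l); \<mu> \<in> carrier (ops P m); \<nu> \<in> carrier (ops P n)\<rbrakk> \<Longrightarrow>
      pcomp P (l + m - 1) n (i + j) (pcomp P l m i \<xi> \<mu>) \<nu> =
        pcomp P l (m + n - 1) i \<xi> (pcomp P m n j \<mu> \<nu>)"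
    and pcomp_assoc_parallel:
      "\<lbrakk>i < k; k < l; \<xi> \<in> carrier (ops P l); \<mu> \<in> carrier (ops P m); \<nu> \<in> carrier (ops P n)\<rbrakk> \<Longrightarrow>
      pcomp P (l + m - 1) n (k + m - 1) (pcomp P l m i \<xi> \<mu>) \<nu> =
        pcomp P (l + n - 1) m i (pcomp P l n k \<xi> \<nu>) \<mu>"
    and pcomp_unit_left: "\<nu> \<in> carrier (ops P n) \<Longrightarrow> pcomp P 1 n 0 (unit_op P) \<nu> = \<nu>"
    and pcomp_unit_right: "\<lbrakk>i < m; \<mu> \<in> carrier (ops P m)\<rbrakk> \<Longrightarrow> pcomp P m 1 i \<mu> (unit_op P) = \<mu>"

text \<open>The complete composition \<open>\<mu>(\<nu>\<^sub>1, \<dots>, \<nu>\<^sub>k)\<close>, where the operations \<open>\<nu>\<^sub>j\<close> are given together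
  with their arities. Inserting the last one first keeps the numbers of the earlier inputs
  unchanged; the first component keeps track of the current arity.\<close>

definition full_comp :: "('a, 'u) operad_data \<Rightarrow> nat \<Rightarrow> 'u \<Rightarrow> (nat \<times> 'u) list \<Rightarrow> 'u" where
  "full_comp P k \<mu> \<nu>s =
     snd (foldr (\<lambda>(i, n, \<nu>) (m, \<xi>). (m + n - 1, pcomp P m n i \<xi> \<nu>)) (enumerate 0 \<nu>s) (k, \<mu>))"


section \<open>The monad of an operad\<close>

definition coinvariants_kernel :: "('a, 'c) ring_scheme \<Rightarrow> ('a, 'u) operad_data \<Rightarrow>
    ('a, 'u) module \<Rightarrow> nat \<Rightarrow> ('u list \<Rightarrow> 'a) set set" where
  "coinvariants_kernel R P V n =
    (let Ms = ops P n # replicate n V; T = tensor_module R Ms in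
     generated_submodule R T
       {pure_tensor R Ms (act P n \<mu> \<sigma> # map (\<lambda>i. vs ! \<sigma> i) [0..<n]) \<ominus>\<^bsub>T\<^esub>
          pure_tensor R Ms (\<mu> # vs) | \<mu> vs \<sigma>.
          \<mu> \<in> carrier (ops P n) \<and> vs \<in> listset (replicate n (carrier V)) \<and> \<sigma> permutes {..<n}})"

text \<open>\<open>(P(n) \<otimes> V\<^sup>\<otimes>\<^sup>n)\<close> modulo the diagonal action of the permutations of \<open>{..<n}\<close>, and the class
  of \<open>\<mu> \<otimes> v\<^sub>1 \<otimes> \<dots> \<otimes> v\<^sub>n\<close>.\<close>

definition coinvariants :: "('a, 'c) ring_scheme \<Rightarrow> ('a, 'u) operad_data \<Rightarrow>
    ('a, 'u) module \<Rightarrow> nat \<Rightarrow> ('a, ('u list \<Rightarrow> 'a) set set) module" where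
  "coinvariants R P V n =
     quotient_module (tensor_module R (ops P n # replicate n V)) (coinvariants_kernel R P V n)"

definition coinvariants_class :: "('a, 'c) ring_scheme \<Rightarrow> ('a, 'u) operad_data \<Rightarrow>
    ('a, 'u) module \<Rightarrow> nat \<Rightarrow> 'u \<Rightarrow> 'u list \<Rightarrow> ('u list \<Rightarrow> 'a) set set" where
  "coinvariants_class R P V n \<mu> vs = (let Ms = ops P n # replicate n V in
     coinvariants_kernel R P V n +>\<^bsub>tensor_module R Ms\<^esub> pure_tensor R Ms (\<mu> # vs))"

definition Schur_sum :: "('a, 'c) ring_scheme \<Rightarrow> ('a, 'u) operad_data \<Rightarrow>
    ('a, 'u) module \<Rightarrow> ('a, nat \<Rightarrow> ('u list \<Rightarrow> 'a) set set) module" where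
  "Schur_sum R P V = direct_sum (coinvariants R P V)"

definition Schur :: "('a, 'c) ring_scheme \<Rightarrow> ('a, 'u) operad_data \<Rightarrow>
    ('a, 'u) module \<Rightarrow> ('a, 'u) module" where
  "Schur R P V = copy_module (Schur_sum R P V)"

text \<open>The element \<open>(\<mu>; v\<^sub>1, \<dots>, v\<^sub>n)\<close>, for \<open>\<mu> \<in> P(n)\<close>.\<close>

definition Schur_elem :: "('a, 'c) ring_scheme \<Rightarrow> ('a, 'u) operad_data \<Rightarrow>
    ('a, 'u) module \<Rightarrow> 'u \<Rightarrow> 'u list \<Rightarrow> 'u" where
  "Schur_elem R P V \<mu> vs = code (Schur_sum R P V)
     (\<lambda>n. if n = length vs then coinvariants_class R P V n \<mu> vs
          else \<zero>\<^bsub>coinvariants R P V n\<^esub>)"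

text \<open>The structure maps are the linear maps with the given values on the generators
  \<open>(\<mu>; v\<^sub>1, \<dots>, v\<^sub>n)\<close>.\<close>

definition Schur_map :: "('a, 'c) ring_scheme \<Rightarrow> ('a, 'u) operad_data \<Rightarrow>
    ('a, 'u) module_arr \<Rightarrow> ('a, 'u) module_arr" where
  "Schur_map R P f = (THE h. h \<in> Hom (MOD R) (Schur R P (src f)) (Schur R P (tgt f)) \<and>
     (\<forall>\<mu> vs. \<mu> \<in> carrier (ops P (length vs)) \<longrightarrow> set vs \<subseteq> carrier (src f) \<longrightarrow>
        app h (Schur_elem R P (src f) \<mu> vs) = Schur_elem R P (tgt f) \<mu> (map (app f) vs)))"

definition Schur_unit :: "('a, 'c) ring_scheme \<Rightarrow> ('a, 'u) operad_data \<Rightarrow>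
    ('a, 'u) module \<Rightarrow> ('a, 'u) module_arr" where
  "Schur_unit R P V = \<lparr>src = V, tgt = Schur R P V,
     app = (\<lambda>v\<in>carrier V. Schur_elem R P V (unit_op P) [v])\<rparr>"

definition Schur_mult :: "('a, 'c) ring_scheme \<Rightarrow> ('a, 'u) operad_data \<Rightarrow>
    ('a, 'u) module \<Rightarrow> ('a, 'u) module_arr" where
  "Schur_mult R P V = (THE h. h \<in> Hom (MOD R) (Schur R P (Schur R P V)) (Schur R P V) \<and>
     (\<forall>\<mu> ws. \<mu> \<in> carrier (ops P (length ws)) \<longrightarrow>
        (\<forall>(\<nu>, vs) \<in> set ws. \<nu> \<in> carrier (ops P (length vs)) \<and> set vs \<subseteq> carrier V) \<longrightarrow>
        app h (Schur_elem R P (Schur R P V) \<mu> (map (\<lambda>(\<nu>, vs). Schur_elem R P V \<nu> vs) ws)) =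
        Schur_elem R P V
          (full_comp P (length ws) \<mu> (map (\<lambda>(\<nu>, vs). (length vs, \<nu>)) ws))
          (concat (map snd ws))))"

definition is_Schur_diff :: "('a, 'c) ring_scheme \<Rightarrow> ('a, 'u) operad_data \<Rightarrow>
    ('a, 'u) module \<Rightarrow> ('a, 'u) module_arr \<Rightarrow> bool" where
  "is_Schur_diff R P V h \<longleftrightarrow>
     h \<in> Hom (MOD R) (Schur R P V) (Schur R P (Prod (MOD R) V V)) \<and>
     (\<forall>\<mu> vs. \<mu> \<in> carrier (ops P (length vs)) \<longrightarrow> set vs \<subseteq> carrier V \<longrightarrow>
        app h (Schur_elem R P V \<mu> vs) =
        (\<Oplus>\<^bsub>Schur R P (Prod (MOD R) V V)\<^esub> i \<in> {..<length vs}.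
           Schur_elem R P (Prod (MOD R) V V) \<mu>
             ((map (app (In1 (MOD R) V V)) vs)[i := app (In2 (MOD R) V V) (vs ! i)])))"

definition Schur_diff :: "('a, 'c) ring_scheme \<Rightarrow> ('a, 'u) operad_data \<Rightarrow>
    ('a, 'u) module \<Rightarrow> ('a, 'u) module_arr" where
  "Schur_diff R P V = (THE h. is_Schur_diff R P V h)"

end

theory Submission
  imports Defs
begin

text \<open>All structure maps are determined by their values on the generators \<open>(\<mu>; v\<^sub>1, \<dots>, v\<^sub>n)\<close>, and a map
  given on generators extends linearly to \<open>S(P, V)\<close> as soon as it is multilinear and invariant under
  permutations. Iterating this in every variable defines the multiplication; its invariance reduces to
  the axioms of the partial compositions, the one under the symmetric group being checked on adjacent
  transpositions. The axioms of the differential combinator then compare sums of generators in which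
  one input is tagged by the second injection: \<open>DC4\<close> is the splitting of the inputs of a composite
  into blocks, and in \<open>DC5\<close> every term with two different tagged positions contains a zero input.\<close>

section \<open>Linear maps and spanning sets\<close>

text \<open>An element of \<open>S(P, S(P, V))\<close> has no canonical expression as an operation
  applied to generators, so the formula for the multiplication does not define a map by itself.
  Different expressions are never compared directly. Instead, agreement of two linear maps, and
  admissibility of a map that depends linearly on a parameter, both cut out submodules, so they hold
  everywhere once they hold on generators. Generators are kept as formal pairs
  (\<open>symbols\<close>) to which the operad identities apply, and are evaluated only afterwards.
  An arbitrary permutation acts on a complete composition through an unwieldy block permutation. An
  adjacent transposition merely exchanges two adjacent blocks, which equivariance and parallel
  associativity give. A second obstacle is size. Tensor products are quotients of free modules whose
  elements are functions into the type of the ring, and that type may be larger than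
  \<open>'u\<close>; an injection into \<open>'u\<close> must still be found for the copy
  \<open>Schur R P V\<close> to make sense.\<close>

definition linear_on ::
    "('a, 'c) ring_scheme \<Rightarrow> ('a, 'b) module \<Rightarrow> ('a, 'd) module \<Rightarrow> ('b \<Rightarrow> 'd) \<Rightarrow> bool" where
  "linear_on R M N f \<longleftrightarrow> (\<forall>x\<in>carrier M. f x \<in> carrier N) \<and>
     (\<forall>x\<in>carrier M. \<forall>y\<in>carrier M. f (x \<oplus>\<^bsub>M\<^esub> y) = f x \<oplus>\<^bsub>N\<^esub> f y) \<and>
     (\<forall>a\<in>carrier R. \<forall>x\<in>carrier M. f (a \<odot>\<^bsub>M\<^esub> x) = a \<odot>\<^bsub>N\<^esub> f x)"

lemma linear_onI:
  assumes "\<And>x. x \<in> carrier M \<Longrightarrow> f x \<in> carrier N"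
    and "\<And>x y. \<lbrakk>x \<in> carrier M; y \<in> carrier M\<rbrakk> \<Longrightarrow> f (x \<oplus>\<^bsub>M\<^esub> y) = f x \<oplus>\<^bsub>N\<^esub> f y"
    and "\<And>a x. \<lbrakk>a \<in> carrier R; x \<in> carrier M\<rbrakk> \<Longrightarrow> f (a \<odot>\<^bsub>M\<^esub> x) = a \<odot>\<^bsub>N\<^esub> f x"
  shows "linear_on R M N f"
  using assms by (auto simp: linear_on_def)

lemma linear_on_closed: "\<lbrakk>linear_on R M N f; x \<in> carrier M\<rbrakk> \<Longrightarrow> f x \<in> carrier N"
  and linear_on_add: "\<lbrakk>linear_on R M N f; x \<in> carrier M; y \<in> carrier M\<rbrakk> \<Longrightarrow>
    f (x \<oplus>\<^bsub>M\<^esub> y) = f x \<oplus>\<^bsub>N\<^esub> f y"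
  and linear_on_smult: "\<lbrakk>linear_on R M N f; a \<in> carrier R; x \<in> carrier M\<rbrakk> \<Longrightarrow>
    f (a \<odot>\<^bsub>M\<^esub> x) = a \<odot>\<^bsub>N\<^esub> f x"
  by (auto simp: linear_on_def)

lemma linear_on_cong:
  assumes "linear_on R M N f" "\<And>x. x \<in> carrier M \<Longrightarrow> f x = g x" "Module.module R M"
  shows "linear_on R M N g"
proof -
  interpret M: Module.module R M by fact
  show ?thesis using assms(1,2) by (auto simp: linear_on_def)
qed

lemma linear_on_zero:
  assumes "linear_on R M N f" "Module.module R M" "Module.module R N"
  shows "f \<zero>\<^bsub>M\<^esub> = \<zero>\<^bsub>N\<^esub>"
proof -
  interpret M: Module.module R M by fact
  interpret N: Module.module R N by fact
  have "f \<zero>\<^bsub>M\<^esub> = f (\<zero>\<^bsub>R\<^esub> \<odot>\<^bsub>M\<^esub> \<zero>\<^bsub>M\<^esub>)" by simp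
  also have "\<dots> = \<zero>\<^bsub>R\<^esub> \<odot>\<^bsub>N\<^esub> f \<zero>\<^bsub>M\<^esub>"
    by (rule linear_on_smult[OF assms(1)]) auto
  also have "\<dots> = \<zero>\<^bsub>N\<^esub>" using linear_on_closed[OF assms(1)] by simp
  finally show ?thesis .
qed

lemma linear_on_uminus:
  assumes "linear_on R M N f" "Module.module R M" "Module.module R N" "x \<in> carrier M"
  shows "f (\<ominus>\<^bsub>M\<^esub> x) = \<ominus>\<^bsub>N\<^esub> f x"
proof -
  interpret M: Module.module R M by fact
  interpret N: Module.module R N by fact
  have "f (\<ominus>\<^bsub>M\<^esub> x) \<oplus>\<^bsub>N\<^esub> f x = f (\<ominus>\<^bsub>M\<^esub> x \<oplus>\<^bsub>M\<^esub> x)"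
    using assms(4) by (simp add: linear_on_add[OF assms(1)])
  also have "\<dots> = \<zero>\<^bsub>N\<^esub>"
    using assms(4) linear_on_zero[OF assms(1-3)] by (simp add: M.l_neg)
  finally show ?thesis
    using assms(4) linear_on_closed[OF assms(1)] by (metis M.add.inv_closed N.add.inv_equality)
qed

lemma linear_on_minus:
  assumes "linear_on R M N f" "Module.module R M" "Module.module R N"
    "x \<in> carrier M" "y \<in> carrier M"
  shows "f (x \<ominus>\<^bsub>M\<^esub> y) = f x \<ominus>\<^bsub>N\<^esub> f y"
proof -
  interpret M: Module.module R M by fact
  show ?thesis
    using assms by (simp add: a_minus_def linear_on_add linear_on_uminus)
qed

lemma module_minus_eq_zero:
  assumes "Module.module R M" "x \<in> carrier M" "y \<in> carrier M" "x \<ominus>\<^bsub>M\<^esub> y = \<zero>\<^bsub>M\<^esub>"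
  shows "x = y"
proof -
  interpret M: Module.module R M by fact
  have "x = (x \<ominus>\<^bsub>M\<^esub> y) \<oplus>\<^bsub>M\<^esub> y" using assms(2,3) by (simp add: a_minus_def M.a_assoc M.l_neg)
  then show ?thesis using assms(3,4) by simp
qed

lemma linear_on_finsum:
  assumes "linear_on R M N f" "Module.module R M" "Module.module R N"
    "finite A" "\<And>i. i \<in> A \<Longrightarrow> g i \<in> carrier M"
  shows "f (\<Oplus>\<^bsub>M\<^esub>i\<in>A. g i) = (\<Oplus>\<^bsub>N\<^esub>i\<in>A. f (g i))"
proof -
  interpret M: Module.module R M by fact
  interpret N: Module.module R N by fact
  show ?thesis using assms(4,5)
  proof (induction A rule: finite_induct)
    case empty
    show ?case by (simp add: linear_on_zero[OF assms(1-3)])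
  next
    case (insert a A)
    then have "g \<in> A \<rightarrow> carrier M" "g a \<in> carrier M"
      "(\<lambda>i. f (g i)) \<in> A \<rightarrow> carrier N" "f (g a) \<in> carrier N"
      using linear_on_closed[OF assms(1)] by auto
    with insert show ?case
      by (simp add: linear_on_add[OF assms(1)])
  qed
qed

lemma linear_on_id: "linear_on R M M (\<lambda>x. x)"
  by (simp add: linear_on_def)

lemma linear_on_compose:
  assumes "linear_on R M N f" "linear_on R N L g"
  shows "linear_on R M L (\<lambda>x. g (f x))"
  using assms by (simp add: linear_on_def)

lemma linear_on_const_zero:
  assumes "Module.module R N"
  shows "linear_on R M N (\<lambda>_. \<zero>\<^bsub>N\<^esub>)"
proof -
  interpret N: Module.module R N by fact
  show ?thesis by (simp add: linear_on_def)
qed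

lemma linear_on_plus:
  assumes "linear_on R M N f" "linear_on R M N g" "Module.module R N"
  shows "linear_on R M N (\<lambda>x. f x \<oplus>\<^bsub>N\<^esub> g x)"
proof -
  interpret N: Module.module R N by fact
  show ?thesis
    using assms(1,2) by (simp add: linear_on_def N.smult_r_distr N.a_ac)
qed

lemma linear_on_scaled:
  assumes "linear_on R M N f" "Module.module R N" "a \<in> carrier R"
  shows "linear_on R M N (\<lambda>x. a \<odot>\<^bsub>N\<^esub> f x)"
proof -
  interpret N: Module.module R N by fact
  show ?thesis
    using assms(1,3) by (auto simp: linear_on_def N.smult_r_distr
      N.smult_assoc1[symmetric] N.R.m_comm)
qed

lemma linear_on_finsum_fun:
  assumes "finite A" "\<And>i. i \<in> A \<Longrightarrow> linear_on R M N (f i)"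
    and "Module.module R M" "Module.module R N"
  shows "linear_on R M N (\<lambda>x. \<Oplus>\<^bsub>N\<^esub>i\<in>A. f i x)"
proof -
  interpret M: Module.module R M by fact
  interpret N: Module.module R N by fact
  show ?thesis using assms(1,2)
  proof (induction A rule: finite_induct)
    case empty
    then show ?case by (simp add: linear_on_const_zero[OF assms(4)])
  next
    case (insert a A)
    have "linear_on R M N (\<lambda>x. f a x \<oplus>\<^bsub>N\<^esub> (\<Oplus>\<^bsub>N\<^esub>i\<in>A. f i x))"
      using insert by (intro linear_on_plus assms(4)) auto
    then show ?case
    proof (rule linear_on_cong[OF _ _ assms(3)])
      fix x assume "x \<in> carrier M"
      then show "f a x \<oplus>\<^bsub>N\<^esub> (\<Oplus>\<^bsub>N\<^esub>i\<in>A. f i x) = (\<Oplus>\<^bsub>N\<^esub>i\<in>insert a A. f i x)"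
        using insert by (subst N.finsum_insert) (auto intro: linear_on_closed)
    qed
  qed
qed

text \<open>Serves twice: it makes linear maps unique on a spanning set, and with \<open>g\<close>
  the zero map it gives the kernel used for quotients by generated submodules.\<close>

lemma submodule_equalizer:
  assumes "linear_on R M N f" "linear_on R M N g" "Module.module R M" "Module.module R N"
  shows "submodule {x \<in> carrier M. f x = g x} R M"
proof -
  interpret M: Module.module R M by fact
  interpret N: Module.module R N by fact
  show ?thesis
    using assms(1,2)
    by (intro M.submoduleI)
      (auto simp: linear_on_zero[OF _ assms(3,4)] linear_on_uminus[OF _ assms(3,4)]
        linear_on_add linear_on_smult)
qed

lemma submodule_zero:
  assumes "submodule H R M" "Module.module R M"
  shows "\<zero>\<^bsub>M\<^esub> \<in> H"
proof -
  interpret M: Module.module R M by fact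
  interpret submodule H R M by fact
  show ?thesis using one_closed by simp
qed

lemma submodule_preimage:
  assumes "linear_on R M N f" "submodule H R N" "Module.module R M" "Module.module R N"
  shows "submodule {x \<in> carrier M. f x \<in> H} R M"
proof -
  interpret M: Module.module R M by fact
  interpret N: Module.module R N by fact
  show ?thesis
    using assms(1) N.submoduleE[OF assms(2)] submodule_zero[OF assms(2,4)]
    by (intro M.submoduleI)
      (auto simp: linear_on_zero[OF _ assms(3,4)] linear_on_uminus[OF _ assms(3,4)]
        linear_on_add linear_on_smult)
qed

text \<open>Phrased through submodules rather than linear combinations: whatever holds on
  \<open>G\<close> and cuts out a submodule holds on the whole module, without any element being
  written as a sum.\<close>

definition spans :: "('a, 'c) ring_scheme \<Rightarrow> ('a, 'b) module \<Rightarrow> 'b set \<Rightarrow> bool" where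
  "spans R M G \<longleftrightarrow> G \<subseteq> carrier M \<and> (\<forall>H. submodule H R M \<longrightarrow> G \<subseteq> H \<longrightarrow> carrier M \<subseteq> H)"

lemma spans_carrier: "spans R M (carrier M)"
  by (simp add: spans_def)

lemma spans_linear_eq:
  assumes "spans R M G" "linear_on R M N f" "linear_on R M N g"
    and "Module.module R M" "Module.module R N"
    and "\<And>x. x \<in> G \<Longrightarrow> f x = g x" "x \<in> carrier M"
  shows "f x = g x"
proof -
  have "G \<subseteq> {x \<in> carrier M. f x = g x}" using assms(1,6) by (auto simp: spans_def)
  then have "carrier M \<subseteq> {x \<in> carrier M. f x = g x}"
    using assms(1) submodule_equalizer[OF assms(2-5)] by (auto simp: spans_def)
  then show ?thesis using assms(7) by auto
qed

lemma spans_image: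
  assumes "spans R M G" "linear_on R M N f" "Module.module R M" "Module.module R N"
    and "carrier N = f ` carrier M"
  shows "spans R N (f ` G)"
  unfolding spans_def
proof (intro conjI allI impI)
  show "f ` G \<subseteq> carrier N" using assms(1,5) by (auto simp: spans_def)
next
  fix H assume H: "submodule H R N" "f ` G \<subseteq> H"
  then have "G \<subseteq> {x \<in> carrier M. f x \<in> H}" using assms(1) by (auto simp: spans_def)
  then have "carrier M \<subseteq> {x \<in> carrier M. f x \<in> H}"
    using assms(1) submodule_preimage[OF assms(2) H(1) assms(3,4)] by (auto simp: spans_def)
  then show "carrier N \<subseteq> H" using assms(5) by auto
qed

lemma submoduleI':
  assumes M: "Module.module R M" and "H \<subseteq> carrier M" "\<zero>\<^bsub>M\<^esub> \<in> H"
    and "\<And>x y. \<lbrakk>x \<in> H; y \<in> H\<rbrakk> \<Longrightarrow> x \<oplus>\<^bsub>M\<^esub> y \<in> H"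
    and smult: "\<And>a x. \<lbrakk>a \<in> carrier R; x \<in> H\<rbrakk> \<Longrightarrow> a \<odot>\<^bsub>M\<^esub> x \<in> H"
  shows "submodule H R M"
proof -
  interpret M: Module.module R M by (rule M)
  have "\<ominus>\<^bsub>M\<^esub> x \<in> H" if "x \<in> H" for x
    using smult[of "\<ominus>\<^bsub>R\<^esub> \<one>\<^bsub>R\<^esub>" x] that assms(2) by (auto simp: M.smult_l_minus)
  with assms show ?thesis by (intro M.submoduleI) auto
qed

text \<open>The image of \<open>X\<close> absorbs scalars, so the sums of lists over
  \<open>X\<close> already form a submodule, which contains the generators. This bounds the number
  of elements by the number of lists over \<open>X\<close>, whatever the size of the ring.\<close>

lemma spans_list_sums:
  assumes M: "Module.module R M" and sp: "spans R M (e ` X)"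
    and sc: "\<And>a s. \<lbrakk>a \<in> carrier R; s \<in> X\<rbrakk> \<Longrightarrow> \<exists>t\<in>X. e t = a \<odot>\<^bsub>M\<^esub> e s"
  shows "carrier M \<subseteq> (\<lambda>ts. foldr (\<lambda>t x. e t \<oplus>\<^bsub>M\<^esub> x) ts \<zero>\<^bsub>M\<^esub>) ` lists X"
proof -
  interpret M: Module.module R M by (rule M)
  let ?f = "\<lambda>ts. foldr (\<lambda>t x. e t \<oplus>\<^bsub>M\<^esub> x) ts \<zero>\<^bsub>M\<^esub>"
  have eX: "e s \<in> carrier M" if "s \<in> X" for s using sp that by (auto simp: spans_def)
  have cl: "?f ts \<in> carrier M" if "ts \<in> lists X" for ts
    using that by (induction ts) (auto simp: eX)
  have app: "?f (ts @ us) = ?f ts \<oplus>\<^bsub>M\<^esub> ?f us" if "ts \<in> lists X" "us \<in> lists X" for ts us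
    using that(1)
  proof (induction ts)
    case (Cons t ts)
    then show ?case using cl[OF Cons.hyps(2)] cl[OF that(2)] by (simp add: M.a_assoc eX)
  qed (simp add: cl[OF that(2)])
  have scl: "\<exists>us\<in>lists X. ?f us = a \<odot>\<^bsub>M\<^esub> ?f ts" if "ts \<in> lists X" and a: "a \<in> carrier R" for ts a
    using that(1)
  proof (induction ts)
    case (Cons t ts)
    obtain u where u: "u \<in> X" "e u = a \<odot>\<^bsub>M\<^esub> e t" using sc[OF a Cons.hyps(1)] by auto
    obtain us where us: "us \<in> lists X" "?f us = a \<odot>\<^bsub>M\<^esub> ?f ts" using Cons by auto
    show ?case
      using u us Cons.hyps a cl[OF Cons.hyps(2)]
      by (intro bexI[of _ "u # us"]) (auto simp: M.smult_r_distr eX)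
  qed (use a in \<open>auto intro: bexI[of _ "[]"]\<close>)
  have "submodule (?f ` lists X) R M"
  proof (rule submoduleI'[OF M])
    show "\<zero>\<^bsub>M\<^esub> \<in> ?f ` lists X" by (rule image_eqI[of _ _ "[]"]) auto
    fix x y assume "x \<in> ?f ` lists X" "y \<in> ?f ` lists X"
    then obtain ts us where *: "ts \<in> lists X" "us \<in> lists X" "x = ?f ts" "y = ?f us" by blast
    then have "x \<oplus>\<^bsub>M\<^esub> y = ?f (ts @ us)" using app by simp
    moreover have "ts @ us \<in> lists X" using * by simp
    ultimately show "x \<oplus>\<^bsub>M\<^esub> y \<in> ?f ` lists X" by (rule image_eqI)
  next
    fix a x assume a: "a \<in> carrier R" and "x \<in> ?f ` lists X"
    then obtain ts where ts: "ts \<in> lists X" "x = ?f ts" by blast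
    obtain us where "us \<in> lists X" "?f us = a \<odot>\<^bsub>M\<^esub> ?f ts" using scl[OF ts(1) a] by blast
    then show "a \<odot>\<^bsub>M\<^esub> x \<in> ?f ` lists X" using ts(2) by (intro image_eqI[of _ _ us]) simp_all
  qed (use cl in blast)
  moreover have "e ` X \<subseteq> ?f ` lists X"
  proof clarify
    fix s assume "s \<in> X"
    then show "e s \<in> ?f ` lists X" by (intro image_eqI[of _ _ "[s]"]) (auto simp: eX)
  qed
  ultimately show ?thesis using sp by (auto simp: spans_def)
qed

section \<open>The module constructions and their universal properties\<close>

lemma mk_module_simps [simp]:
  "carrier (mk_module A z pl sm) = A" "\<zero>\<^bsub>mk_module A z pl sm\<^esub> = z"
  "add (mk_module A z pl sm) = pl" "smult (mk_module A z pl sm) = sm"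
  by (simp_all add: mk_module_def)

text \<open>The module axioms pass along the surjection \<open>\<pi>\<close>. Coset modules and
  transported copies are both instances, so the axioms are verified once for the two.\<close>

lemma module_image:
  assumes "Module.module R M" "carrier Q = \<pi> ` carrier M" "\<pi> \<zero>\<^bsub>M\<^esub> = \<zero>\<^bsub>Q\<^esub>"
    and add: "\<And>x y. \<lbrakk>x \<in> carrier M; y \<in> carrier M\<rbrakk> \<Longrightarrow> \<pi> x \<oplus>\<^bsub>Q\<^esub> \<pi> y = \<pi> (x \<oplus>\<^bsub>M\<^esub> y)"
    and smult: "\<And>a x. \<lbrakk>a \<in> carrier R; x \<in> carrier M\<rbrakk> \<Longrightarrow> a \<odot>\<^bsub>Q\<^esub> \<pi> x = \<pi> (a \<odot>\<^bsub>M\<^esub> x)"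
  shows "Module.module R Q" "linear_on R M Q \<pi>"
proof -
  interpret M: Module.module R M by fact
  show "Module.module R Q"
  proof (rule moduleI)
    show "cring R" by (rule M.is_cring)
    show "abelian_group Q"
    proof (rule abelian_groupI)
      fix x assume "x \<in> carrier Q"
      then obtain m where m: "m \<in> carrier M" "x = \<pi> m" using assms(2) by auto
      show "\<exists>y\<in>carrier Q. y \<oplus>\<^bsub>Q\<^esub> x = \<zero>\<^bsub>Q\<^esub>"
        using m assms(2,3) by (intro bexI[of _ "\<pi> (\<ominus>\<^bsub>M\<^esub> m)"]) (auto simp: add M.l_neg)
    qed (use assms(2) in \<open>auto simp: add assms(3)[symmetric] M.a_ac\<close>)
  qed (use assms(2) in \<open>auto simp: add smult M.smult_l_distr M.smult_r_distr M.smult_assoc1\<close>)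
  show "linear_on R M Q \<pi>"
    using assms(2) by (auto simp: linear_on_def add smult)
qed

subsection \<open>Quotients\<close>

lemma quotient_module_props:
  assumes M: "Module.module R M" and N: "submodule N R M"
  shows quotient_module_module: "Module.module R (quotient_module M N)"
    and quotient_module_linear: "linear_on R M (quotient_module M N) (\<lambda>x. N +>\<^bsub>M\<^esub> x)"
    and quotient_module_carrier: "carrier (quotient_module M N) = (\<lambda>x. N +>\<^bsub>M\<^esub> x) ` carrier M"
    and quotient_module_zero: "\<zero>\<^bsub>quotient_module M N\<^esub> = N"
    and quotient_module_ker: "\<And>x. x \<in> N \<Longrightarrow> N +>\<^bsub>M\<^esub> x = \<zero>\<^bsub>quotient_module M N\<^esub>"
    and quotient_module_eq: "\<And>x y. \<lbrakk>x \<in> carrier M; y \<in> carrier M; N +>\<^bsub>M\<^esub> x = N +>\<^bsub>M\<^esub> y\<rbrakk> \<Longrightarrow>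
      x \<ominus>\<^bsub>M\<^esub> y \<in> N"
proof -
  interpret M: Module.module R M by fact
  interpret N: submodule N R M by fact
  interpret S: abelian_subgroup N M
    by (rule abelian_subgroupI3)
      (auto simp: additive_subgroup_def N.subgroup_axioms M.abelian_group_axioms)
  have NM: "N \<subseteq> carrier M" using M.submoduleE[OF N] by blast
  let ?p = "\<lambda>x. N +>\<^bsub>M\<^esub> x" and ?Q = "quotient_module M N"
  show car: "carrier ?Q = ?p ` carrier M"
    by (auto simp: quotient_module_def A_RCOSETS_def')
  show zero: "\<zero>\<^bsub>?Q\<^esub> = N"
    by (simp add: quotient_module_def)
  show ker: "?p x = \<zero>\<^bsub>?Q\<^esub>" if "x \<in> N" for x
    unfolding zero using that by (simp add: S.a_rcos_const)
  show eq: "x \<ominus>\<^bsub>M\<^esub> y \<in> N" if "x \<in> carrier M" "y \<in> carrier M" "?p x = ?p y" for x y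
    proof -
    have "x \<in> ?p y" using S.a_rcos_self[OF that(1)] that(3) by simp
    then obtain n where n: "n \<in> N" "x = n \<oplus>\<^bsub>M\<^esub> y"
      by (auto simp: a_r_coset_def')
    then have "x \<ominus>\<^bsub>M\<^esub> y = n"
      using that NM by (auto simp: a_minus_def M.a_assoc M.r_neg)
    then show ?thesis using n by simp
  qed
  have add: "?p x \<oplus>\<^bsub>?Q\<^esub> ?p y = ?p (x \<oplus>\<^bsub>M\<^esub> y)" if "x \<in> carrier M" "y \<in> carrier M" for x y
    using that by (simp add: quotient_module_def S.a_rcos_sum)
  have smult: "a \<odot>\<^bsub>?Q\<^esub> ?p x = ?p (a \<odot>\<^bsub>M\<^esub> x)" if "a \<in> carrier R" "x \<in> carrier M" for a x
  proof -
    \<comment> \<open>\<open>quotient_module\<close> multiplies by a scalar by taking a union over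
      all representatives. It is a single coset because every representative contributes the same
      one.\<close>
    have "?p (a \<odot>\<^bsub>M\<^esub> y) = ?p (a \<odot>\<^bsub>M\<^esub> x)" if y: "y \<in> ?p x" for y
    proof -
      obtain n where n: "n \<in> N" "y = n \<oplus>\<^bsub>M\<^esub> x"
        using y by (auto simp: a_r_coset_def')
      then have ay: "a \<odot>\<^bsub>M\<^esub> y = a \<odot>\<^bsub>M\<^esub> n \<oplus>\<^bsub>M\<^esub> a \<odot>\<^bsub>M\<^esub> x" and anN: "a \<odot>\<^bsub>M\<^esub> n \<in> N"
        using NM \<open>a \<in> carrier R\<close> \<open>x \<in> carrier M\<close> by (auto simp: M.smult_r_distr)
      have ax: "a \<odot>\<^bsub>M\<^esub> x \<in> carrier M"
        using \<open>a \<in> carrier R\<close> \<open>x \<in> carrier M\<close> by simp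
      have "?p (a \<odot>\<^bsub>M\<^esub> y) = ?p (a \<odot>\<^bsub>M\<^esub> n) \<oplus>\<^bsub>?Q\<^esub> ?p (a \<odot>\<^bsub>M\<^esub> x)"
        using add[OF subsetD[OF NM anN] ax] ay by simp
      also have "\<dots> = ?p \<zero>\<^bsub>M\<^esub> \<oplus>\<^bsub>?Q\<^esub> ?p (a \<odot>\<^bsub>M\<^esub> x)"
        using ker[OF anN] ker[of "\<zero>\<^bsub>M\<^esub>"] N.one_closed by simp
      also have "\<dots> = ?p (a \<odot>\<^bsub>M\<^esub> x)" using add[OF M.zero_closed ax] ax by simp
      finally show ?thesis .
    qed
    moreover have "x \<in> ?p x" using S.a_rcos_self that by blast
    ultimately have "(\<Union>y\<in>?p x. ?p (a \<odot>\<^bsub>M\<^esub> y)) = ?p (a \<odot>\<^bsub>M\<^esub> x)" by blast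
    then show ?thesis by (simp add: quotient_module_def)
  qed
  have "?p \<zero>\<^bsub>M\<^esub> = \<zero>\<^bsub>?Q\<^esub>" using ker N.one_closed by simp
  from module_image[OF M car this add smult]
  show "Module.module R ?Q" "linear_on R M ?Q ?p" by auto
qed

text \<open>The value on a coset is that of \<open>f\<close> at a chosen representative. Two
  representatives differ by an element of \<open>N\<close>, which \<open>f\<close> kills, so the
  choice does not matter.\<close>

lemma quotient_module_lift:
  assumes M: "Module.module R M" and N: "submodule N R M" and L: "Module.module R L"
    and f: "linear_on R M L f" and ker: "\<And>x. x \<in> N \<Longrightarrow> f x = \<zero>\<^bsub>L\<^esub>"
  shows "\<exists>h. linear_on R (quotient_module M N) L h \<and> (\<forall>x\<in>carrier M. h (N +>\<^bsub>M\<^esub> x) = f x)"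
proof -
  interpret M: Module.module R M by fact
  interpret L: Module.module R L by fact
  let ?p = "\<lambda>x. N +>\<^bsub>M\<^esub> x" and ?Q = "quotient_module M N"
  note Q = quotient_module_props[OF M N]
  define h where "h K = f (SOME x. x \<in> carrier M \<and> ?p x = K)" for K
  have h: "h (?p x) = f x" if x: "x \<in> carrier M" for x
  proof -
    define y where "y = (SOME y. y \<in> carrier M \<and> ?p y = ?p x)"
    have y: "y \<in> carrier M \<and> ?p y = ?p x"
      unfolding y_def by (rule someI[of _ x]) (simp add: x)
    then have "f y \<ominus>\<^bsub>L\<^esub> f x = \<zero>\<^bsub>L\<^esub>"
      using ker[OF Q(6)[of y x]] x linear_on_minus[OF f M L, of y x] by simp
    then have "f y = f x"
      using linear_on_closed[OF f] x y module_minus_eq_zero[OF L] by blast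
    then show ?thesis by (simp add: h_def y_def)
  qed
  have "linear_on R ?Q L h"
  proof (rule linear_onI)
    fix x y assume "x \<in> carrier ?Q" "y \<in> carrier ?Q"
    then obtain x' y' where xy: "x' \<in> carrier M" "y' \<in> carrier M" "x = ?p x'" "y = ?p y'"
      unfolding Q(3) by auto
    then have "x \<oplus>\<^bsub>?Q\<^esub> y = ?p (x' \<oplus>\<^bsub>M\<^esub> y')" by (simp add: linear_on_add[OF Q(2)])
    then show "h (x \<oplus>\<^bsub>?Q\<^esub> y) = h x \<oplus>\<^bsub>L\<^esub> h y" using xy by (simp add: h linear_on_add[OF f])
  next
    fix a x assume a: "a \<in> carrier R" and "x \<in> carrier ?Q"
    then obtain x' where xy: "x' \<in> carrier M" "x = ?p x'"
      unfolding Q(3) by auto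
    then have "a \<odot>\<^bsub>?Q\<^esub> x = ?p (a \<odot>\<^bsub>M\<^esub> x')" using a by (simp add: linear_on_smult[OF Q(2)])
    then show "h (a \<odot>\<^bsub>?Q\<^esub> x) = a \<odot>\<^bsub>L\<^esub> h x" using xy a by (simp add: h linear_on_smult[OF f])
  qed (auto simp: Q(3) h linear_on_closed[OF f])
  then show ?thesis using h by blast
qed

lemma generated_submodule_props:
  assumes M: "Module.module R M" and G: "G \<subseteq> carrier M"
  shows generated_submodule_submodule: "submodule (generated_submodule R M G) R M"
    and generated_submodule_incl: "G \<subseteq> generated_submodule R M G"
    and generated_submodule_least:
      "\<And>H. \<lbrakk>submodule H R M; G \<subseteq> H\<rbrakk> \<Longrightarrow> generated_submodule R M G \<subseteq> H"
proof -
  interpret M: Module.module R M by fact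
  let ?S = "{N. submodule N R M \<and> G \<subseteq> N}"
  have c: "carrier M \<in> ?S" using G M.carrier_is_submodule by simp
  have "submodule (\<Inter>?S) R M"
  proof (rule M.submoduleI)
    show "\<Inter>?S \<subseteq> carrier M" using c by blast
    show "\<zero>\<^bsub>M\<^esub> \<in> \<Inter>?S" using submodule_zero[OF _ M] by auto
  qed (simp_all add: M.submoduleE(3-5))
  then show "submodule (generated_submodule R M G) R M"
    by (simp add: generated_submodule_def)
qed (auto simp: generated_submodule_def)

text \<open>The interface through which quotients are used: relations are differences lying in
  \<open>G\<close>, and a map descends as soon as it kills \<open>G\<close>, because its kernel is a
  submodule. It is applied to the multilinearity relations and then, on the tensor product, to the
  permutation relations.\<close>

lemma generated_quotient_props:
  fixes G M R
  defines "N \<equiv> generated_submodule R M G"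
  assumes M: "Module.module R M" and G: "G \<subseteq> carrier M"
  shows generated_quotient_module: "Module.module R (quotient_module M N)"
    and generated_quotient_linear: "linear_on R M (quotient_module M N) (\<lambda>x. N +>\<^bsub>M\<^esub> x)"
    and generated_quotient_spans:
      "\<And>B. spans R M B \<Longrightarrow> spans R (quotient_module M N) ((\<lambda>x. N +>\<^bsub>M\<^esub> x) ` B)"
    and generated_quotient_eq: "\<And>x y. \<lbrakk>x \<in> carrier M; y \<in> carrier M; x \<ominus>\<^bsub>M\<^esub> y \<in> G\<rbrakk> \<Longrightarrow>
      N +>\<^bsub>M\<^esub> x = N +>\<^bsub>M\<^esub> y"
    and generated_quotient_lift: "\<And>L f. \<lbrakk>Module.module R L; linear_on R M L f;
        \<And>x. x \<in> G \<Longrightarrow> f x = \<zero>\<^bsub>L\<^esub>\<rbrakk> \<Longrightarrow>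
      \<exists>h. linear_on R (quotient_module M N) L h \<and> (\<forall>x\<in>carrier M. h (N +>\<^bsub>M\<^esub> x) = f x)"
proof -
  interpret M: Module.module R M by fact
  note gs = generated_submodule_props[OF M G, folded N_def]
  note Q = quotient_module_props[OF M gs(1)]
  let ?Q = "quotient_module M N"
  show "Module.module R ?Q" "linear_on R M ?Q (\<lambda>x. N +>\<^bsub>M\<^esub> x)" by (fact Q)+
  show "spans R ?Q ((\<lambda>x. N +>\<^bsub>M\<^esub> x) ` B)" if "spans R M B" for B
    by (rule spans_image[OF that Q(2) M Q(1) Q(3)])
  show "N +>\<^bsub>M\<^esub> x = N +>\<^bsub>M\<^esub> y" if xy: "x \<in> carrier M" "y \<in> carrier M" "x \<ominus>\<^bsub>M\<^esub> y \<in> G" for x y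
  proof -
    interpret Q: Module.module R ?Q by (fact Q)
    have "(N +>\<^bsub>M\<^esub> x) \<ominus>\<^bsub>?Q\<^esub> (N +>\<^bsub>M\<^esub> y) = \<zero>\<^bsub>?Q\<^esub>"
      using linear_on_minus[OF Q(2) M Q(1) xy(1,2)] Q(5)[of "x \<ominus>\<^bsub>M\<^esub> y"] gs(2) xy(3) by auto
    then show ?thesis
      using linear_on_closed[OF Q(2)] xy module_minus_eq_zero[OF Q(1)] by blast
  qed
  show "\<exists>h. linear_on R ?Q L h \<and> (\<forall>x\<in>carrier M. h (N +>\<^bsub>M\<^esub> x) = f x)"
    if L: "Module.module R L" and f: "linear_on R M L f" and z: "\<And>x. x \<in> G \<Longrightarrow> f x = \<zero>\<^bsub>L\<^esub>" for L f
  proof (rule quotient_module_lift[OF M gs(1) L f])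
    have "submodule {x \<in> carrier M. f x = \<zero>\<^bsub>L\<^esub>} R M"
      by (rule submodule_equalizer[OF f linear_on_const_zero[OF L] M L])
    then have "N \<subseteq> {x \<in> carrier M. f x = \<zero>\<^bsub>L\<^esub>}"
      by (rule gs(3)) (use G z in auto)
    then show "f x = \<zero>\<^bsub>L\<^esub>" if "x \<in> N" for x using that by blast
  qed
qed

subsection \<open>Free modules\<close>

lemma free_module_simps:
  "carrier (free_module R X) =
     {c. (\<forall>x. c x \<in> carrier R) \<and> finite {x. c x \<noteq> \<zero>\<^bsub>R\<^esub>} \<and> {x. c x \<noteq> \<zero>\<^bsub>R\<^esub>} \<subseteq> X}"
  "\<zero>\<^bsub>free_module R X\<^esub> = (\<lambda>_. \<zero>\<^bsub>R\<^esub>)"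
  "c \<oplus>\<^bsub>free_module R X\<^esub> d = (\<lambda>x. c x \<oplus>\<^bsub>R\<^esub> d x)"
  "a \<odot>\<^bsub>free_module R X\<^esub> c = (\<lambda>x. a \<otimes>\<^bsub>R\<^esub> c x)"
  by (simp_all add: free_module_def)

context cring
begin

lemma free_module_module: "Module.module R (free_module R X)"
proof (rule moduleI)
  let ?F = "free_module R X"
  have supp: "finite {x. h x \<noteq> \<zero>} \<and> {x. h x \<noteq> \<zero>} \<subseteq> X"
    if "{x. h x \<noteq> \<zero>} \<subseteq> {x. c x \<noteq> \<zero>} \<union> {x. d x \<noteq> \<zero>}" "c \<in> carrier ?F" "d \<in> carrier ?F" for c d h
    using that by (auto simp: free_module_simps intro: finite_subset)
  show "cring R" by (rule is_cring)
  show "abelian_group ?F"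
  proof (rule abelian_groupI)
    fix c d assume cd: "c \<in> carrier ?F" "d \<in> carrier ?F"
    have "finite {x. c x \<oplus> d x \<noteq> \<zero>} \<and> {x. c x \<oplus> d x \<noteq> \<zero>} \<subseteq> X"
      by (rule supp[OF _ cd]) auto
    then show "c \<oplus>\<^bsub>?F\<^esub> d \<in> carrier ?F" using cd by (simp add: free_module_simps)
  next
    fix c assume c: "c \<in> carrier ?F"
    have "finite {x. \<ominus> c x \<noteq> \<zero>} \<and> {x. \<ominus> c x \<noteq> \<zero>} \<subseteq> X"
      by (rule supp[OF _ c c]) auto
    then show "\<exists>y\<in>carrier ?F. y \<oplus>\<^bsub>?F\<^esub> c = \<zero>\<^bsub>?F\<^esub>"
      using c by (intro bexI[of _ "\<lambda>x. \<ominus> c x"]) (auto simp: free_module_simps l_neg)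
  qed (auto simp: free_module_simps fun_eq_iff a_ac)
  fix a c assume ac: "a \<in> carrier R" "c \<in> carrier ?F"
  have "finite {x. a \<otimes> c x \<noteq> \<zero>} \<and> {x. a \<otimes> c x \<noteq> \<zero>} \<subseteq> X"
    by (rule supp[OF _ ac(2) ac(2)]) (use ac in auto)
  then show "a \<odot>\<^bsub>?F\<^esub> c \<in> carrier ?F" using ac by (simp add: free_module_simps)
qed (auto simp: free_module_simps fun_eq_iff l_distr r_distr m_assoc)

lemma free_basis_closed: "x \<in> X \<Longrightarrow> free_basis R x \<in> carrier (free_module R X)"
  by (auto simp: free_module_simps free_basis_def intro: finite_subset[of _ "{x}"])

lemma free_module_decomp:
  assumes "c \<in> carrier (free_module R X)"
  shows "c = (\<lambda>y. if y = x then \<zero> else c y) \<oplus>\<^bsub>free_module R X\<^esub>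
    c x \<odot>\<^bsub>free_module R X\<^esub> free_basis R x"
  using assms by (auto simp: free_module_simps free_basis_def fun_eq_iff)

text \<open>Induction over a finite set containing the support, one coordinate being split off at a
  time by \<open>free_module_decomp\<close>.\<close>

lemma free_module_spans: "spans R (free_module R X) (free_basis R ` X)"
  unfolding spans_def
proof (intro conjI allI impI)
  let ?F = "free_module R X"
  show "free_basis R ` X \<subseteq> carrier ?F" using free_basis_closed by auto
  interpret F: Module.module R ?F by (rule free_module_module)
  fix H assume H: "submodule H R ?F" "free_basis R ` X \<subseteq> H"
  note HE = F.submoduleE[OF H(1)]
  have "c \<in> H" if "finite A" "A \<subseteq> X" "c \<in> carrier ?F" "{x. c x \<noteq> \<zero>} \<subseteq> A" for A c
    using that
  proof (induction A arbitrary: c rule: finite_induct)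
    case empty
    then have "c = \<zero>\<^bsub>?F\<^esub>" by (auto simp: free_module_simps)
    then show ?case using submodule_zero[OF H(1) free_module_module] by simp
  next
    case (insert a A)
    let ?c = "\<lambda>y. if y = a then \<zero> else c y"
    have "?c \<in> carrier ?F"
      using insert.prems(2) by (auto simp: free_module_simps intro: finite_subset[of _ "{x. c x \<noteq> \<zero>}"])
    then have "?c \<in> H" using insert.prems by (intro insert.IH) auto
    moreover have "c a \<odot>\<^bsub>?F\<^esub> free_basis R a \<in> H"
      using H(2) insert.prems by (intro HE(4)) (auto simp: free_module_simps)
    ultimately show ?case
      using HE(5) free_module_decomp[OF insert.prems(2), of a] by metis
  qed
  then show "carrier ?F \<subseteq> H" by (auto simp: free_module_simps)
qed

lemma free_module_lift:
  assumes L: "Module.module R L" and g: "\<And>x. x \<in> X \<Longrightarrow> g x \<in> carrier L"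
  shows "\<exists>h. linear_on R (free_module R X) L h \<and> (\<forall>x\<in>X. h (free_basis R x) = g x)"
proof -
  interpret L: Module.module R L by fact
  let ?F = "free_module R X"
  define h where "h c = (\<Oplus>\<^bsub>L\<^esub>x\<in>{x. c x \<noteq> \<zero>}. c x \<odot>\<^bsub>L\<^esub> g x)" for c
  \<comment> \<open>The sum over the support may be taken over any larger finite part of
    \<open>X\<close>. This lets \<open>c\<close>, \<open>d\<close> and their sum, whose supports
    differ, share one index set.\<close>
  have h: "h c = (\<Oplus>\<^bsub>L\<^esub>x\<in>A. c x \<odot>\<^bsub>L\<^esub> g x)"
    if "finite A" "A \<subseteq> X" "c \<in> carrier ?F" "{x. c x \<noteq> \<zero>} \<subseteq> A" for A c
    unfolding h_def
    by (rule L.add.finprod_mono_neutral_cong_left)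
      (use that g in \<open>auto simp: free_module_simps Pi_def subset_iff\<close>)
  have "linear_on R ?F L h"
  proof (rule linear_onI)
    fix c d assume cd: "c \<in> carrier ?F" "d \<in> carrier ?F"
    let ?A = "{x. c x \<noteq> \<zero>} \<union> {x. d x \<noteq> \<zero>}"
    have A: "finite ?A" "?A \<subseteq> X" using cd by (auto simp: free_module_simps)
    interpret F: Module.module R ?F by (rule free_module_module)
    have s: "c \<oplus>\<^bsub>?F\<^esub> d \<in> carrier ?F" using cd by simp
    show "h (c \<oplus>\<^bsub>?F\<^esub> d) = h c \<oplus>\<^bsub>L\<^esub> h d"
      unfolding h[OF A s] h[OF A cd(1)] h[OF A cd(2)]
    proof (subst h[OF A s])
      show "{x. (c \<oplus>\<^bsub>?F\<^esub> d) x \<noteq> \<zero>} \<subseteq> ?A" using cd by (auto simp: free_module_simps)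
      have cR: "c x \<in> carrier R" "d x \<in> carrier R" for x using cd by (auto simp: free_module_simps)
      have gA: "g x \<in> carrier L" if "x \<in> ?A" for x using A g that by blast
      have "(\<Oplus>\<^bsub>L\<^esub>x\<in>?A. (c \<oplus>\<^bsub>?F\<^esub> d) x \<odot>\<^bsub>L\<^esub> g x) =
        (\<Oplus>\<^bsub>L\<^esub>x\<in>?A. c x \<odot>\<^bsub>L\<^esub> g x \<oplus>\<^bsub>L\<^esub> d x \<odot>\<^bsub>L\<^esub> g x)"
        using cR gA by (intro L.finsum_cong') (auto simp: free_module_simps L.smult_l_distr)
      also have "\<dots> = (\<Oplus>\<^bsub>L\<^esub>x\<in>?A. c x \<odot>\<^bsub>L\<^esub> g x) \<oplus>\<^bsub>L\<^esub> (\<Oplus>\<^bsub>L\<^esub>x\<in>?A. d x \<odot>\<^bsub>L\<^esub> g x)"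
        using cR gA by (intro L.finsum_addf) auto
      finally show "(\<Oplus>\<^bsub>L\<^esub>x\<in>?A. (c \<oplus>\<^bsub>?F\<^esub> d) x \<odot>\<^bsub>L\<^esub> g x) = h c \<oplus>\<^bsub>L\<^esub> h d"
        using h[OF A cd(1)] h[OF A cd(2)] by simp
    qed
  next
    fix a c assume ac: "a \<in> carrier R" "c \<in> carrier ?F"
    let ?A = "{x. c x \<noteq> \<zero>}"
    have A: "finite ?A" "?A \<subseteq> X" using ac by (auto simp: free_module_simps)
    interpret F: Module.module R ?F by (rule free_module_module)
    have s: "a \<odot>\<^bsub>?F\<^esub> c \<in> carrier ?F" using ac by simp
    have cR: "c x \<in> carrier R" for x using ac by (auto simp: free_module_simps)
    have gA: "g x \<in> carrier L" if "x \<in> ?A" for x using A g that by blast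
    have "h (a \<odot>\<^bsub>?F\<^esub> c) = (\<Oplus>\<^bsub>L\<^esub>x\<in>?A. (a \<odot>\<^bsub>?F\<^esub> c) x \<odot>\<^bsub>L\<^esub> g x)"
      by (rule h[OF A s]) (use ac in \<open>auto simp: free_module_simps\<close>)
    also have "\<dots> = (\<Oplus>\<^bsub>L\<^esub>x\<in>?A. a \<odot>\<^bsub>L\<^esub> (c x \<odot>\<^bsub>L\<^esub> g x))"
      using cR gA ac by (intro L.finsum_cong') (auto simp: free_module_simps L.smult_assoc1)
    also have "\<dots> = a \<odot>\<^bsub>L\<^esub> h c"
      unfolding h_def using cR gA ac A by (intro L.finsum_smult_ldistr[symmetric]) auto
    finally show "h (a \<odot>\<^bsub>?F\<^esub> c) = a \<odot>\<^bsub>L\<^esub> h c" .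
  next
    fix c assume "c \<in> carrier ?F"
    then show "h c \<in> carrier L" unfolding h_def
      using g by (intro L.finsum_closed) (auto simp: free_module_simps)
  qed
  moreover have "h (free_basis R x) = g x" if x: "x \<in> X" for x
  proof -
    have "h (free_basis R x) = (\<Oplus>\<^bsub>L\<^esub>y\<in>{x}. free_basis R x y \<odot>\<^bsub>L\<^esub> g y)"
      by (rule h) (use x in \<open>auto simp: free_basis_closed\<close>, auto simp: free_basis_def split: if_splits)
    also have "\<dots> = g x" using g[OF x] by (simp add: free_basis_def)
    finally show ?thesis .
  qed
  ultimately show ?thesis by blast
qed

end

subsection \<open>Tensor products\<close>

lemma listset_iff: "xs \<in> listset As \<longleftrightarrow> length xs = length As \<and> (\<forall>i<length As. xs ! i \<in> As ! i)"
proof (induction As arbitrary: xs)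
  case (Cons A As)
  show ?case
    by (cases xs) (auto simp: set_Cons_def Cons.IH nth_Cons less_Suc_eq_0_disj split: nat.splits)
qed auto

lemma listset_replicate: "xs \<in> listset (replicate n A) \<longleftrightarrow> length xs = n \<and> set xs \<subseteq> A"
  by (auto simp: listset_iff set_conv_nth)

lemma listset_update:
  "\<lbrakk>xs \<in> listset As; i < length As; x \<in> As ! i\<rbrakk> \<Longrightarrow> xs[i := x] \<in> listset As"
  by (auto simp: listset_iff nth_list_update)

text \<open>Membership of the values is a separate clause: for an empty list of factors there is no
  variable whose linearity would imply it.\<close>

definition multilinear_on ::
    "('a, 'c) ring_scheme \<Rightarrow> ('a, 'b) module list \<Rightarrow> ('a, 'd) module \<Rightarrow> ('b list \<Rightarrow> 'd) \<Rightarrow> bool" where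
  "multilinear_on R Ms N F \<longleftrightarrow> (\<forall>xs\<in>listset (map carrier Ms). F xs \<in> carrier N \<and>
     (\<forall>i<length Ms. linear_on R (Ms ! i) N (\<lambda>x. F (xs[i := x]))))"

context cring
begin

context
  fixes Ms :: "('a, 'd) module list"
  assumes Ms: "\<forall>M\<in>set Ms. Module.module R M"
begin

lemma tensor_relations_subset:
  "tensor_relations R Ms \<subseteq> carrier (free_module R (listset (map carrier Ms)))"
proof -
  let ?T = "listset (map carrier Ms)"
  interpret F: Module.module R "free_module R ?T" by (rule free_module_module)
  have b: "free_basis R (xs[i := x]) \<in> carrier (free_module R ?T)"
    if "xs \<in> ?T" "i < length Ms" "x \<in> carrier (Ms ! i)" for xs i x
    using that by (intro free_basis_closed listset_update) auto
  have *: "x \<oplus>\<^bsub>Ms ! i\<^esub> y \<in> carrier (Ms ! i)" "a \<odot>\<^bsub>Ms ! i\<^esub> x \<in> carrier (Ms ! i)"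
    if "i < length Ms" "x \<in> carrier (Ms ! i)" "y \<in> carrier (Ms ! i)" "a \<in> carrier R" for i x y a
  proof -
    interpret Mi: Module.module R "Ms ! i" using Ms that by simp
    show "x \<oplus>\<^bsub>Ms ! i\<^esub> y \<in> carrier (Ms ! i)" "a \<odot>\<^bsub>Ms ! i\<^esub> x \<in> carrier (Ms ! i)"
      using that by auto
  qed
  show ?thesis
    unfolding tensor_relations_def Let_def
    by (auto intro!: F.minus_closed F.a_closed F.smult_closed b *)
qed

lemmas tensor_quotient = generated_quotient_props[OF free_module_module tensor_relations_subset,
    folded tensor_kernel_def, folded tensor_module_def]

lemma tensor_module_module: "Module.module R (tensor_module R Ms)"
  by (rule tensor_quotient(1))

lemma pure_tensor_multilinear: "multilinear_on R Ms (tensor_module R Ms) (pure_tensor R Ms)"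
proof -
  let ?T = "listset (map carrier Ms)"
  let ?F = "free_module R ?T"
  let ?p = "\<lambda>x. tensor_kernel R Ms +>\<^bsub>?F\<^esub> x"
  interpret F: Module.module R ?F by (rule free_module_module)
  have b: "free_basis R (xs[i := x]) \<in> carrier ?F"
    if "xs \<in> ?T" "i < length Ms" "x \<in> carrier (Ms ! i)" for xs i x
    using that by (intro free_basis_closed listset_update) auto
  have lin: "linear_on R (Ms ! i) (tensor_module R Ms) (\<lambda>x. pure_tensor R Ms (xs[i := x]))"
    if xs: "xs \<in> ?T" and i: "i < length Ms" for xs i
  proof (rule linear_onI)
    interpret Mi: Module.module R "Ms ! i" using Ms i by simp
    fix x assume x: "x \<in> carrier (Ms ! i)"
    show "pure_tensor R Ms (xs[i := x]) \<in> carrier (tensor_module R Ms)"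
      unfolding pure_tensor_def by (rule linear_on_closed[OF tensor_quotient(2) b[OF xs i x]])
    show "pure_tensor R Ms (xs[i := a \<odot>\<^bsub>Ms ! i\<^esub> x]) =
        a \<odot>\<^bsub>tensor_module R Ms\<^esub> pure_tensor R Ms (xs[i := x])" if a: "a \<in> carrier R" for a
      unfolding pure_tensor_def linear_on_smult[OF tensor_quotient(2) a b[OF xs i x], symmetric]
    proof (rule tensor_quotient(4))
      show "free_basis R (xs[i := a \<odot>\<^bsub>Ms ! i\<^esub> x]) \<ominus>\<^bsub>?F\<^esub> a \<odot>\<^bsub>?F\<^esub> free_basis R (xs[i := x])
        \<in> tensor_relations R Ms"
        unfolding tensor_relations_def Let_def using xs i x a by blast
    qed (use b xs i x a in auto)
    fix y assume y: "y \<in> carrier (Ms ! i)"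
    show "pure_tensor R Ms (xs[i := x \<oplus>\<^bsub>Ms ! i\<^esub> y]) =
        pure_tensor R Ms (xs[i := x]) \<oplus>\<^bsub>tensor_module R Ms\<^esub> pure_tensor R Ms (xs[i := y])"
      unfolding pure_tensor_def
        linear_on_add[OF tensor_quotient(2) b[OF xs i x] b[OF xs i y], symmetric]
    proof (rule tensor_quotient(4))
      show "free_basis R (xs[i := x \<oplus>\<^bsub>Ms ! i\<^esub> y]) \<ominus>\<^bsub>?F\<^esub>
          (free_basis R (xs[i := x]) \<oplus>\<^bsub>?F\<^esub> free_basis R (xs[i := y])) \<in> tensor_relations R Ms"
        unfolding tensor_relations_def Let_def using xs i x y by blast
    qed (use b xs i x y in auto)
  qed
  have "pure_tensor R Ms xs \<in> carrier (tensor_module R Ms)" if "xs \<in> ?T" for xs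
    unfolding pure_tensor_def
    by (rule linear_on_closed[OF tensor_quotient(2) free_basis_closed[OF that]])
  with lin show ?thesis by (simp add: multilinear_on_def)
qed

lemma pure_tensor_spans:
  "spans R (tensor_module R Ms) (pure_tensor R Ms ` listset (map carrier Ms))"
  using tensor_quotient(3)[OF free_module_spans] by (simp add: image_image pure_tensor_def[abs_def])

text \<open>\<open>F\<close> is first extended to the free module on tuples. There, additivity and
  homogeneity in each variable say precisely that the two families of relations are sent to
  zero.\<close>

lemma tensor_module_lift:
  assumes N: "Module.module R N" and F: "multilinear_on R Ms N F"
  shows "\<exists>h. linear_on R (tensor_module R Ms) N h \<and>
    (\<forall>xs\<in>listset (map carrier Ms). h (pure_tensor R Ms xs) = F xs)"
proof -
  let ?T = "listset (map carrier Ms)"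
  let ?F = "free_module R ?T"
  interpret F: Module.module R ?F by (rule free_module_module)
  interpret N: Module.module R N by (rule N)
  obtain f where f: "linear_on R ?F N f" "\<And>xs. xs \<in> ?T \<Longrightarrow> f (free_basis R xs) = F xs"
    using free_module_lift[OF N, of ?T F] F by (auto simp: multilinear_on_def)
  have b: "xs[i := x] \<in> ?T" if "xs \<in> ?T" "i < length Ms" "x \<in> carrier (Ms ! i)" for xs i x
    using that by (intro listset_update) auto
  have *: "x \<oplus>\<^bsub>Ms ! i\<^esub> y \<in> carrier (Ms ! i)" "a \<odot>\<^bsub>Ms ! i\<^esub> x \<in> carrier (Ms ! i)"
    if "i < length Ms" "x \<in> carrier (Ms ! i)" "y \<in> carrier (Ms ! i)" "a \<in> carrier R" for i x y a
  proof -
    interpret Mi: Module.module R "Ms ! i" using Ms that by simp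
    show "x \<oplus>\<^bsub>Ms ! i\<^esub> y \<in> carrier (Ms ! i)" "a \<odot>\<^bsub>Ms ! i\<^esub> x \<in> carrier (Ms ! i)"
      using that by auto
  qed
  have F_lin: "linear_on R (Ms ! i) N (\<lambda>x. F (xs[i := x]))" if "xs \<in> ?T" "i < length Ms" for xs i
    using F that by (auto simp: multilinear_on_def)
  have F_cl: "F xs \<in> carrier N" if "xs \<in> ?T" for xs
    using F that by (auto simp: multilinear_on_def)
  have "f r = \<zero>\<^bsub>N\<^esub>" if "r \<in> tensor_relations R Ms" for r
  proof -
    from that consider
      (add) xs i x y where "r = free_basis R (xs[i := x \<oplus>\<^bsub>Ms ! i\<^esub> y]) \<ominus>\<^bsub>?F\<^esub>
          (free_basis R (xs[i := x]) \<oplus>\<^bsub>?F\<^esub> free_basis R (xs[i := y]))"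
        "xs \<in> ?T" "i < length Ms" "x \<in> carrier (Ms ! i)" "y \<in> carrier (Ms ! i)"
      | (smult) xs i a x where
        "r = free_basis R (xs[i := a \<odot>\<^bsub>Ms ! i\<^esub> x]) \<ominus>\<^bsub>?F\<^esub> a \<odot>\<^bsub>?F\<^esub> free_basis R (xs[i := x])"
        "xs \<in> ?T" "i < length Ms" "a \<in> carrier R" "x \<in> carrier (Ms ! i)"
      unfolding tensor_relations_def Let_def by blast
    then show ?thesis
    proof cases
      case add
      then show ?thesis
        using linear_on_add[OF F_lin[OF add(2,3)] add(4,5)]
        by (simp add: a_minus_def linear_on_uminus[OF f(1) free_module_module N] linear_on_add[OF f(1)] f(2) b
          free_basis_closed *(1)[OF _ _ _ one_closed] N.r_neg F_cl)
    next
      case smult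
      then show ?thesis
        using linear_on_smult[OF F_lin[OF smult(2,3)] smult(4,5)]
        by (simp add: a_minus_def linear_on_uminus[OF f(1) free_module_module N] linear_on_add[OF f(1)] linear_on_smult[OF f(1)] f(2) b
          free_basis_closed * N.r_neg F_cl)
    qed
  qed
  from tensor_quotient(5)[OF N f(1) this] obtain h where h: "linear_on R (tensor_module R Ms) N h"
    "\<And>c. c \<in> carrier ?F \<Longrightarrow> h (tensor_kernel R Ms +>\<^bsub>?F\<^esub> c) = f c" by blast
  have "h (pure_tensor R Ms xs) = F xs" if "xs \<in> ?T" for xs
    unfolding pure_tensor_def h(2)[OF free_basis_closed[OF that]] by (rule f(2)[OF that])
  then show ?thesis using h(1) by blast
qed

end

end

subsection \<open>Multilinear maps on a power\<close>

lemma multilinear_on_replicate: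
  "multilinear_on R (replicate k M) N F \<longleftrightarrow> (\<forall>xs. length xs = k \<longrightarrow> set xs \<subseteq> carrier M \<longrightarrow>
     F xs \<in> carrier N \<and> (\<forall>i<k. linear_on R M N (\<lambda>x. F (xs[i := x]))))"
  by (auto simp: multilinear_on_def listset_replicate)

lemma multilinear_on_replicateD:
  assumes "multilinear_on R (replicate k M) N F" "length xs = k" "set xs \<subseteq> carrier M"
  shows "F xs \<in> carrier N" "\<And>i. i < k \<Longrightarrow> linear_on R M N (\<lambda>x. F (xs[i := x]))"
  using assms by (auto simp: multilinear_on_replicate)

text \<open>Replace the entries by elements of \<open>G\<close> one at a time.\<close>

lemma spans_list_induct:
  assumes sp: "spans R M G"
    and step: "\<And>xs i. \<lbrakk>length xs = k; set xs \<subseteq> carrier M; i < k\<rbrakk> \<Longrightarrow>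
      submodule {x \<in> carrier M. Q (xs[i := x])} R M"
    and base: "\<And>xs. \<lbrakk>length xs = k; set xs \<subseteq> G\<rbrakk> \<Longrightarrow> Q xs"
    and xs: "length xs = k" "set xs \<subseteq> carrier M"
  shows "Q xs"
proof -
  have GM: "G \<subseteq> carrier M" using sp by (simp add: spans_def)
  have "Q xs" if "j \<le> k" "length xs = k" "set xs \<subseteq> carrier M" "set (drop j xs) \<subseteq> G" for j xs
    using that
  proof (induction j arbitrary: xs)
    case 0
    then show ?case by (intro base) auto
  next
    case (Suc j)
    have "Q (xs[j := x])" if "x \<in> G" for x
    proof (rule Suc.IH)
      show "set (xs[j := x]) \<subseteq> carrier M"
        using Suc.prems that GM set_update_subset_insert[of xs j x] by blast
      have "drop j (xs[j := x]) = x # drop (Suc j) xs"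
        using Suc.prems by (simp add: Cons_nth_drop_Suc[symmetric])
      then show "set (drop j (xs[j := x])) \<subseteq> G" using Suc.prems that by simp
    qed (use Suc.prems in auto)
    then have "G \<subseteq> {x \<in> carrier M. Q (xs[j := x])}" using GM by auto
    moreover have "submodule {x \<in> carrier M. Q (xs[j := x])} R M"
      using Suc.prems by (intro step) auto
    ultimately have "carrier M \<subseteq> {x \<in> carrier M. Q (xs[j := x])}"
      using sp unfolding spans_def by blast
    moreover have "xs ! j \<in> carrier M" using Suc.prems by (auto dest: nth_mem)
    ultimately have "Q (xs[j := xs ! j])" by blast
    then show ?case by simp
  qed
  from this[of k xs] xs show ?thesis by simp
qed

text \<open>With all other entries fixed, the agreement of \<open>F\<close> and \<open>F'\<close> is
  an equalizer of linear maps, so the entries can be replaced by generators in turn.\<close>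

lemma multilinear_on_eqI:
  assumes sp: "spans R M G" and M: "Module.module R M" and N: "Module.module R N"
    and F: "multilinear_on R (replicate k M) N F" "multilinear_on R (replicate k M) N F'"
    and eq: "\<And>xs. \<lbrakk>length xs = k; set xs \<subseteq> G\<rbrakk> \<Longrightarrow> F xs = F' xs"
    and xs: "length xs = k" "set xs \<subseteq> carrier M"
  shows "F xs = F' xs"
proof (rule spans_list_induct[OF sp _ eq xs])
  fix xs i assume *: "length xs = k" "set xs \<subseteq> carrier M" "i < k"
  show "submodule {x \<in> carrier M. F (xs[i := x]) = F' (xs[i := x])} R M"
    by (rule submodule_equalizer[OF multilinear_on_replicateD(2)[OF F(1) *]
          multilinear_on_replicateD(2)[OF F(2) *] M N])
qed auto

lemma multilinear_on_plus:
  assumes "multilinear_on R (replicate k M) N F" "multilinear_on R (replicate k M) N F'"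
    and N: "Module.module R N"
  shows "multilinear_on R (replicate k M) N (\<lambda>xs. F xs \<oplus>\<^bsub>N\<^esub> F' xs)"
proof -
  interpret N: Module.module R N by (rule N)
  show ?thesis
    using assms by (auto simp: multilinear_on_replicate intro: linear_on_plus)
qed

lemma multilinear_on_scaled:
  assumes "multilinear_on R (replicate k M) N F" "a \<in> carrier R" and N: "Module.module R N"
  shows "multilinear_on R (replicate k M) N (\<lambda>xs. a \<odot>\<^bsub>N\<^esub> F xs)"
proof -
  interpret N: Module.module R N by (rule N)
  show ?thesis
    using assms by (auto simp: multilinear_on_replicate intro: linear_on_scaled)
qed

subsection \<open>Direct sums and transported copies\<close>

lemma direct_sum_simps:
  "carrier (direct_sum M) = {c. (\<forall>n. c n \<in> carrier (M n)) \<and> finite {n. c n \<noteq> \<zero>\<^bsub>M n\<^esub>}}"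
  "\<zero>\<^bsub>direct_sum M\<^esub> = (\<lambda>n. \<zero>\<^bsub>M n\<^esub>)"
  "c \<oplus>\<^bsub>direct_sum M\<^esub> d = (\<lambda>n. c n \<oplus>\<^bsub>M n\<^esub> d n)"
  "a \<odot>\<^bsub>direct_sum M\<^esub> c = (\<lambda>n. a \<odot>\<^bsub>M n\<^esub> c n)"
  by (simp_all add: direct_sum_def)

definition direct_sum_incl :: "(nat \<Rightarrow> ('a, 'b) module) \<Rightarrow> nat \<Rightarrow> 'b \<Rightarrow> nat \<Rightarrow> 'b" where
  "direct_sum_incl M n x = (\<lambda>k. if k = n then x else \<zero>\<^bsub>M k\<^esub>)"

context cring
begin

context
  fixes M :: "nat \<Rightarrow> ('a, 'd) module"
  assumes M: "\<And>n. Module.module R (M n)"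
begin

lemma direct_sum_module: "Module.module R (direct_sum M)"
proof (rule moduleI)
  interpret M: Module.module R "M n" for n by (rule M)
  let ?F = "direct_sum M"
  have supp: "finite {x. h x \<noteq> \<zero>\<^bsub>M x\<^esub>}"
    if "{x. h x \<noteq> \<zero>\<^bsub>M x\<^esub>} \<subseteq> {x. c x \<noteq> \<zero>\<^bsub>M x\<^esub>} \<union> {x. d x \<noteq> \<zero>\<^bsub>M x\<^esub>}"
      "c \<in> carrier ?F" "d \<in> carrier ?F" for c d h
    using that by (auto simp: direct_sum_simps intro: finite_subset)
  show "cring R" by (rule is_cring)
  show "abelian_group ?F"
  proof (rule abelian_groupI)
    fix c d assume cd: "c \<in> carrier ?F" "d \<in> carrier ?F"
    have "finite {x. c x \<oplus>\<^bsub>M x\<^esub> d x \<noteq> \<zero>\<^bsub>M x\<^esub>}"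
      by (rule supp[OF _ cd]) auto
    then show "c \<oplus>\<^bsub>?F\<^esub> d \<in> carrier ?F" using cd by (simp add: direct_sum_simps)
  next
    fix c assume c: "c \<in> carrier ?F"
    have "finite {x. \<ominus>\<^bsub>M x\<^esub> c x \<noteq> \<zero>\<^bsub>M x\<^esub>}"
      by (rule supp[OF _ c c]) (auto simp: a_inv_def)
    then show "\<exists>y\<in>carrier ?F. y \<oplus>\<^bsub>?F\<^esub> c = \<zero>\<^bsub>?F\<^esub>"
      using c by (intro bexI[of _ "\<lambda>x. \<ominus>\<^bsub>M x\<^esub> c x"]) (auto simp: direct_sum_simps M.l_neg)
  qed (auto simp: direct_sum_simps fun_eq_iff M.a_ac)
  fix a c assume ac: "a \<in> carrier R" "c \<in> carrier ?F"
  have "finite {x. a \<odot>\<^bsub>M x\<^esub> c x \<noteq> \<zero>\<^bsub>M x\<^esub>}"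
    by (rule supp[OF _ ac(2) ac(2)]) (use ac in auto)
  then show "a \<odot>\<^bsub>?F\<^esub> c \<in> carrier ?F" using ac by (simp add: direct_sum_simps)
qed (auto simp: direct_sum_simps fun_eq_iff Module.module.smult_l_distr[OF M]
    Module.module.smult_r_distr[OF M] Module.module.smult_assoc1[OF M] Module.module.smult_one[OF M])

lemma direct_sum_incl_linear: "linear_on R (M n) (direct_sum M) (direct_sum_incl M n)"
proof -
  interpret M: Module.module R "M n" for n by (rule M)
  have "finite {k. direct_sum_incl M n x k \<noteq> \<zero>\<^bsub>M k\<^esub>}" for x
    by (rule finite_subset[of _ "{n}"]) (auto simp: direct_sum_incl_def)
  then show ?thesis
    by (auto simp: linear_on_def direct_sum_simps direct_sum_incl_def fun_eq_iff)
qed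

text \<open>Preimages under the inclusions bring every single summand into the submodule; a finitely
  supported family is then exhausted one component at a time.\<close>

lemma direct_sum_spans:
  assumes G: "\<And>n. spans R (M n) (G n)"
  shows "spans R (direct_sum M) (\<Union>n. direct_sum_incl M n ` G n)"
  unfolding spans_def
proof (intro conjI allI impI)
  let ?F = "direct_sum M"
  show "(\<Union>n. direct_sum_incl M n ` G n) \<subseteq> carrier ?F"
    using G linear_on_closed[OF direct_sum_incl_linear] by (fastforce simp: spans_def)
  interpret M: Module.module R "M n" for n by (rule M)
  interpret F: Module.module R ?F by (rule direct_sum_module)
  fix H assume H: "submodule H R ?F" "(\<Union>n. direct_sum_incl M n ` G n) \<subseteq> H"
  note HE = F.submoduleE[OF H(1)]
  have inc: "direct_sum_incl M n x \<in> H" if "x \<in> carrier (M n)" for n x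
  proof -
    have "submodule {x \<in> carrier (M n). direct_sum_incl M n x \<in> H} R (M n)"
      by (rule submodule_preimage[OF direct_sum_incl_linear H(1) M direct_sum_module])
    moreover have "G n \<subseteq> {x \<in> carrier (M n). direct_sum_incl M n x \<in> H}"
      using H(2) G[of n] by (auto simp: spans_def)
    ultimately show ?thesis using G[of n] that by (auto simp: spans_def)
  qed
  have "c \<in> H" if "finite A" "c \<in> carrier ?F" "{x. c x \<noteq> \<zero>\<^bsub>M x\<^esub>} \<subseteq> A" for A c
    using that
  proof (induction A arbitrary: c rule: finite_induct)
    case empty
    then have "c = \<zero>\<^bsub>?F\<^esub>" by (auto simp: direct_sum_simps)
    then show ?case using submodule_zero[OF H(1) direct_sum_module] by simp
  next
    case (insert a A)
    let ?c = "\<lambda>y. if y = a then \<zero>\<^bsub>M y\<^esub> else c y"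
    have "?c \<in> carrier ?F"
      using insert.prems(1)
      by (auto simp: direct_sum_simps intro: finite_subset[of _ "{x. c x \<noteq> \<zero>\<^bsub>M x\<^esub>}"])
    then have "?c \<in> H" using insert.prems by (intro insert.IH) auto
    moreover have "direct_sum_incl M a (c a) \<in> H"
      using insert.prems by (intro inc) (auto simp: direct_sum_simps)
    moreover have "c = ?c \<oplus>\<^bsub>?F\<^esub> direct_sum_incl M a (c a)"
      using insert.prems by (auto simp: direct_sum_simps fun_eq_iff direct_sum_incl_def)
    ultimately show ?case using HE(5) by metis
  qed
  then show "carrier ?F \<subseteq> H" by (auto simp: direct_sum_simps)
qed

lemma direct_sum_lift:
  assumes L: "Module.module R L" and f: "\<And>n. linear_on R (M n) L (f n)"
  shows "\<exists>h. linear_on R (direct_sum M) L h \<and> (\<forall>n. \<forall>x\<in>carrier (M n). h (direct_sum_incl M n x) = f n x)"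
proof -
  interpret L: Module.module R L by (rule L)
  interpret M: Module.module R "M n" for n by (rule M)
  let ?F = "direct_sum M"
  interpret F: Module.module R ?F by (rule direct_sum_module)
  have fz: "f n \<zero>\<^bsub>M n\<^esub> = \<zero>\<^bsub>L\<^esub>" for n by (rule linear_on_zero[OF f M L])
  have fc: "f n x \<in> carrier L" if "x \<in> carrier (M n)" for n x by (rule linear_on_closed[OF f that])
  define h where "h c = (\<Oplus>\<^bsub>L\<^esub>n\<in>{n. c n \<noteq> \<zero>\<^bsub>M n\<^esub>}. f n (c n))" for c
  have h: "h c = (\<Oplus>\<^bsub>L\<^esub>n\<in>A. f n (c n))"
    if "finite A" "c \<in> carrier ?F" "{x. c x \<noteq> \<zero>\<^bsub>M x\<^esub>} \<subseteq> A" for A c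
    unfolding h_def
    by (rule L.add.finprod_mono_neutral_cong_left)
      (use that in \<open>auto simp: direct_sum_simps fz fc\<close>)
  have "linear_on R ?F L h"
  proof (rule linear_onI)
    fix c d assume cd: "c \<in> carrier ?F" "d \<in> carrier ?F"
    let ?A = "{x. c x \<noteq> \<zero>\<^bsub>M x\<^esub>} \<union> {x. d x \<noteq> \<zero>\<^bsub>M x\<^esub>}"
    have A: "finite ?A" using cd by (auto simp: direct_sum_simps)
    have s: "c \<oplus>\<^bsub>?F\<^esub> d \<in> carrier ?F" using cd by simp
    have cM: "c n \<in> carrier (M n)" "d n \<in> carrier (M n)" for n
      using cd by (auto simp: direct_sum_simps)
    have "h (c \<oplus>\<^bsub>?F\<^esub> d) = (\<Oplus>\<^bsub>L\<^esub>n\<in>?A. f n ((c \<oplus>\<^bsub>?F\<^esub> d) n))"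
      by (rule h[OF A s]) (use cd in \<open>auto simp: direct_sum_simps\<close>)
    also have "\<dots> = (\<Oplus>\<^bsub>L\<^esub>n\<in>?A. f n (c n) \<oplus>\<^bsub>L\<^esub> f n (d n))"
      using cM by (intro L.finsum_cong') (auto simp: direct_sum_simps linear_on_add[OF f] fc)
    also have "\<dots> = (\<Oplus>\<^bsub>L\<^esub>n\<in>?A. f n (c n)) \<oplus>\<^bsub>L\<^esub> (\<Oplus>\<^bsub>L\<^esub>n\<in>?A. f n (d n))"
      using cM fc by (intro L.finsum_addf) auto
    also have "\<dots> = h c \<oplus>\<^bsub>L\<^esub> h d"
      using h[OF A cd(1)] h[OF A cd(2)] by simp
    finally show "h (c \<oplus>\<^bsub>?F\<^esub> d) = h c \<oplus>\<^bsub>L\<^esub> h d" .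
  next
    fix a c assume ac: "a \<in> carrier R" "c \<in> carrier ?F"
    let ?A = "{x. c x \<noteq> \<zero>\<^bsub>M x\<^esub>}"
    have A: "finite ?A" using ac by (auto simp: direct_sum_simps)
    have s: "a \<odot>\<^bsub>?F\<^esub> c \<in> carrier ?F" using ac by simp
    have cM: "c n \<in> carrier (M n)" for n using ac by (auto simp: direct_sum_simps)
    have "h (a \<odot>\<^bsub>?F\<^esub> c) = (\<Oplus>\<^bsub>L\<^esub>n\<in>?A. f n ((a \<odot>\<^bsub>?F\<^esub> c) n))"
      by (rule h[OF A s]) (use ac in \<open>auto simp: direct_sum_simps\<close>)
    also have "\<dots> = (\<Oplus>\<^bsub>L\<^esub>n\<in>?A. a \<odot>\<^bsub>L\<^esub> f n (c n))"
      using cM ac by (intro L.finsum_cong') (auto simp: direct_sum_simps linear_on_smult[OF f] fc)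
    also have "\<dots> = a \<odot>\<^bsub>L\<^esub> h c"
      unfolding h_def using cM fc ac A by (intro L.finsum_smult_ldistr[symmetric]) auto
    finally show "h (a \<odot>\<^bsub>?F\<^esub> c) = a \<odot>\<^bsub>L\<^esub> h c" .
  next
    fix c assume "c \<in> carrier ?F"
    then show "h c \<in> carrier L" unfolding h_def
      using fc by (intro L.finsum_closed) (auto simp: direct_sum_simps)
  qed
  moreover have "h (direct_sum_incl M n x) = f n x" if x: "x \<in> carrier (M n)" for n x
  proof -
    have "h (direct_sum_incl M n x) = (\<Oplus>\<^bsub>L\<^esub>k\<in>{n}. f k (direct_sum_incl M n x k))"
      by (rule h)
        (use x linear_on_closed[OF direct_sum_incl_linear] in \<open>auto simp: direct_sum_incl_def split: if_splits\<close>)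
    also have "\<dots> = f n x" using fc[OF x] by (simp add: direct_sum_incl_def)
    finally show ?thesis .
  qed
  ultimately show ?thesis by blast
qed

end

end

text \<open>\<open>code\<close> is a chosen injection and is meaningful only if one exists.
  Existence is therefore a hypothesis here; it is discharged separately for binary products and for
  the direct sum of coinvariants.\<close>

lemma
  fixes M :: "('a, 'b) module"
  assumes "\<exists>e :: 'b \<Rightarrow> 'u. inj_on e (carrier M)"
  shows inj_on_code: "inj_on (code M :: 'b \<Rightarrow> 'u) (carrier M)"
    and decode_code: "\<And>x. x \<in> carrier M \<Longrightarrow> decode M (code M x :: 'u) = x"
proof -
  show *: "inj_on (code M :: 'b \<Rightarrow> 'u) (carrier M)"
    unfolding code_def using assms by (rule someI_ex)
  show "decode M (code M x :: 'u) = x" if "x \<in> carrier M" for x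
    unfolding decode_def by (rule inv_into_f_f[OF * that])
qed

lemma
  fixes M :: "('a, 'b) module" and R :: "('a, 'c) ring_scheme"
  assumes inj: "\<exists>e :: 'b \<Rightarrow> 'u. inj_on e (carrier M)" and M: "Module.module R M"
  defines "K \<equiv> copy_module M :: ('a, 'u) module"
  shows copy_module_carrier: "carrier K = code M ` carrier M"
    and copy_module_zero: "\<zero>\<^bsub>K\<^esub> = code M \<zero>\<^bsub>M\<^esub>"
    and copy_module_module: "Module.module R K"
    and code_linear: "linear_on R M K (code M)"
    and decode_linear: "linear_on R K M (decode M)"
proof -
  interpret M: Module.module R M by (rule M)
  note dc = decode_code[OF inj]
  show car: "carrier K = code M ` carrier M" and zero: "\<zero>\<^bsub>K\<^esub> = code M \<zero>\<^bsub>M\<^esub>"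
    by (simp_all add: K_def copy_module_def)
  have add: "code M x \<oplus>\<^bsub>K\<^esub> code M y = code M (x \<oplus>\<^bsub>M\<^esub> y)" if "x \<in> carrier M" "y \<in> carrier M" for x y
    using that by (simp add: K_def copy_module_def dc)
  have smult: "a \<odot>\<^bsub>K\<^esub> code M x = code M (a \<odot>\<^bsub>M\<^esub> x)" if "a \<in> carrier R" "x \<in> carrier M" for a x
    using that by (simp add: K_def copy_module_def dc)
  show "Module.module R K" "linear_on R M K (code M)"
    using module_image[OF M car zero[symmetric] add smult] by auto
  show "linear_on R K M (decode M)"
    by (auto simp: linear_on_def car dc add smult)
qed

section \<open>The Schur functor of an operad\<close>

text \<open>The conditions under which a function of \<open>(\<mu>; v_1, ..., v_n)\<close> extends
  to \<open>S(P, V)\<close>, for all arities at once, the arity being the length of the list. Entry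
  \<open>i\<close> of \<open>permute_list \<sigma> vs\<close> is \<open>vs ! \<sigma> i\<close>, as
  in the relations defining the coinvariants.\<close>

definition sym_multilinear_on :: "('a, 'c) ring_scheme \<Rightarrow> ('a, 'u) operad_data \<Rightarrow>
    ('a, 'u) module \<Rightarrow> ('a, 'd) module \<Rightarrow> ('u \<Rightarrow> 'u list \<Rightarrow> 'd) \<Rightarrow> bool" where
  "sym_multilinear_on R P V N g \<longleftrightarrow>
     (\<forall>vs. set vs \<subseteq> carrier V \<longrightarrow> linear_on R (ops P (length vs)) N (\<lambda>\<mu>. g \<mu> vs)) \<and>
     (\<forall>\<mu> vs i. \<mu> \<in> carrier (ops P (length vs)) \<longrightarrow> set vs \<subseteq> carrier V \<longrightarrow> i < length vs \<longrightarrow>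
        linear_on R V N (\<lambda>x. g \<mu> (vs[i := x]))) \<and>
     (\<forall>\<mu> vs \<sigma>. \<mu> \<in> carrier (ops P (length vs)) \<longrightarrow> set vs \<subseteq> carrier V \<longrightarrow>
        \<sigma> permutes {..<length vs} \<longrightarrow> g (act P (length vs) \<mu> \<sigma>) (permute_list \<sigma> vs) = g \<mu> vs)"

lemma sym_multilinear_onI:
  assumes "\<And>vs. set vs \<subseteq> carrier V \<Longrightarrow> linear_on R (ops P (length vs)) N (\<lambda>\<mu>. g \<mu> vs)"
    and "\<And>\<mu> vs i. \<lbrakk>\<mu> \<in> carrier (ops P (length vs)); set vs \<subseteq> carrier V; i < length vs\<rbrakk> \<Longrightarrow>
      linear_on R V N (\<lambda>x. g \<mu> (vs[i := x]))"
    and "\<And>\<mu> vs \<sigma>. \<lbrakk>\<mu> \<in> carrier (ops P (length vs)); set vs \<subseteq> carrier V; \<sigma> permutes {..<length vs}\<rbrakk> \<Longrightarrow>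
      g (act P (length vs) \<mu> \<sigma>) (permute_list \<sigma> vs) = g \<mu> vs"
  shows "sym_multilinear_on R P V N g"
  using assms by (simp add: sym_multilinear_on_def)

lemma
  assumes "sym_multilinear_on R P V N g" "set vs \<subseteq> carrier V"
  shows sym_multilinear_on_op: "linear_on R (ops P (length vs)) N (\<lambda>\<mu>. g \<mu> vs)"
    and sym_multilinear_on_arg: "\<And>\<mu> i. \<lbrakk>\<mu> \<in> carrier (ops P (length vs)); i < length vs\<rbrakk> \<Longrightarrow>
      linear_on R V N (\<lambda>x. g \<mu> (vs[i := x]))"
    and sym_multilinear_on_perm: "\<And>\<mu> \<sigma>. \<lbrakk>\<mu> \<in> carrier (ops P (length vs)); \<sigma> permutes {..<length vs}\<rbrakk> \<Longrightarrow>
      g (act P (length vs) \<mu> \<sigma>) (permute_list \<sigma> vs) = g \<mu> vs"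
    and sym_multilinear_on_closed: "\<And>\<mu>. \<mu> \<in> carrier (ops P (length vs)) \<Longrightarrow> g \<mu> vs \<in> carrier N"
proof -
  show *: "linear_on R (ops P (length vs)) N (\<lambda>\<mu>. g \<mu> vs)"
    using assms unfolding sym_multilinear_on_def by blast
  show "linear_on R V N (\<lambda>x. g \<mu> (vs[i := x]))"
    if "\<mu> \<in> carrier (ops P (length vs))" "i < length vs" for \<mu> i
    using assms that unfolding sym_multilinear_on_def by blast
  show "g (act P (length vs) \<mu> \<sigma>) (permute_list \<sigma> vs) = g \<mu> vs"
    if "\<mu> \<in> carrier (ops P (length vs))" "\<sigma> permutes {..<length vs}" for \<mu> \<sigma>
    using assms that unfolding sym_multilinear_on_def by blast
  show "g \<mu> vs \<in> carrier N" if "\<mu> \<in> carrier (ops P (length vs))" for \<mu>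
    using linear_on_closed[OF * that] .
qed

text \<open>Entries are merged from the right by an injective pairing \<open>p\<close>. The merged
  value does not show where the list ends, so the length is stored along with it through an
  injection of the natural numbers.\<close>

lemma ex_inj_list:
  "\<exists>e :: 'u::infinite list \<Rightarrow> 'u. inj e"
proof -
  include cardinal_syntax
  have inf: "infinite (UNIV :: 'u set)" by (rule infinite_UNIV)
  have "|UNIV \<times> UNIV :: ('u \<times> 'u) set| \<le>o |UNIV :: 'u set|"
    using card_of_Times_same_infinite[OF inf] by (rule ordIso_imp_ordLeq)
  then obtain p :: "'u \<times> 'u \<Rightarrow> 'u" where p: "inj p"
    using card_of_ordLeq[of "UNIV \<times> UNIV :: ('u \<times> 'u) set" "UNIV :: 'u set"] by auto
  obtain f :: "nat \<Rightarrow> 'u" where f: "inj f"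
    using infinite_countable_subset[OF inf] by auto
  define g where "g xs = foldr (\<lambda>x y. p (x, y)) xs (f 0)" for xs
  have g: "xs = ys" if "length xs = length ys" "g xs = g ys" for xs ys
    using that by (induction xs ys rule: list_induct2) (auto simp: g_def dest: injD[OF p])
  have "inj (\<lambda>xs. p (f (length xs), g xs))"
    by (rule injI) (auto dest!: injD[OF p] injD[OF f] intro: g)
  then show ?thesis by blast
qed

context operad
begin

lemma tensor_factors_listset:
  "\<mu> # vs \<in> listset (map carrier (ops P n # replicate n V)) \<longleftrightarrow>
    \<mu> \<in> carrier (ops P n) \<and> length vs = n \<and> set vs \<subseteq> carrier V"
  by (auto simp: set_Cons_def listset_replicate)

context
  fixes V :: "('a, 'u) module"
  assumes V: "Module.module R V"
begin

private abbreviation "fac n \<equiv> ops P n # replicate n V"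
private abbreviation "T n \<equiv> tensor_module R (fac n)"

private lemma fac: "\<forall>M\<in>set (fac n). Module.module R M"
  using ops_module V by auto

private lemma pure_closed:
  "\<lbrakk>\<mu> \<in> carrier (ops P n); length vs = n; set vs \<subseteq> carrier V\<rbrakk> \<Longrightarrow>
    pure_tensor R (fac n) (\<mu> # vs) \<in> carrier (T n)"
  using pure_tensor_multilinear[OF fac[of n]] tensor_factors_listset[of \<mu> vs n V]
  unfolding multilinear_on_def by blast

private definition "coinv_rel n = {pure_tensor R (fac n) (act P n \<mu> \<sigma> # map (\<lambda>i. vs ! \<sigma> i) [0..<n])
    \<ominus>\<^bsub>T n\<^esub> pure_tensor R (fac n) (\<mu> # vs) | \<mu> vs \<sigma>.
    \<mu> \<in> carrier (ops P n) \<and> vs \<in> listset (replicate n (carrier V)) \<and> \<sigma> permutes {..<n}}"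

private lemma coinv_ker: "coinvariants_kernel R P V n = generated_submodule R (T n) (coinv_rel n)"
  by (simp add: coinvariants_kernel_def coinv_rel_def Let_def)

private lemma coinv_rel_subset: "coinv_rel n \<subseteq> carrier (T n)"
proof -
  interpret T: Module.module R "T n" by (rule tensor_module_module[OF fac])
  show ?thesis
    unfolding coinv_rel_def
  proof clarify
    fix \<mu> vs \<sigma>
    assume *: "\<mu> \<in> carrier (ops P n)" "vs \<in> listset (replicate n (carrier V))" "\<sigma> permutes {..<n}"
    then have vs: "length vs = n" "set vs \<subseteq> carrier V" by (auto simp: listset_replicate)
    then have "set (permute_list \<sigma> vs) \<subseteq> carrier V" using * by simp
    then show "pure_tensor R (fac n) (act P n \<mu> \<sigma> # map (\<lambda>i. vs ! \<sigma> i) [0..<n])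
        \<ominus>\<^bsub>T n\<^esub> pure_tensor R (fac n) (\<mu> # vs) \<in> carrier (T n)"
      using * vs by (intro T.minus_closed pure_closed act_closed) (auto simp: permute_list_def)
  qed
qed

private lemmas coinv_quotient =
  generated_quotient_props[OF tensor_module_module[OF fac] coinv_rel_subset,
    folded coinv_ker, folded coinvariants_def]

lemma coinvariants_module: "Module.module R (coinvariants R P V n)"
  by (rule coinv_quotient(1))

private lemma class_eq: "coinvariants_class R P V n \<mu> vs =
    coinvariants_kernel R P V n +>\<^bsub>T n\<^esub> pure_tensor R (fac n) (\<mu> # vs)"
  by (simp add: coinvariants_class_def Let_def)

lemma coinvariants_class_linear_op:
  assumes "set vs \<subseteq> carrier V" "length vs = n"
  shows "linear_on R (ops P n) (coinvariants R P V n) (\<lambda>\<mu>. coinvariants_class R P V n \<mu> vs)"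
proof -
  interpret Pn: Module.module R "ops P n" by (rule ops_module)
  have "\<zero>\<^bsub>ops P n\<^esub> # vs \<in> listset (map carrier (fac n))"
    using assms by (subst tensor_factors_listset) auto
  \<comment> \<open>Multilinearity speaks of updating an existing tuple, so the zero operation is a
    placeholder in slot 0 that \<open>\<mu>\<close> then overwrites.\<close>
  then have "linear_on R (fac n ! 0) (T n) (\<lambda>\<mu>. pure_tensor R (fac n) ((\<zero>\<^bsub>ops P n\<^esub> # vs)[0 := \<mu>]))"
    using pure_tensor_multilinear[OF fac[of n]] unfolding multilinear_on_def by blast
  then have "linear_on R (ops P n) (T n) (\<lambda>\<mu>. pure_tensor R (fac n) (\<mu> # vs))" by simp
  from linear_on_compose[OF this coinv_quotient(2)] show ?thesis by (simp add: class_eq)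
qed

lemma coinvariants_class_linear_arg:
  assumes "\<mu> \<in> carrier (ops P n)" "set vs \<subseteq> carrier V" "length vs = n" "i < n"
  shows "linear_on R V (coinvariants R P V n) (\<lambda>x. coinvariants_class R P V n \<mu> (vs[i := x]))"
proof -
  have "\<mu> # vs \<in> listset (map carrier (fac n))"
    using assms by (subst tensor_factors_listset) auto
  moreover have "Suc i < length (fac n)" using assms by simp
  ultimately have "linear_on R (fac n ! Suc i) (T n) (\<lambda>x. pure_tensor R (fac n) ((\<mu> # vs)[Suc i := x]))"
    using pure_tensor_multilinear[OF fac[of n]] unfolding multilinear_on_def by blast
  then have "linear_on R V (T n) (\<lambda>x. pure_tensor R (fac n) (\<mu> # vs[i := x]))" using assms by simp
  from linear_on_compose[OF this coinv_quotient(2)] show ?thesis by (simp add: class_eq)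
qed

lemma coinvariants_class_perm:
  assumes "\<mu> \<in> carrier (ops P n)" "set vs \<subseteq> carrier V" "length vs = n" "\<sigma> permutes {..<n}"
  shows "coinvariants_class R P V n (act P n \<mu> \<sigma>) (permute_list \<sigma> vs) = coinvariants_class R P V n \<mu> vs"
  unfolding class_eq
proof (rule coinv_quotient(4))
  have *: "set (permute_list \<sigma> vs) \<subseteq> carrier V" using assms by simp
  show "pure_tensor R (fac n) (act P n \<mu> \<sigma> # permute_list \<sigma> vs) \<in> carrier (T n)"
    "pure_tensor R (fac n) (\<mu> # vs) \<in> carrier (T n)"
    using assms * by (auto intro!: pure_closed act_closed)
  show "pure_tensor R (fac n) (act P n \<mu> \<sigma> # permute_list \<sigma> vs) \<ominus>\<^bsub>T n\<^esub>
      pure_tensor R (fac n) (\<mu> # vs) \<in> coinv_rel n"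
    using assms unfolding coinv_rel_def permute_list_def by (auto simp: listset_replicate)
qed

lemma coinvariants_class_spans:
  "spans R (coinvariants R P V n) {coinvariants_class R P V n \<mu> vs | \<mu> vs.
    \<mu> \<in> carrier (ops P n) \<and> length vs = n \<and> set vs \<subseteq> carrier V}"
proof -
  have "listset (map carrier (fac n)) =
      {\<mu> # vs | \<mu> vs. \<mu> \<in> carrier (ops P n) \<and> length vs = n \<and> set vs \<subseteq> carrier V}"
    by (auto simp: set_Cons_def listset_replicate)
  then have "{coinvariants_class R P V n \<mu> vs | \<mu> vs.
      \<mu> \<in> carrier (ops P n) \<and> length vs = n \<and> set vs \<subseteq> carrier V} =
    (\<lambda>x. coinvariants_kernel R P V n +>\<^bsub>T n\<^esub> x) ` pure_tensor R (fac n) ` listset (map carrier (fac n))"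
    by (auto simp: class_eq image_iff simp del: listset.simps)
  then show ?thesis
    using coinv_quotient(3)[OF pure_tensor_spans[OF fac]] by (simp del: listset.simps)
qed

text \<open>The two linearity conditions give a map on the tensor product; the invariance condition
  says that this map kills the relations of the diagonal action.\<close>

lemma coinvariants_lift:
  assumes N: "Module.module R N" and g: "sym_multilinear_on R P V N g"
  shows "\<exists>h. linear_on R (coinvariants R P V n) N h \<and>
    (\<forall>\<mu> vs. \<mu> \<in> carrier (ops P n) \<longrightarrow> length vs = n \<longrightarrow> set vs \<subseteq> carrier V \<longrightarrow>
      h (coinvariants_class R P V n \<mu> vs) = g \<mu> vs)"
proof -
  interpret N: Module.module R N by (rule N)
  let ?L = "listset (map carrier (fac n))"
  have "multilinear_on R (fac n) N (\<lambda>xs. g (hd xs) (tl xs))"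
    unfolding multilinear_on_def
  proof (intro ballI conjI allI impI)
    fix xs assume "xs \<in> ?L"
    then obtain \<mu> vs where xs: "xs = \<mu> # vs" "\<mu> \<in> carrier (ops P n)" "length vs = n" "set vs \<subseteq> carrier V"
      by (auto simp: set_Cons_def listset_replicate)
    show "g (hd xs) (tl xs) \<in> carrier N"
      using sym_multilinear_on_closed[OF g xs(4)] xs by simp
    fix i assume "i < length (fac n)"
    then show "linear_on R (fac n ! i) N (\<lambda>x. g (hd (xs[i := x])) (tl (xs[i := x])))"
      using sym_multilinear_on_op[OF g xs(4)] sym_multilinear_on_arg[OF g xs(4)] xs
      by (cases i) auto
  qed
  from tensor_module_lift[OF fac N this] obtain f where f: "linear_on R (T n) N f"
    "\<And>xs. xs \<in> ?L \<Longrightarrow> f (pure_tensor R (fac n) xs) = g (hd xs) (tl xs)" by blast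
  have fp: "f (pure_tensor R (fac n) (\<mu> # vs)) = g \<mu> vs"
    if "\<mu> \<in> carrier (ops P n)" "length vs = n" "set vs \<subseteq> carrier V" for \<mu> vs
    using f(2)[of "\<mu> # vs"] that by (auto simp: set_Cons_def listset_replicate)
  have "f r = \<zero>\<^bsub>N\<^esub>" if "r \<in> coinv_rel n" for r
  proof -
    from that obtain \<mu> vs \<sigma> where r: "r = pure_tensor R (fac n) (act P n \<mu> \<sigma> # permute_list \<sigma> vs) \<ominus>\<^bsub>T n\<^esub>
        pure_tensor R (fac n) (\<mu> # vs)" and *: "\<mu> \<in> carrier (ops P n)" "length vs = n"
        "set vs \<subseteq> carrier V" "\<sigma> permutes {..<n}"
      by (auto simp: coinv_rel_def listset_replicate permute_list_def)
    have **: "set (permute_list \<sigma> vs) \<subseteq> carrier V" "act P n \<mu> \<sigma> \<in> carrier (ops P n)"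
      using * by (auto simp: act_closed)
    have "f r = g (act P n \<mu> \<sigma>) (permute_list \<sigma> vs) \<ominus>\<^bsub>N\<^esub> g \<mu> vs"
      unfolding r using * **
      by (subst linear_on_minus[OF f(1) tensor_module_module[OF fac] N])
        (auto simp: fp intro!: pure_closed)
    also have "\<dots> = \<zero>\<^bsub>N\<^esub>"
      using sym_multilinear_on_perm[OF g *(3)] sym_multilinear_on_closed[OF g *(3)] *
      by (simp add: a_minus_def N.r_neg)
    finally show ?thesis .
  qed
  from coinv_quotient(5)[OF N f(1) this] obtain h where
    h: "linear_on R (coinvariants R P V n) N h"
      "\<And>x. x \<in> carrier (T n) \<Longrightarrow> h (coinvariants_kernel R P V n +>\<^bsub>T n\<^esub> x) = f x"
    by blast
  then show ?thesis
    by (intro exI[of _ h]) (auto simp: class_eq fp pure_closed)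
qed

lemma Schur_sum_module: "Module.module R (Schur_sum R P V)"
  unfolding Schur_sum_def by (rule direct_sum_module[OF coinvariants_module])

text \<open>The generator inside the direct sum itself, before it is moved into the universe by
  \<open>code\<close>.\<close>

definition Schur_sum_elem :: "'u \<Rightarrow> 'u list \<Rightarrow> nat \<Rightarrow> ('u list \<Rightarrow> 'a) set set" where
  "Schur_sum_elem \<mu> vs = direct_sum_incl (coinvariants R P V) (length vs)
     (coinvariants_class R P V (length vs) \<mu> vs)"

lemma Schur_sum_elem_sym_multilinear:
  "sym_multilinear_on R P V (Schur_sum R P V) Schur_sum_elem"
  unfolding Schur_sum_elem_def Schur_sum_def
proof (rule sym_multilinear_onI)
  note dl = direct_sum_incl_linear[of "coinvariants R P V", OF coinvariants_module]
  fix vs assume vs: "set vs \<subseteq> carrier V"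
  show "linear_on R (ops P (length vs)) (direct_sum (coinvariants R P V))
      (\<lambda>\<mu>. direct_sum_incl (coinvariants R P V) (length vs) (coinvariants_class R P V (length vs) \<mu> vs))"
    by (rule linear_on_compose[OF coinvariants_class_linear_op[OF vs refl] dl])
  fix \<mu> assume \<mu>: "\<mu> \<in> carrier (ops P (length vs))"
  show "linear_on R V (direct_sum (coinvariants R P V))
      (\<lambda>x. direct_sum_incl (coinvariants R P V) (length (vs[i := x]))
        (coinvariants_class R P V (length (vs[i := x])) \<mu> (vs[i := x])))" if i: "i < length vs" for i
    using linear_on_compose[OF coinvariants_class_linear_arg[OF \<mu> vs refl i] dl] by simp
  show "direct_sum_incl (coinvariants R P V) (length (permute_list \<sigma> vs))
      (coinvariants_class R P V (length (permute_list \<sigma> vs)) (act P (length vs) \<mu> \<sigma>) (permute_list \<sigma> vs)) =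
    direct_sum_incl (coinvariants R P V) (length vs) (coinvariants_class R P V (length vs) \<mu> vs)"
    if "\<sigma> permutes {..<length vs}" for \<sigma>
    using coinvariants_class_perm[OF \<mu> vs refl that] by simp
qed

lemma Schur_sum_elem_spans:
  "spans R (Schur_sum R P V)
    {Schur_sum_elem \<mu> vs | \<mu> vs. \<mu> \<in> carrier (ops P (length vs)) \<and> set vs \<subseteq> carrier V}"
proof -
  have "spans R (Schur_sum R P V) (\<Union>n. direct_sum_incl (coinvariants R P V) n `
      {coinvariants_class R P V n \<mu> vs | \<mu> vs. \<mu> \<in> carrier (ops P n) \<and> length vs = n \<and> set vs \<subseteq> carrier V})"
    unfolding Schur_sum_def by (rule direct_sum_spans[OF coinvariants_module coinvariants_class_spans])
  also have "(\<Union>n. direct_sum_incl (coinvariants R P V) n `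
      {coinvariants_class R P V n \<mu> vs | \<mu> vs. \<mu> \<in> carrier (ops P n) \<and> length vs = n \<and> set vs \<subseteq> carrier V}) =
    {Schur_sum_elem \<mu> vs | \<mu> vs. \<mu> \<in> carrier (ops P (length vs)) \<and> set vs \<subseteq> carrier V}"
    by (fastforce simp: Schur_sum_elem_def)
  finally show ?thesis .
qed

lemma Schur_sum_lift:
  assumes N: "Module.module R N" and g: "sym_multilinear_on R P V N g"
  shows "\<exists>h. linear_on R (Schur_sum R P V) N h \<and>
    (\<forall>\<mu> vs. \<mu> \<in> carrier (ops P (length vs)) \<longrightarrow> set vs \<subseteq> carrier V \<longrightarrow> h (Schur_sum_elem \<mu> vs) = g \<mu> vs)"
proof -
  have "\<forall>n. \<exists>h. linear_on R (coinvariants R P V n) N h \<and>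
    (\<forall>\<mu> vs. \<mu> \<in> carrier (ops P n) \<longrightarrow> length vs = n \<longrightarrow> set vs \<subseteq> carrier V \<longrightarrow>
      h (coinvariants_class R P V n \<mu> vs) = g \<mu> vs)"
    using coinvariants_lift[OF N g] by blast
  then obtain f where f: "\<And>n. linear_on R (coinvariants R P V n) N (f n)"
    "\<And>n \<mu> vs. \<lbrakk>\<mu> \<in> carrier (ops P n); length vs = n; set vs \<subseteq> carrier V\<rbrakk> \<Longrightarrow>
      f n (coinvariants_class R P V n \<mu> vs) = g \<mu> vs"
    by metis
  from direct_sum_lift[of "coinvariants R P V", OF coinvariants_module N f(1)] obtain h where
    h: "linear_on R (Schur_sum R P V) N h"
      "\<And>n x. x \<in> carrier (coinvariants R P V n) \<Longrightarrow> h (direct_sum_incl (coinvariants R P V) n x) = f n x"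
    unfolding Schur_sum_def by blast
  have "coinvariants_class R P V (length vs) \<mu> vs \<in> carrier (coinvariants R P V (length vs))"
    if "\<mu> \<in> carrier (ops P (length vs))" "set vs \<subseteq> carrier V" for \<mu> vs
    using linear_on_closed[OF coinvariants_class_linear_op[OF that(2) refl] that(1)] .
  then show ?thesis
    by (intro exI[of _ h]) (auto simp: h Schur_sum_elem_def f(2))
qed

end

end

subsection \<open>The transported Schur functor\<close>

text \<open>The infinite universe enters here: it provides the injections that copy products and
  direct sums back into \<open>'u\<close>.\<close>

locale operad_universe = operad R P
  for R :: "('a, 'c) ring_scheme" (structure) and P :: "('a, 'u::infinite) operad_data"
begin

abbreviation "elt \<equiv> Schur_elem R P"
abbreviation "SP \<equiv> Schur R P"
abbreviation "Smap \<equiv> Schur_map R P"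
abbreviation "Smult \<equiv> Schur_mult R P"
abbreviation "Sunit \<equiv> Schur_unit R P"
abbreviation "Sdiff \<equiv> Schur_diff R P"
abbreviation "Lin \<equiv> Hom (MOD R)"
abbreviation MOD_comp (infixr \<open>\<bullet>\<close> 75) where "g \<bullet> f \<equiv> Comp (MOD R) g f"

text \<open>Formal generators. They are kept as pairs because different pairs may have the same
  class, while operad identities are statements about the pairs.\<close>

definition symbols :: "('a, 'u) module \<Rightarrow> ('u \<times> 'u list) set" where
  "symbols V = {(\<mu>, vs). \<mu> \<in> carrier (ops P (length vs)) \<and> set vs \<subseteq> carrier V}"

definition eval_symbol :: "('a, 'u) module \<Rightarrow> 'u \<times> 'u list \<Rightarrow> 'u" where
  "eval_symbol V s = elt V (fst s) (snd s)"

lemma sym_multilinear_on_cong: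
  assumes g: "sym_multilinear_on R P V N g" and V: "Module.module R V"
    and eq: "\<And>\<mu> vs. (\<mu>, vs) \<in> symbols V \<Longrightarrow> g \<mu> vs = g' \<mu> vs"
  shows "sym_multilinear_on R P V N g'"
proof (rule sym_multilinear_onI)
  fix vs assume vs: "set vs \<subseteq> carrier V"
  show "linear_on R (ops P (length vs)) N (\<lambda>\<mu>. g' \<mu> vs)"
    by (rule linear_on_cong[OF sym_multilinear_on_op[OF g vs] _ ops_module])
      (use vs eq in \<open>auto simp: symbols_def\<close>)
  fix \<mu> assume \<mu>: "\<mu> \<in> carrier (ops P (length vs))"
  show "linear_on R V N (\<lambda>x. g' \<mu> (vs[i := x]))" if i: "i < length vs" for i
  proof (rule linear_on_cong[OF sym_multilinear_on_arg[OF g vs \<mu> i] _ V])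
    fix x assume "x \<in> carrier V"
    then have "(\<mu>, vs[i := x]) \<in> symbols V"
      using vs \<mu> set_update_subset_insert[of vs i x] by (auto simp: symbols_def)
    then show "g \<mu> (vs[i := x]) = g' \<mu> (vs[i := x])" by (rule eq)
  qed
  show "g' (act P (length vs) \<mu> \<sigma>) (permute_list \<sigma> vs) = g' \<mu> vs"
    if \<sigma>: "\<sigma> permutes {..<length vs}" for \<sigma>
    using sym_multilinear_on_perm[OF g vs \<mu> \<sigma>] vs \<mu> \<sigma>
      eq[of \<mu> vs] eq[of "act P (length vs) \<mu> \<sigma>" "permute_list \<sigma> vs"]
    by (simp add: symbols_def act_closed)
qed

text \<open>For a family linear in \<open>m\<close>, being admissible as a function of the symbol is
  stable under sums and multiples in \<open>m\<close>. Hence a variable to which a map has already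
  been extended need only be tested on generators while the next one is treated.\<close>

lemma submodule_sym_multilinear_on:
  assumes V: "Module.module R V" and M: "Module.module R M" and N: "Module.module R N"
    and g: "\<And>\<mu> vs. (\<mu>, vs) \<in> symbols V \<Longrightarrow> linear_on R M N (g \<mu> vs)"
  shows "submodule {m \<in> carrier M. sym_multilinear_on R P V N (\<lambda>\<mu> vs. g \<mu> vs m)} R M"
proof (rule submoduleI'[OF M])
  interpret M: Module.module R M by (rule M)
  interpret N: Module.module R N by (rule N)
  let ?S = "{m \<in> carrier M. sym_multilinear_on R P V N (\<lambda>\<mu> vs. g \<mu> vs m)}"
  have "sym_multilinear_on R P V N (\<lambda>\<mu> vs. \<zero>\<^bsub>N\<^esub>)"
    by (intro sym_multilinear_onI linear_on_const_zero N refl)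
  from sym_multilinear_on_cong[OF this V, of "\<lambda>\<mu> vs. g \<mu> vs \<zero>\<^bsub>M\<^esub>"]
  show "\<zero>\<^bsub>M\<^esub> \<in> ?S" using linear_on_zero[OF g M N] by simp
  {
    fix x y assume *: "x \<in> ?S" "y \<in> ?S"
    then have x: "sym_multilinear_on R P V N (\<lambda>\<mu> vs. g \<mu> vs x)"
      and y: "sym_multilinear_on R P V N (\<lambda>\<mu> vs. g \<mu> vs y)" by auto
    have "sym_multilinear_on R P V N (\<lambda>\<mu> vs. g \<mu> vs x \<oplus>\<^bsub>N\<^esub> g \<mu> vs y)"
      by (intro sym_multilinear_onI linear_on_plus N sym_multilinear_on_op[OF x]
          sym_multilinear_on_op[OF y] sym_multilinear_on_arg[OF x] sym_multilinear_on_arg[OF y])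
        (simp_all add: sym_multilinear_on_perm[OF x] sym_multilinear_on_perm[OF y])
    from sym_multilinear_on_cong[OF this V, of "\<lambda>\<mu> vs. g \<mu> vs (x \<oplus>\<^bsub>M\<^esub> y)"]
    show "x \<oplus>\<^bsub>M\<^esub> y \<in> ?S" using linear_on_add[OF g] * by simp
  next
    fix a x assume *: "a \<in> carrier R" "x \<in> ?S"
    then have x: "sym_multilinear_on R P V N (\<lambda>\<mu> vs. g \<mu> vs x)" by auto
    have "sym_multilinear_on R P V N (\<lambda>\<mu> vs. a \<odot>\<^bsub>N\<^esub> g \<mu> vs x)"
      by (intro sym_multilinear_onI linear_on_scaled N sym_multilinear_on_op[OF x]
          sym_multilinear_on_arg[OF x] *(1)) (simp_all add: sym_multilinear_on_perm[OF x])
    from sym_multilinear_on_cong[OF this V, of "\<lambda>\<mu> vs. g \<mu> vs (a \<odot>\<^bsub>M\<^esub> x)"]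
    show "a \<odot>\<^bsub>M\<^esub> x \<in> ?S" using linear_on_smult[OF g] * by simp
  }
qed auto

text \<open>Scalars can be absorbed into the operations, so every element is a finite sum of generators and
  the number of elements is bounded independently of the size of the ring.\<close>

lemma Schur_sum_ex_inj:
  assumes V: "Module.module R V"
  shows "\<exists>e :: (nat \<Rightarrow> ('u list \<Rightarrow> 'a) set set) \<Rightarrow> 'u. inj_on e (carrier (Schur_sum R P V))"
proof -
  let ?S = "Schur_sum R P V"
  let ?e = "\<lambda>(\<mu>, vs). Schur_sum_elem V \<mu> vs"
  define f where "f ts = foldr (\<lambda>t x. ?e t \<oplus>\<^bsub>?S\<^esub> x) ts \<zero>\<^bsub>?S\<^esub>" for ts
  note sm = Schur_sum_elem_sym_multilinear[OF V]
  have "carrier ?S \<subseteq> (\<lambda>ts. foldr (\<lambda>t x. ?e t \<oplus>\<^bsub>?S\<^esub> x) ts \<zero>\<^bsub>?S\<^esub>) ` lists (symbols V)"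
  proof (rule spans_list_sums[OF Schur_sum_module[OF V]])
    have "?e ` symbols V =
      {Schur_sum_elem V \<mu> vs | \<mu> vs. \<mu> \<in> carrier (ops P (length vs)) \<and> set vs \<subseteq> carrier V}"
      by (auto simp: symbols_def image_iff)
    then show "spans R ?S (?e ` symbols V)" using Schur_sum_elem_spans[OF V] by simp
    fix a s assume a: "a \<in> carrier R" and "s \<in> symbols V"
    then obtain \<mu> vs where s: "s = (\<mu>, vs)" "\<mu> \<in> carrier (ops P (length vs))" "set vs \<subseteq> carrier V"
      by (auto simp: symbols_def)
    interpret Pn: Module.module R "ops P (length vs)" by (rule ops_module)
    show "\<exists>t\<in>symbols V. ?e t = a \<odot>\<^bsub>?S\<^esub> ?e s"
      using linear_on_smult[OF sym_multilinear_on_op[OF sm s(3)] a s(2)] s a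
      by (intro bexI[of _ "(a \<odot>\<^bsub>ops P (length vs)\<^esub> \<mu>, vs)"]) (auto simp: symbols_def)
  qed
  then have sub: "carrier ?S \<subseteq> f ` lists (symbols V)" by (simp add: f_def)
  obtain e :: "'u list \<Rightarrow> 'u" where e: "inj e" using ex_inj_list by blast
  have "inj (\<lambda>t. e (fst t # snd t))" for t
    by (rule injI) (auto simp: prod_eq_iff dest: injD[OF e])
  then have "inj (map (\<lambda>t :: 'u \<times> 'u list. e (fst t # snd t)))" by simp
  \<comment> \<open>A right inverse of \<open>f\<close> picks a list of symbols for each element.
    The list is encoded by applying \<open>e\<close> to each symbol, viewed as a nonempty list, and
    once more to the resulting list.\<close>
  from inj_compose[OF e this]
  have "inj_on ((e \<circ> map (\<lambda>t. e (fst t # snd t))) \<circ> inv_into (lists (symbols V)) f) (carrier ?S)"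
    by (rule comp_inj_on[OF inj_on_inv_into[OF sub] inj_on_subset[OF _ subset_UNIV]])
  then show ?thesis by blast
qed

context
  fixes V :: "('a, 'u) module"
  assumes V: "Module.module R V"
begin

private lemmas copy = inj_on_code[OF Schur_sum_ex_inj[OF V]] decode_code[OF Schur_sum_ex_inj[OF V]]
  copy_module_carrier[OF Schur_sum_ex_inj[OF V] Schur_sum_module[OF V], folded Schur_def]
  code_linear[OF Schur_sum_ex_inj[OF V] Schur_sum_module[OF V], folded Schur_def]
  decode_linear[OF Schur_sum_ex_inj[OF V] Schur_sum_module[OF V], folded Schur_def]

lemma Schur_module: "Module.module R (SP V)"
  unfolding Schur_def by (rule copy_module_module[OF Schur_sum_ex_inj[OF V] Schur_sum_module[OF V]])

lemma Schur_elem_eq: "elt V \<mu> vs = code (Schur_sum R P V) (Schur_sum_elem V \<mu> vs)"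
  unfolding Schur_elem_def Schur_sum_elem_def[OF V] direct_sum_incl_def
  by (rule arg_cong[where f = "code (Schur_sum R P V)"]) (auto simp: fun_eq_iff)

lemma Schur_elem_sym_multilinear:
  "sym_multilinear_on R P V (SP V) (elt V)"
proof (rule sym_multilinear_onI)
  note sm = Schur_sum_elem_sym_multilinear[OF V]
  fix vs assume vs: "set vs \<subseteq> carrier V"
  show "linear_on R (ops P (length vs)) (SP V) (\<lambda>\<mu>. elt V \<mu> vs)"
    unfolding Schur_elem_eq by (rule linear_on_compose[OF sym_multilinear_on_op[OF sm vs] copy(4)])
  fix \<mu> assume \<mu>: "\<mu> \<in> carrier (ops P (length vs))"
  show "linear_on R V (SP V) (\<lambda>x. elt V \<mu> (vs[i := x]))" if i: "i < length vs" for i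
    unfolding Schur_elem_eq
    by (rule linear_on_compose[OF sym_multilinear_on_arg[OF sm vs \<mu> i] copy(4)])
  show "elt V (act P (length vs) \<mu> \<sigma>) (permute_list \<sigma> vs) = elt V \<mu> vs"
    if "\<sigma> permutes {..<length vs}" for \<sigma>
    using sym_multilinear_on_perm[OF sm vs \<mu> that] by (simp add: Schur_elem_eq)
qed

lemma Schur_lift:
  assumes N: "Module.module R N" and g: "sym_multilinear_on R P V N g"
  shows "\<exists>h. linear_on R (SP V) N h \<and>
    (\<forall>\<mu> vs. (\<mu>, vs) \<in> symbols V \<longrightarrow> h (elt V \<mu> vs) = g \<mu> vs)"
proof -
  obtain f where f: "linear_on R (Schur_sum R P V) N f"
    "\<And>\<mu> vs. (\<mu>, vs) \<in> symbols V \<Longrightarrow> f (Schur_sum_elem V \<mu> vs) = g \<mu> vs"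
    using Schur_sum_lift[OF V N g] by (auto simp: symbols_def)
  have "Schur_sum_elem V \<mu> vs \<in> carrier (Schur_sum R P V)" if "(\<mu>, vs) \<in> symbols V" for \<mu> vs
    using that sym_multilinear_on_closed[OF Schur_sum_elem_sym_multilinear[OF V]]
    by (auto simp: symbols_def)
  then show ?thesis
    using linear_on_compose[OF copy(5) f(1)] f(2)
    by (intro exI[of _ "\<lambda>x. f (decode (Schur_sum R P V) x)"]) (simp add: Schur_elem_eq copy(2))
qed

lemma Schur_elem_spans_carrier:
  "spans R (SP V) {elt V \<mu> vs | \<mu> vs. (\<mu>, vs) \<in> symbols V}"
proof -
  have "{elt V \<mu> vs | \<mu> vs. (\<mu>, vs) \<in> symbols V} = code (Schur_sum R P V) `
    {Schur_sum_elem V \<mu> vs | \<mu> vs. \<mu> \<in> carrier (ops P (length vs)) \<and> set vs \<subseteq> carrier V}"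
    by (auto simp: symbols_def Schur_elem_eq)
  then show ?thesis
    using spans_image[OF Schur_sum_elem_spans[OF V] copy(4) Schur_sum_module[OF V] Schur_module copy(3)]
    by simp
qed

lemma Schur_elem_closed: "(\<mu>, vs) \<in> symbols V \<Longrightarrow> elt V \<mu> vs \<in> carrier (SP V)"
  using sym_multilinear_on_closed[OF Schur_elem_sym_multilinear] by (auto simp: symbols_def)

lemma Schur_elem_multilinear:
  "\<mu> \<in> carrier (ops P n) \<Longrightarrow> multilinear_on R (replicate n V) (SP V) (elt V \<mu>)"
  unfolding multilinear_on_replicate
  by (intro allI impI conjI sym_multilinear_on_closed[OF Schur_elem_sym_multilinear]
      sym_multilinear_on_arg[OF Schur_elem_sym_multilinear]) simp_all

text \<open>By multilinearity the inputs can be restricted to any spanning set. Taking for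
  \<open>G\<close> the generators of \<open>S(P, V)\<close> gives generators of the iterated functor
  whose inputs are evaluated symbols, which is where the multiplication is prescribed.\<close>

lemma Schur_elem_spans:
  assumes G: "spans R V G"
  shows "spans R (SP V)
    {elt V \<mu> vs | \<mu> vs. \<mu> \<in> carrier (ops P (length vs)) \<and> set vs \<subseteq> G}"
  unfolding spans_def
proof (intro conjI allI impI)
  have GV: "G \<subseteq> carrier V" using G by (simp add: spans_def)
  then show "{elt V \<mu> vs | \<mu> vs. \<mu> \<in> carrier (ops P (length vs)) \<and> set vs \<subseteq> G}
      \<subseteq> carrier (SP V)"
    by (auto intro!: Schur_elem_closed simp: symbols_def)
  fix H assume H: "submodule H R (SP V)"
    "{elt V \<mu> vs | \<mu> vs. \<mu> \<in> carrier (ops P (length vs)) \<and> set vs \<subseteq> G} \<subseteq> H"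
  have "elt V \<mu> vs \<in> H" if s: "(\<mu>, vs) \<in> symbols V" for \<mu> vs
  proof (rule spans_list_induct[where Q = "\<lambda>xs. elt V \<mu> xs \<in> H" and k = "length vs", OF G])
    have \<mu>: "\<mu> \<in> carrier (ops P (length vs))" using s by (simp add: symbols_def)
    show "submodule {x \<in> carrier V. elt V \<mu> (xs[i := x]) \<in> H} R V"
      if "length xs = length vs" "set xs \<subseteq> carrier V" "i < length vs" for xs i
      by (rule submodule_preimage[OF multilinear_on_replicateD(2)[OF Schur_elem_multilinear[OF \<mu>] that]
            H(1) V Schur_module])
    show "elt V \<mu> xs \<in> H" if "length xs = length vs" "set xs \<subseteq> G" for xs
    proof -
      have "\<mu> \<in> carrier (ops P (length xs))" using \<mu> that by simp
      then show ?thesis using H(2) that by blast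
    qed
  qed (use s in \<open>auto simp: symbols_def\<close>)
  then show "carrier (SP V) \<subseteq> H"
    using Schur_elem_spans_carrier H(1) unfolding spans_def by blast
qed

lemma Schur_linear_eqI:
  assumes "spans R V G" "linear_on R (SP V) N f" "linear_on R (SP V) N g"
    and N: "Module.module R N"
    and "\<And>\<mu> vs. \<lbrakk>\<mu> \<in> carrier (ops P (length vs)); set vs \<subseteq> G\<rbrakk> \<Longrightarrow>
      f (elt V \<mu> vs) = g (elt V \<mu> vs)"
    and "x \<in> carrier (SP V)"
  shows "f x = g x"
proof (rule spans_linear_eq[OF Schur_elem_spans[OF assms(1)] assms(2,3) Schur_module N _ assms(6)])
  fix x assume "x \<in> {elt V \<mu> vs | \<mu> vs. \<mu> \<in> carrier (ops P (length vs)) \<and> set vs \<subseteq> G}"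
  then obtain \<mu> vs where "x = elt V \<mu> vs" "\<mu> \<in> carrier (ops P (length vs))" "set vs \<subseteq> G"
    by blast
  then show "f x = g x" using assms(5)[of \<mu> vs] by simp
qed

lemma eval_symbol_spans: "spans R (SP V) (eval_symbol V ` symbols V)"
proof -
  have "eval_symbol V ` symbols V = {elt V \<mu> vs | \<mu> vs. (\<mu>, vs) \<in> symbols V}"
    unfolding eval_symbol_def image_def Bex_def split_paired_Ex by (simp add: conj_commute)
  then show ?thesis using Schur_elem_spans_carrier by simp
qed

text \<open>After extending linearly in the first variable, the function is still admissible in each of the
  remaining ones: this is a linear condition, so it may be checked on generators.\<close>

lemma Schur_multilinear_lift:
  assumes N: "Module.module R N"
    and "\<And>xs. \<lbrakk>length xs = k; set xs \<subseteq> symbols V\<rbrakk> \<Longrightarrow> f xs \<in> carrier N"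
    and "\<And>xs i. \<lbrakk>length xs = k; set xs \<subseteq> symbols V; i < k\<rbrakk> \<Longrightarrow>
      sym_multilinear_on R P V N (\<lambda>\<mu> vs. f (xs[i := (\<mu>, vs)]))"
  shows "\<exists>F. multilinear_on R (replicate k (SP V)) N F \<and>
    (\<forall>xs. length xs = k \<longrightarrow> set xs \<subseteq> symbols V \<longrightarrow> F (map (eval_symbol V) xs) = f xs)"
  using assms(2,3)
proof (induction k arbitrary: f)
  case 0
  then show ?case
    by (intro exI[of _ "\<lambda>_. f []"]) (auto simp: multilinear_on_def)
next
  case (Suc k)
  interpret N: Module.module R N by (rule N)
  interpret S: Module.module R "SP V" by (rule Schur_module)
  let ?S = "SP V"
  have "\<exists>h. linear_on R ?S N h \<and> (\<forall>\<mu> vs. (\<mu>, vs) \<in> symbols V \<longrightarrow>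
      h (elt V \<mu> vs) = f ((\<mu>, vs) # xs))"
    if "length xs = k" "set xs \<subseteq> symbols V" for xs
  \<comment> \<open>The hypothesis on \<open>f\<close> concerns replacing an entry of a complete
    list of \<open>Suc k\<close> symbols, so some symbol is wanted as a placeholder for the first
    entry. If there is none, the condition on \<open>h\<close> is void.\<close>
  proof (cases "symbols V = {}")
    case True
    then show ?thesis using linear_on_const_zero[OF N, of ?S] by blast
  next
    case False
    then obtain s where "s \<in> symbols V" by blast
    then have "sym_multilinear_on R P V N (\<lambda>\<mu> vs. f ((s # xs)[0 := (\<mu>, vs)]))"
      using that by (intro Suc.prems(2)) auto
    from Schur_lift[OF N this] show ?thesis by simp
  qed
  then obtain h where h: "\<And>xs. \<lbrakk>length xs = k; set xs \<subseteq> symbols V\<rbrakk> \<Longrightarrow> linear_on R ?S N (h xs)"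
    "\<And>xs \<mu> vs. \<lbrakk>length xs = k; set xs \<subseteq> symbols V; (\<mu>, vs) \<in> symbols V\<rbrakk> \<Longrightarrow>
      h xs (elt V \<mu> vs) = f ((\<mu>, vs) # xs)"
    by metis
  have upd: "set (xs[i := s]) \<subseteq> symbols V" if "set xs \<subseteq> symbols V" "s \<in> symbols V" for xs i s
    using that set_update_subset_insert[of xs i s] by blast
  have sm: "sym_multilinear_on R P V N (\<lambda>\<mu> vs. h (xs[i := (\<mu>, vs)]) m)"
    if m: "m \<in> carrier ?S" and xs: "length xs = k" "set xs \<subseteq> symbols V" "i < k" for m xs i
  proof -
    let ?Q = "{m \<in> carrier ?S. sym_multilinear_on R P V N (\<lambda>\<mu> vs. h (xs[i := (\<mu>, vs)]) m)}"
    have "submodule ?Q R ?S"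
      by (rule submodule_sym_multilinear_on[OF V Schur_module N])
        (intro h(1) upd, use xs in auto)
    moreover have "{elt V \<mu> vs | \<mu> vs. (\<mu>, vs) \<in> symbols V} \<subseteq> ?Q"
    proof clarify
      fix \<mu> vs assume s: "(\<mu>, vs) \<in> symbols V"
      have "sym_multilinear_on R P V N (\<lambda>\<mu>' vs'. f (((\<mu>, vs) # xs)[Suc i := (\<mu>', vs')]))"
        using s xs by (intro Suc.prems(2)) auto
      then have "sym_multilinear_on R P V N (\<lambda>\<mu>' vs'. h (xs[i := (\<mu>', vs')]) (elt V \<mu> vs))"
      proof (rule sym_multilinear_on_cong[OF _ V])
        fix \<mu>' vs' assume "(\<mu>', vs') \<in> symbols V"
        then have "length (xs[i := (\<mu>', vs')]) = k" "set (xs[i := (\<mu>', vs')]) \<subseteq> symbols V"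
          using upd[OF xs(2)] xs(1) by auto
        from h(2)[OF this s]
        show "f (((\<mu>, vs) # xs)[Suc i := (\<mu>', vs')]) = h (xs[i := (\<mu>', vs')]) (elt V \<mu> vs)"
          by simp
      qed
      then show "elt V \<mu> vs \<in> carrier ?S \<and>
          sym_multilinear_on R P V N (\<lambda>\<mu>' vs'. h (xs[i := (\<mu>', vs')]) (elt V \<mu> vs))"
        using Schur_elem_closed[OF s] by blast
    qed
    ultimately show ?thesis using Schur_elem_spans_carrier m unfolding spans_def by blast
  qed
  \<comment> \<open>The induction hypothesis is applied to \<open>h xs m\<close> as a function of
    the remaining \<open>k\<close> symbols, with the first variable frozen at
    \<open>m\<close>.\<close>
  have "\<exists>F. multilinear_on R (replicate k ?S) N F \<and>
      (\<forall>xs. length xs = k \<longrightarrow> set xs \<subseteq> symbols V \<longrightarrow> F (map (eval_symbol V) xs) = h xs m)"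
    if m: "m \<in> carrier ?S" for m
    by (rule Suc.IH) (use m sm linear_on_closed[OF h(1)] in auto)
  then have "\<forall>m\<in>carrier ?S. \<exists>F. multilinear_on R (replicate k ?S) N F \<and>
      (\<forall>xs. length xs = k \<longrightarrow> set xs \<subseteq> symbols V \<longrightarrow> F (map (eval_symbol V) xs) = h xs m)"
    by (rule ballI)
  then obtain F where "\<forall>m\<in>carrier ?S. multilinear_on R (replicate k ?S) N (F m) \<and>
      (\<forall>xs. length xs = k \<longrightarrow> set xs \<subseteq> symbols V \<longrightarrow> F m (map (eval_symbol V) xs) = h xs m)"
    by (rule bchoice[THEN exE])
  then have F: "\<And>m. m \<in> carrier ?S \<Longrightarrow> multilinear_on R (replicate k ?S) N (F m)"
    "\<And>m xs. \<lbrakk>m \<in> carrier ?S; length xs = k; set xs \<subseteq> symbols V\<rbrakk> \<Longrightarrow> F m (map (eval_symbol V) xs) = h xs m"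
    by blast+
  have ex: "\<exists>xs. ys = map (eval_symbol V) xs \<and> length xs = k \<and> set xs \<subseteq> symbols V"
    if "length ys = k" "set ys \<subseteq> eval_symbol V ` symbols V" for ys
  proof -
    have "ys \<in> lists (eval_symbol V ` symbols V)" using that by auto
    then show ?thesis using that by (auto simp: lists_image)
  qed
  \<comment> \<open>\<open>F m\<close> was chosen independently for each \<open>m\<close>, so
    linearity in \<open>m\<close> has to be recovered. For fixed \<open>m\<close> and
    \<open>m'\<close> both sides are multilinear in \<open>ws\<close>, and on symbols they reduce to
    the linearity of \<open>h\<close>.\<close>
  have F_add: "F (m \<oplus>\<^bsub>?S\<^esub> m') ws = F m ws \<oplus>\<^bsub>N\<^esub> F m' ws"
    if "m \<in> carrier ?S" "m' \<in> carrier ?S" "length ws = k" "set ws \<subseteq> carrier ?S" for m m' ws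
  proof (rule multilinear_on_eqI[where F = "F (m \<oplus>\<^bsub>?S\<^esub> m')" and
        F' = "\<lambda>ws. F m ws \<oplus>\<^bsub>N\<^esub> F m' ws", OF eval_symbol_spans Schur_module N _ _ _ that(3,4)])
    show "multilinear_on R (replicate k ?S) N (F (m \<oplus>\<^bsub>?S\<^esub> m'))" using that by (intro F(1)) simp
    show "multilinear_on R (replicate k ?S) N (\<lambda>ws. F m ws \<oplus>\<^bsub>N\<^esub> F m' ws)"
      using that by (intro multilinear_on_plus F(1) N)
    fix ys assume "length ys = k" "set ys \<subseteq> eval_symbol V ` symbols V"
    from ex[OF this] obtain xs where xs: "ys = map (eval_symbol V) xs" "length xs = k" "set xs \<subseteq> symbols V"
      by blast
    then show "F (m \<oplus>\<^bsub>?S\<^esub> m') ys = F m ys \<oplus>\<^bsub>N\<^esub> F m' ys"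
      using that(1,2) by (simp add: F(2) linear_on_add[OF h(1)])
  qed
  have F_smult: "F (a \<odot>\<^bsub>?S\<^esub> m) ws = a \<odot>\<^bsub>N\<^esub> F m ws"
    if "a \<in> carrier R" "m \<in> carrier ?S" "length ws = k" "set ws \<subseteq> carrier ?S" for a m ws
  proof (rule multilinear_on_eqI[where F = "F (a \<odot>\<^bsub>?S\<^esub> m)" and
        F' = "\<lambda>ws. a \<odot>\<^bsub>N\<^esub> F m ws", OF eval_symbol_spans Schur_module N _ _ _ that(3,4)])
    show "multilinear_on R (replicate k ?S) N (F (a \<odot>\<^bsub>?S\<^esub> m))" using that by (intro F(1)) simp
    show "multilinear_on R (replicate k ?S) N (\<lambda>ws. a \<odot>\<^bsub>N\<^esub> F m ws)"
      using that by (intro multilinear_on_scaled F(1) N)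
    fix ys assume "length ys = k" "set ys \<subseteq> eval_symbol V ` symbols V"
    from ex[OF this] obtain xs where xs: "ys = map (eval_symbol V) xs" "length xs = k" "set xs \<subseteq> symbols V"
      by blast
    then show "F (a \<odot>\<^bsub>?S\<^esub> m) ys = a \<odot>\<^bsub>N\<^esub> F m ys"
      using that(1,2) by (simp add: F(2) linear_on_smult[OF h(1)])
  qed
  show ?case
  proof (intro exI[of _ "\<lambda>ws. F (hd ws) (tl ws)"] conjI allI impI)
    show "multilinear_on R (replicate (Suc k) ?S) N (\<lambda>ws. F (hd ws) (tl ws))"
      unfolding multilinear_on_replicate
    proof (intro allI impI conjI)
      fix xs assume *: "length xs = Suc k" "set xs \<subseteq> carrier ?S"
      then obtain w ws where ws: "xs = w # ws" "w \<in> carrier ?S" "length ws = k" "set ws \<subseteq> carrier ?S"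
        by (cases xs) auto
      show "F (hd xs) (tl xs) \<in> carrier N"
        using multilinear_on_replicateD(1)[OF F(1)] ws by simp
      fix i assume i: "i < Suc k"
      show "linear_on R ?S N (\<lambda>x. F (hd (xs[i := x])) (tl (xs[i := x])))"
      proof (cases i)
        case 0
        have "linear_on R ?S N (\<lambda>x. F x ws)"
        proof (rule linear_onI)
          show "F x ws \<in> carrier N" if "x \<in> carrier ?S" for x
            by (rule multilinear_on_replicateD(1)[OF F(1)[OF that] ws(3,4)])
        qed (rule F_add F_smult, assumption+, rule ws, rule ws)+
        then show ?thesis using 0 ws(1) by simp
      next
        case (Suc j)
        then show ?thesis
          using ws i multilinear_on_replicateD(2)[OF F(1)[OF ws(2)] ws(3,4), of j] by simp
      qed
    qed
    fix xs assume *: "length xs = Suc k" "set xs \<subseteq> symbols V"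
    then obtain \<mu> vs ys where ys: "xs = (\<mu>, vs) # ys" "(\<mu>, vs) \<in> symbols V" "length ys = k"
        "set ys \<subseteq> symbols V"
      by (cases xs) auto
    then have "eval_symbol V (\<mu>, vs) \<in> carrier ?S" by (simp add: eval_symbol_def Schur_elem_closed)
    then show "F (hd (map (eval_symbol V) xs)) (tl (map (eval_symbol V) xs)) = f xs"
      using ys by (simp add: F(2)) (simp add: eval_symbol_def h(2))
  qed
qed

end

end

section \<open>Complete composition in an operad\<close>

text \<open>\<open>comp_arity m \<nu>s\<close> is the arity after the operations \<open>\<nu>s\<close> have been inserted into
  \<open>length \<nu>s\<close> of \<open>m\<close> inputs. It is also the new number of the input \<open>m\<close>, if all of these
  precede it.\<close>

definition comp_arity :: "nat \<Rightarrow> (nat \<times> 'u) list \<Rightarrow> nat" where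
  "comp_arity m \<nu>s = m + sum_list (map fst \<nu>s) - length \<nu>s"

lemma comp_arity_Nil [simp]: "comp_arity m [] = m"
  by (simp add: comp_arity_def)

lemma comp_arity_append: "length xs + length ys \<le> m \<Longrightarrow>
    comp_arity m (xs @ ys) = comp_arity (comp_arity m ys) xs"
  by (simp add: comp_arity_def)

lemma comp_arity_snoc: "length xs < m \<Longrightarrow>
    comp_arity m (xs @ [(n, \<nu>)]) = comp_arity (m + n - 1) xs"
  by (simp add: comp_arity_def)

lemma comp_arity_add: "length xs \<le> m \<Longrightarrow> comp_arity (m + k) xs = comp_arity m xs + k"
  by (simp add: comp_arity_def)

lemma comp_arity_add_minus: "length xs < m \<Longrightarrow> comp_arity (m + k - 1) xs = comp_arity m xs + k - 1"
  by (simp add: comp_arity_def)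

lemma comp_arity_length: "comp_arity (length xs) xs = sum_list (map fst xs)"
  by (simp add: comp_arity_def)

lemma comp_arity_ge: "length xs \<le> k \<Longrightarrow> k \<le> m \<Longrightarrow> m - k \<le> comp_arity m xs"
  by (simp add: comp_arity_def)

text \<open>The complete composition with insertion starting at input \<open>s\<close>. The free
  starting point is what allows a list of operations to be split.\<close>

definition comp_at ::
    "('a, 'u) operad_data \<Rightarrow> nat \<Rightarrow> nat \<Rightarrow> 'u \<Rightarrow> (nat \<times> 'u) list \<Rightarrow> 'u" where
  "comp_at P s m \<xi> \<nu>s =
     snd (foldr (\<lambda>(i, n, \<nu>) (m, \<xi>). (m + n - 1, pcomp P m n i \<xi> \<nu>)) (enumerate s \<nu>s) (m, \<xi>))"

lemma full_comp_eq: "full_comp P k \<mu> \<nu>s = comp_at P 0 k \<mu> \<nu>s"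
  by (simp add: full_comp_def comp_at_def)

lemma comp_at_Nil [simp]: "comp_at P s m \<xi> [] = \<xi>"
  by (simp add: comp_at_def)

lemma comp_at_snoc:
  "comp_at P s m \<xi> (\<nu>s @ [(n, \<nu>)]) = comp_at P s (m + n - 1) (pcomp P m n (s + length \<nu>s) \<xi> \<nu>) \<nu>s"
  by (simp add: comp_at_def enumerate_append_eq)

text \<open>The last operation is inserted first, so \<open>ys\<close> goes in while the numbers are
  still the original ones, and \<open>xs\<close> afterwards at inputs that have kept their numbers.
  For the same reason the inductions on such lists run from the end.\<close>

lemma comp_at_append:
  assumes "length xs + length ys \<le> m"
  shows "comp_at P s m \<xi> (xs @ ys) =
    comp_at P s (comp_arity m ys) (comp_at P (s + length xs) m \<xi> ys) xs"
  using assms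
proof (induction ys arbitrary: m \<xi> rule: rev_induct)
  case (snoc y ys)
  obtain n \<nu> where y: "y = (n, \<nu>)" by force
  have "comp_at P s m \<xi> (xs @ ys @ [y]) =
      comp_at P s (m + n - 1) (pcomp P m n (s + length xs + length ys) \<xi> \<nu>) (xs @ ys)"
    using comp_at_snoc[of P s m \<xi> "xs @ ys" n \<nu>] by (simp add: y add.assoc)
  also have "\<dots> = comp_at P s (comp_arity (m + n - 1) ys)
      (comp_at P (s + length xs) (m + n - 1) (pcomp P m n (s + length xs + length ys) \<xi> \<nu>) ys) xs"
    using snoc.prems by (intro snoc.IH) simp
  finally show ?case using snoc.prems by (simp add: y comp_at_snoc comp_arity_snoc)
qed simp

text \<open>The block sum of the identity on the first \<open>s\<close> inputs with
  \<open>\<rho>\<close>. The permutations that come to act on complete compositions have this form: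
  some block is rearranged behind a stretch of untouched inputs.\<close>

definition shift_perm :: "nat \<Rightarrow> (nat \<Rightarrow> nat) \<Rightarrow> nat \<Rightarrow> nat" where
  "shift_perm s \<rho> j = (if j < s then j else s + \<rho> (j - s))"

lemma shift_perm_less:
  assumes "\<rho> permutes {..<n}" "s + n \<le> m" "j < m"
  shows "shift_perm s \<rho> j < m"
proof (cases "j < s")
  case False
  have "\<rho> permutes {..<m - s}" by (rule permutes_subset[OF assms(1)]) (use assms(2) in auto)
  from permutes_in_image[OF this, of "j - s"] have "\<rho> (j - s) < m - s"
    using False assms(3) by auto
  then show ?thesis using False by (simp add: shift_perm_def)
qed (use assms in \<open>simp add: shift_perm_def\<close>)

lemma shift_perm_permutes:
  assumes "\<rho> permutes {..<n}" "s + n \<le> m"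
  shows "shift_perm s \<rho> permutes {..<m}"
proof (rule bij_imp_permutes)
  have inv: "inv_into UNIV \<rho> permutes {..<n}" by (rule permutes_inv[OF assms(1)])
  show "bij_betw (shift_perm s \<rho>) {..<m} {..<m}"
  proof (rule bij_betw_byWitness[where f' = "shift_perm s (inv_into UNIV \<rho>)"])
    show "\<forall>j\<in>{..<m}. shift_perm s (inv_into UNIV \<rho>) (shift_perm s \<rho> j) = j"
      "\<forall>j\<in>{..<m}. shift_perm s \<rho> (shift_perm s (inv_into UNIV \<rho>) j) = j"
      using permutes_inverses[OF assms(1)] by (simp_all add: shift_perm_def)
  qed (use shift_perm_less[OF assms] shift_perm_less[OF inv assms(2)] in blast)+
  show "shift_perm s \<rho> j = j" if "j \<notin> {..<m}" for j
  proof -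
    have "\<rho> (j - s) = j - s"
      by (rule permutes_not_in[OF assms(1)]) (use that assms(2) in auto)
    then show ?thesis using that assms(2) by (simp add: shift_perm_def)
  qed
qed

lemma permute_list_shift_perm:
  assumes "\<rho> permutes {..<length vs}"
  shows "permute_list (shift_perm (length us) \<rho>) (us @ vs @ ws) = us @ permute_list \<rho> vs @ ws"
proof (rule nth_equalityI)
  fix j assume "j < length (permute_list (shift_perm (length us) \<rho>) (us @ vs @ ws))"
  then have j: "j < length us + length vs + length ws" by simp
  have \<rho>: "\<rho> k < length vs \<longleftrightarrow> k < length vs" for k
    using permutes_in_image[OF assms, of k] by simp
  have \<rho>': "\<rho> k = k" if "\<not> k < length vs" for k
    using permutes_not_in[OF assms, of k] that by simp
  have "shift_perm (length us) \<rho> permutes {..<length (us @ vs @ ws)}"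
    by (rule shift_perm_permutes[OF assms]) simp
  from permute_list_nth[OF this, of j]
  have "permute_list (shift_perm (length us) \<rho>) (us @ vs @ ws) ! j =
      (us @ vs @ ws) ! shift_perm (length us) \<rho> j" using j by simp
  also have "\<dots> = (us @ permute_list \<rho> vs @ ws) ! j"
    using j \<rho> \<rho>' by (auto simp: shift_perm_def nth_append permute_list_nth[OF assms])
  finally show "permute_list (shift_perm (length us) \<rho>) (us @ vs @ ws) ! j =
    (us @ permute_list \<rho> vs @ ws) ! j" .
qed simp

text \<open>The insertion point lies among the fixed inputs before \<open>s\<close>, so the
  permutation keeps its shape and only its start is renumbered, to \<open>s + n - 1\<close>.\<close>

lemma perm_pcomp_shift_perm:
  assumes "\<rho> permutes {..<m - s}" "i < s" "s \<le> m"
  shows "perm_pcomp m n i (shift_perm s \<rho>) id = shift_perm (s + n - 1) \<rho>"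
proof
  fix j
  have "\<rho> k = k" if "m - s \<le> k" for k using permutes_not_in[OF assms(1), of k] that by simp
  note \<rho> = this
  \<comment> \<open>In this order: inputs beyond the new arity, the inserted block, the inputs
    before it, the fixed inputs between it and the new start, and the inputs moved by
    \<open>\<rho>\<close>.\<close>
  consider "m + n - 1 \<le> j" | "i \<le> j" "j < i + n" "j < m + n - 1" | "j < i" "j < m + n - 1"
    | "i + n \<le> j" "j < s + n - 1" "j < m + n - 1" | "s + n - 1 \<le> j" "i + n \<le> j" "j < m + n - 1"
    by linarith
  then show "perm_pcomp m n i (shift_perm s \<rho>) id j = shift_perm (s + n - 1) \<rho> j"
  proof cases
    case 1
    then have "\<rho> (j - (s + n - 1)) = j - (s + n - 1)" using assms by (intro \<rho>) simp
    then show ?thesis using 1 assms by (simp add: perm_pcomp_def shift_perm_def)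
  next
    case 5
    then have "j + 1 - n - s = j - (s + n - 1)" using assms by simp
    then show ?thesis using 5 assms by (simp add: perm_pcomp_def shift_perm_def Let_def) arith
  qed (use assms in \<open>auto simp: perm_pcomp_def shift_perm_def Let_def\<close>)
qed

lemma perm_pcomp_id_left:
  assumes "\<tau> permutes {..<n}" "i < m"
  shows "perm_pcomp m n i id \<tau> = shift_perm i \<tau>"
proof
  fix j
  have "\<tau> k = k" if "n \<le> k" for k using permutes_not_in[OF assms(1), of k] that by simp
  then show "perm_pcomp m n i id \<tau> j = shift_perm i \<tau> j"
    using assms(2) by (auto simp: perm_pcomp_def shift_perm_def Let_def)
qed

text \<open>The insertion point lies behind all the inputs that \<open>\<sigma>\<close> moves, so
  neither they nor their images are renumbered.\<close>

lemma perm_pcomp_before: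
  assumes "\<sigma> permutes {..<q}" "q \<le> i" "i < m"
  shows "perm_pcomp m n i \<sigma> id = \<sigma>"
proof
  fix j
  have 1: "\<sigma> k = k" if "q \<le> k" for k using permutes_not_in[OF assms(1), of k] that by simp
  have 2: "\<sigma> k < q" if "k < q" for k using permutes_in_image[OF assms(1), of k] that by simp
  show "perm_pcomp m n i \<sigma> id j = \<sigma> j"
  proof (cases "j < q")
    case True
    then show ?thesis using 1[of i] 2[of j] assms by (auto simp: perm_pcomp_def Let_def)
  next
    case False
    then show ?thesis using 1[of i] 1[of j] 1[of "j + 1 - n"] assms
      by (auto simp: perm_pcomp_def Let_def)
  qed
qed

text \<open>Exchange of adjacent blocks of lengths \<open>a\<close> and \<open>b\<close>, in the
  convention of \<open>permute_list\<close>: position \<open>j\<close> of the result reads position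
  \<open>block_swap a b j\<close> of the source. So the first \<open>b\<close> positions read the
  second block.\<close>

definition block_swap :: "nat \<Rightarrow> nat \<Rightarrow> nat \<Rightarrow> nat" where
  "block_swap a b j = (if j < b then a + j else if j < a + b then j - b else j)"

lemma block_swap_permutes: "block_swap a b permutes {..<a + b}"
proof (rule bij_imp_permutes)
  show "bij_betw (block_swap a b) {..<a + b} {..<a + b}"
    by (rule bij_betw_byWitness[where f' = "block_swap b a"]) (auto simp: block_swap_def)
qed (auto simp: block_swap_def)

lemma permute_list_block_swap:
  "permute_list (block_swap (length us) (length vs)) (us @ vs) = vs @ us"
proof (rule nth_equalityI)
  fix j assume "j < length (permute_list (block_swap (length us) (length vs)) (us @ vs))"
  then show "permute_list (block_swap (length us) (length vs)) (us @ vs) ! j = (vs @ us) ! j"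
    using permute_list_nth[of "block_swap (length us) (length vs)" "us @ vs" j] block_swap_permutes
    by (auto simp: block_swap_def nth_append)
qed simp

text \<open>First half of turning a transposition into a block exchange: input \<open>Suc p\<close>
  is widened to a block of length \<open>a\<close>, while input \<open>p\<close> is still a block of
  length 1.\<close>

lemma perm_pcomp_transpose:
  assumes "Suc p < m"
  shows "perm_pcomp m a (Suc p) (transpose p (Suc p)) id = shift_perm p (block_swap a 1)"
proof
  fix j
  consider "j < p" | "j = p" | "Suc p \<le> j" "j < Suc p + a" | "Suc p + a \<le> j" by linarith
  then show "perm_pcomp m a (Suc p) (transpose p (Suc p)) id j = shift_perm p (block_swap a 1) j"
  proof cases
    case 4
    then have "Suc (j - a) \<noteq> p" "j - a \<noteq> p" "Suc j - a \<noteq> p" "Suc j - a \<noteq> Suc p" by linarith+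
    then show ?thesis using 4 assms
      by (auto simp: perm_pcomp_def transpose_def Let_def shift_perm_def block_swap_def)
  qed (use assms in \<open>auto simp: perm_pcomp_def transpose_def Let_def shift_perm_def block_swap_def\<close>)
qed

text \<open>Second half: the remaining single input, at \<open>p\<close>, is widened to length
  \<open>b\<close>.\<close>

lemma perm_pcomp_block_swap:
  assumes "p < m"
  shows "perm_pcomp (m + a) b p (shift_perm p (block_swap a 1)) id = shift_perm p (block_swap a b)"
proof
  fix j
  consider "j < p" | "p \<le> j" "j < p + b" | "p + b \<le> j" "j < p + b + a" | "p + b + a \<le> j" by linarith
  then show "perm_pcomp (m + a) b p (shift_perm p (block_swap a 1)) id j = shift_perm p (block_swap a b) j"
  proof cases
    case 4
    then have "p + a < Suc j - b" by linarith
    then show ?thesis using 4 assms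
      by (auto simp: perm_pcomp_def shift_perm_def block_swap_def Let_def)
  qed (use assms in \<open>auto simp: perm_pcomp_def shift_perm_def block_swap_def Let_def\<close>)
qed

section \<open>Linearity, equivariance and associativity of complete composition\<close>

context operad
begin

definition arity_ops :: "(nat \<times> 'u) set" where
  "arity_ops = {(n, \<nu>). \<nu> \<in> carrier (ops P n)}"

lemma arity_ops_iff [simp]: "(n, \<nu>) \<in> arity_ops \<longleftrightarrow> \<nu> \<in> carrier (ops P n)"
  by (simp add: arity_ops_def)

lemma comp_at_closed:
  "\<lbrakk>set \<nu>s \<subseteq> arity_ops; s + length \<nu>s \<le> m; \<xi> \<in> carrier (ops P m)\<rbrakk> \<Longrightarrow>
    comp_at P s m \<xi> \<nu>s \<in> carrier (ops P (comp_arity m \<nu>s))"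
proof (induction \<nu>s arbitrary: m \<xi> rule: rev_induct)
  case (snoc y \<nu>s)
  obtain n \<nu> where y: "y = (n, \<nu>)" by force
  have l: "length \<nu>s < m" using snoc.prems by simp
  show ?case
    unfolding y comp_at_snoc comp_arity_snoc[OF l]
    by (rule snoc.IH) (use snoc.prems in \<open>auto simp: y intro: pcomp_closed[unfolded One_nat_def]\<close>)
qed simp

lemma pcomp_linear_left: "\<lbrakk>i < m; \<nu> \<in> carrier (ops P n)\<rbrakk> \<Longrightarrow>
    linear_on R (ops P m) (ops P (m + n - 1)) (\<lambda>\<xi>. pcomp P m n i \<xi> \<nu>)"
  by (intro linear_onI pcomp_closed pcomp_add_left pcomp_smult_left)

lemma pcomp_linear_right: "\<lbrakk>i < m; \<xi> \<in> carrier (ops P m)\<rbrakk> \<Longrightarrow>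
    linear_on R (ops P n) (ops P (m + n - 1)) (\<lambda>\<nu>. pcomp P m n i \<xi> \<nu>)"
  by (intro linear_onI pcomp_closed pcomp_add_right pcomp_smult_right)

lemma comp_at_linear_left:
  "\<lbrakk>set \<nu>s \<subseteq> arity_ops; s + length \<nu>s \<le> m\<rbrakk> \<Longrightarrow>
    linear_on R (ops P m) (ops P (comp_arity m \<nu>s)) (\<lambda>\<xi>. comp_at P s m \<xi> \<nu>s)"
proof (induction \<nu>s arbitrary: m rule: rev_induct)
  case Nil
  then show ?case by (simp add: linear_on_id)
next
  case (snoc y \<nu>s)
  obtain n \<nu> where y: "y = (n, \<nu>)" by force
  have "linear_on R (ops P (m + n - 1)) (ops P (comp_arity (m + n - 1) \<nu>s))
      (\<lambda>\<xi>. comp_at P s (m + n - 1) \<xi> \<nu>s)"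
    using snoc.prems by (intro snoc.IH) auto
  from linear_on_compose[OF pcomp_linear_left this]
  show ?case using snoc.prems by (simp add: y comp_at_snoc comp_arity_snoc)
qed

text \<open>When the list is split at the varying entry, the later operations are already inside,
  the entry itself enters through the right linearity of one partial composition, and the earlier
  operations act linearly on the result.\<close>

lemma comp_at_linear_arg:
  assumes "set xs \<subseteq> arity_ops" "set ys \<subseteq> arity_ops" "s + length xs + length ys < m"
    and \<xi>: "\<xi> \<in> carrier (ops P m)"
  shows "linear_on R (ops P n) (ops P (comp_arity m (xs @ (n, \<nu>) # ys)))
    (\<lambda>\<nu>. comp_at P s m \<xi> (xs @ (n, \<nu>) # ys))"
proof -
  let ?m = "comp_arity m ys" and ?\<xi> = "comp_at P (s + length xs + 1) m \<xi> ys"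
  have m: "s + length xs < ?m" using assms(3) comp_arity_ge[of ys "length ys" m] by simp
  have "?\<xi> \<in> carrier (ops P ?m)" using assms by (intro comp_at_closed) auto
  from pcomp_linear_right[OF m this]
  have "linear_on R (ops P n) (ops P (?m + n - 1)) (\<lambda>\<nu>. pcomp P ?m n (s + length xs) ?\<xi> \<nu>)" .
  from linear_on_compose[OF this comp_at_linear_left[OF assms(1), of s]] m
  have *: "linear_on R (ops P n) (ops P (comp_arity (?m + n - 1) xs))
    (\<lambda>\<nu>. comp_at P s (?m + n - 1) (pcomp P ?m n (s + length xs) ?\<xi> \<nu>) xs)" by simp
  have "comp_at P s m \<xi> (xs @ (n, \<nu>) # ys) =
      comp_at P s (?m + n - 1) (pcomp P ?m n (s + length xs) ?\<xi> \<nu>) xs" for \<nu>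
    using comp_at_append[of "xs @ [(n, \<nu>)]" ys m P s \<xi>] assms(3) by (simp add: comp_at_snoc)
  moreover have "comp_arity m (xs @ (n, \<nu>) # ys) = comp_arity (?m + n - 1) xs"
    using comp_arity_append[of "xs @ [(n, \<nu>)]" ys m] m assms(3) by (simp add: comp_arity_snoc)
  ultimately show ?thesis using * by simp
qed

text \<open>All filled inputs lie before \<open>s\<close>, where the permutation is the identity, so
  equivariance moves it outside; its start becomes \<open>comp_arity s \<nu>s\<close>, the new
  number of input \<open>s\<close>.\<close>

lemma comp_at_act_shift_perm:
  "\<lbrakk>set \<nu>s \<subseteq> arity_ops; t + length \<nu>s \<le> s; s \<le> m; \<xi> \<in> carrier (ops P m);
    \<rho> permutes {..<m - s}\<rbrakk> \<Longrightarrow>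
    comp_at P t m (act P m \<xi> (shift_perm s \<rho>)) \<nu>s =
      act P (comp_arity m \<nu>s) (comp_at P t m \<xi> \<nu>s) (shift_perm (comp_arity s \<nu>s) \<rho>)"
proof (induction \<nu>s arbitrary: m s \<xi> rule: rev_induct)
  case (snoc y \<nu>s)
  obtain n \<nu> where y: "y = (n, \<nu>)" by force
  let ?i = "t + length \<nu>s"
  have i: "?i < s" "?i < m" using snoc.prems by auto
  \<comment> \<open>The equivariance axiom permutes both operations at once; the inserted one gets
    the identity, which \<open>act_id\<close> removes again.\<close>
  have "pcomp P m n ?i (act P m \<xi> (shift_perm s \<rho>)) (act P n \<nu> id) =
      act P (m + n - 1) (pcomp P m n (shift_perm s \<rho> ?i) \<xi> \<nu>)
        (perm_pcomp m n ?i (shift_perm s \<rho>) id)"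
    using snoc.prems i by (intro pcomp_equivariant shift_perm_permutes[of \<rho> "m - s"] permutes_id)
      (auto simp: y)
  then have "pcomp P m n ?i (act P m \<xi> (shift_perm s \<rho>)) \<nu> =
      act P (m + n - 1) (pcomp P m n ?i \<xi> \<nu>) (shift_perm (s + n - 1) \<rho>)"
    using snoc.prems i by (simp add: y act_id perm_pcomp_shift_perm) (simp add: shift_perm_def)
  moreover have "comp_at P t (m + n - 1)
      (act P (m + n - 1) (pcomp P m n ?i \<xi> \<nu>) (shift_perm (s + n - 1) \<rho>)) \<nu>s =
    act P (comp_arity (m + n - 1) \<nu>s) (comp_at P t (m + n - 1) (pcomp P m n ?i \<xi> \<nu>) \<nu>s)
      (shift_perm (comp_arity (s + n - 1) \<nu>s) \<rho>)"
  proof (rule snoc.IH)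
    have "m + n - 1 - (s + n - 1) = m - s" using i by simp
    then show "\<rho> permutes {..<m + n - 1 - (s + n - 1)}" using snoc.prems by simp
  qed (use snoc.prems i in \<open>auto simp: y intro: pcomp_closed[unfolded One_nat_def]\<close>)
  ultimately show ?case
    using snoc.prems i by (simp add: y comp_at_snoc comp_arity_snoc)
qed simp

text \<open>The complementary situation: only inputs in front of every insertion point are moved,
  and these keep their numbers, so the permutation is unchanged.\<close>

lemma comp_at_act_before:
  "\<lbrakk>set \<nu>s \<subseteq> arity_ops; q \<le> s; s + length \<nu>s \<le> m; \<xi> \<in> carrier (ops P m); \<sigma> permutes {..<q}\<rbrakk> \<Longrightarrow>
    comp_at P s m (act P m \<xi> \<sigma>) \<nu>s = act P (comp_arity m \<nu>s) (comp_at P s m \<xi> \<nu>s) \<sigma>"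
proof (induction \<nu>s arbitrary: m \<xi> rule: rev_induct)
  case (snoc y \<nu>s)
  obtain n \<nu> where y: "y = (n, \<nu>)" by force
  let ?i = "s + length \<nu>s"
  have i: "?i < m" using snoc.prems by auto
  have "\<sigma> ?i = ?i" using permutes_not_in[OF snoc.prems(5), of ?i] snoc.prems(2) by simp
  moreover have "pcomp P m n ?i (act P m \<xi> \<sigma>) (act P n \<nu> id) =
      act P (m + n - 1) (pcomp P m n (\<sigma> ?i) \<xi> \<nu>) (perm_pcomp m n ?i \<sigma> id)"
    using snoc.prems i by (intro pcomp_equivariant permutes_subset[OF snoc.prems(5)] permutes_id)
      (auto simp: y)
  ultimately have "pcomp P m n ?i (act P m \<xi> \<sigma>) \<nu> = act P (m + n - 1) (pcomp P m n ?i \<xi> \<nu>) \<sigma>"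
    using snoc.prems i perm_pcomp_before[of \<sigma> q ?i m n] by (simp add: y act_id)
  moreover have "comp_at P s (m + n - 1) (act P (m + n - 1) (pcomp P m n ?i \<xi> \<nu>) \<sigma>) \<nu>s =
    act P (comp_arity (m + n - 1) \<nu>s) (comp_at P s (m + n - 1) (pcomp P m n ?i \<xi> \<nu>) \<nu>s) \<sigma>"
    by (rule snoc.IH) (use snoc.prems i in \<open>auto simp: y intro: pcomp_closed[unfolded One_nat_def]\<close>)
  ultimately show ?case
    using snoc.prems i by (simp add: y comp_at_snoc comp_arity_snoc)
qed simp

text \<open>When \<open>\<nu>\<close> is inserted, \<open>\<tau>\<close> becomes a permutation of
  the block that starts at \<open>length xs\<close>. Filling the inputs before it then pushes this
  block to the total arity of \<open>xs\<close>.\<close>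

lemma comp_at_act_arg:
  assumes "set xs \<subseteq> arity_ops" "set ys \<subseteq> arity_ops" "length xs + length ys < m"
    "\<xi> \<in> carrier (ops P m)" "\<nu> \<in> carrier (ops P n)" "\<tau> permutes {..<n}"
  shows "comp_at P 0 m \<xi> (xs @ (n, act P n \<nu> \<tau>) # ys) =
    act P (comp_arity m (xs @ (n, \<nu>) # ys)) (comp_at P 0 m \<xi> (xs @ (n, \<nu>) # ys))
      (shift_perm (sum_list (map fst xs)) \<tau>)"
proof -
  let ?m = "comp_arity m ys" and ?\<xi> = "comp_at P (length xs + 1) m \<xi> ys" and ?i = "length xs"
  have m: "?i < ?m" using assms(3) comp_arity_ge[of ys "length ys" m] by simp
  have \<xi>: "?\<xi> \<in> carrier (ops P ?m)" using assms by (intro comp_at_closed) auto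
  have eq: "comp_at P 0 m \<xi> (xs @ (n, \<nu>) # ys) =
      comp_at P 0 (?m + n - 1) (pcomp P ?m n ?i ?\<xi> \<nu>) xs" for \<nu>
    using comp_at_append[of "xs @ [(n, \<nu>)]" ys m P 0 \<xi>] assms(3) by (simp add: comp_at_snoc)
  have ar: "comp_arity m (xs @ (n, \<nu>) # ys) = comp_arity (?m + n - 1) xs"
    using comp_arity_append[of "xs @ [(n, \<nu>)]" ys m] m assms(3) by (simp add: comp_arity_snoc)
  have "pcomp P ?m n ?i (act P ?m ?\<xi> id) (act P n \<nu> \<tau>) =
      act P (?m + n - 1) (pcomp P ?m n (id ?i) ?\<xi> \<nu>) (perm_pcomp ?m n ?i id \<tau>)"
    using assms m \<xi> by (intro pcomp_equivariant permutes_id) auto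
  then have "pcomp P ?m n ?i ?\<xi> (act P n \<nu> \<tau>) =
      act P (?m + n - 1) (pcomp P ?m n ?i ?\<xi> \<nu>) (shift_perm ?i \<tau>)"
    using assms m \<xi> by (simp add: act_id perm_pcomp_id_left)
  moreover have "comp_at P 0 (?m + n - 1)
      (act P (?m + n - 1) (pcomp P ?m n ?i ?\<xi> \<nu>) (shift_perm ?i \<tau>)) xs =
    act P (comp_arity (?m + n - 1) xs) (comp_at P 0 (?m + n - 1) (pcomp P ?m n ?i ?\<xi> \<nu>) xs)
      (shift_perm (comp_arity ?i xs) \<tau>)"
  proof (rule comp_at_act_shift_perm)
    show "\<tau> permutes {..<?m + n - 1 - ?i}"
      by (rule permutes_subset[OF assms(6)]) (use m in auto)
  qed (use assms m \<xi> in \<open>auto intro: pcomp_closed[unfolded One_nat_def]\<close>)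
  ultimately show ?thesis by (simp add: eq ar comp_arity_length)
qed

text \<open>The core of the equivariance in the outer operation. \<open>ys\<close> leaves the
  transposition alone, each of the next two insertions widens one of the exchanged inputs, and
  \<open>xs\<close> only moves the start of the resulting block exchange.\<close>

lemma comp_at_act_transpose:
  assumes "set xs \<subseteq> arity_ops" "set ys \<subseteq> arity_ops" "length xs + length ys + 2 \<le> m"
    "\<xi> \<in> carrier (ops P m)" "\<mu> \<in> carrier (ops P a)" "\<nu> \<in> carrier (ops P b)"
  shows "comp_at P 0 m (act P m \<xi> (transpose (length xs) (Suc (length xs)))) (xs @ (b, \<nu>) # (a, \<mu>) # ys) =
    act P (comp_arity m (xs @ (a, \<mu>) # (b, \<nu>) # ys)) (comp_at P 0 m \<xi> (xs @ (a, \<mu>) # (b, \<nu>) # ys))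
      (shift_perm (sum_list (map fst xs)) (block_swap a b))"
proof -
  let ?p = "length xs"
  let ?m = "comp_arity m ys" and ?\<xi> = "comp_at P (?p + 2) m \<xi> ys" and ?\<sigma> = "transpose ?p (Suc ?p)"
  have m: "Suc ?p < ?m" using assms(3) comp_arity_ge[of ys "length ys" m] by simp
  have \<xi>: "?\<xi> \<in> carrier (ops P ?m)" using assms by (intro comp_at_closed) auto
  have eq: "comp_at P 0 m \<zeta> (xs @ (b, \<nu>) # (a, \<mu>) # ys) =
      comp_at P 0 (?m + a - 1 + b - 1)
        (pcomp P (?m + a - 1) b ?p (pcomp P ?m a (Suc ?p) (comp_at P (?p + 2) m \<zeta> ys) \<mu>) \<nu>) xs" for \<zeta> \<mu> \<nu> a b
    using comp_at_append[of "(xs @ [(b, \<nu>)]) @ [(a, \<mu>)]" ys m P 0 \<zeta>] assms(3)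
    unfolding comp_at_snoc by simp
  have ar: "comp_arity m (xs @ (a, \<mu>) # (b, \<nu>) # ys) = comp_arity (?m + b - 1 + a - 1) xs"
    using comp_arity_append[of "(xs @ [(a, \<mu>)]) @ [(b, \<nu>)]" ys m] m assms(3)
    by (simp add: comp_arity_def)
  have perm: "?\<sigma> permutes {..<?p + 2}" by (rule permutes_swap_id) auto
  have perm': "?\<sigma> permutes {..<?m}" by (rule permutes_swap_id) (use m in auto)
  let ?\<sigma>1 = "perm_pcomp ?m a (Suc ?p) ?\<sigma> id"
  obtain m' where m': "?m = Suc m'" "?p < m'" using m by (cases ?m) auto
  have \<sigma>1: "?\<sigma>1 ?p = ?p + a" "perm_pcomp (?m + a - 1) b ?p ?\<sigma>1 id = shift_perm ?p (block_swap a b)"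
    unfolding perm_pcomp_transpose[OF m] using perm_pcomp_block_swap[OF m'(2), of a b] m'(1)
    by (simp add: shift_perm_def block_swap_def, simp)
  have e: "?m + b - 1 + a - 1 = ?m + a - 1 + b - 1" using m by simp
  have \<zeta>: "pcomp P (?m + b - 1) a ?p (pcomp P ?m b (Suc ?p) ?\<xi> \<nu>) \<mu> \<in> carrier (ops P (?m + a - 1 + b - 1))"
    unfolding e[symmetric] using assms m \<xi> by (intro pcomp_closed) auto
  have "comp_at P (?p + 2) m (act P m \<xi> ?\<sigma>) ys = act P ?m ?\<xi> ?\<sigma>"
    using assms perm by (intro comp_at_act_before) auto
  moreover have "pcomp P ?m a (Suc ?p) (act P ?m ?\<xi> ?\<sigma>) (act P a \<mu> id) =
      act P (?m + a - 1) (pcomp P ?m a (?\<sigma> (Suc ?p)) ?\<xi> \<mu>) ?\<sigma>1"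
    using assms m \<xi> perm' by (intro pcomp_equivariant permutes_id) auto
  moreover have "pcomp P (?m + a - 1) b ?p (act P (?m + a - 1) (pcomp P ?m a ?p ?\<xi> \<mu>) ?\<sigma>1) (act P b \<nu> id) =
      act P (?m + a - 1 + b - 1) (pcomp P (?m + a - 1) b (?\<sigma>1 ?p) (pcomp P ?m a ?p ?\<xi> \<mu>) \<nu>)
        (perm_pcomp (?m + a - 1) b ?p ?\<sigma>1 id)"
  proof (rule pcomp_equivariant)
    show "?\<sigma>1 permutes {..<?m + a - 1}"
      unfolding perm_pcomp_transpose[OF m]
      by (rule shift_perm_permutes[OF block_swap_permutes]) (use m in simp)
  qed (use assms m \<xi> in \<open>auto intro: pcomp_closed[unfolded One_nat_def] permutes_id\<close>)
  \<comment> \<open>Under the permutation \<open>\<mu>\<close> has entered at \<open>p\<close>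
    before \<open>\<nu>\<close>, whereas \<open>comp_at\<close> inserts the later operation first.
    The parallel axiom restores that order.\<close>
  moreover have "pcomp P (?m + a - 1) b (?p + a) (pcomp P ?m a ?p ?\<xi> \<mu>) \<nu> =
      pcomp P (?m + b - 1) a ?p (pcomp P ?m b (Suc ?p) ?\<xi> \<nu>) \<mu>"
    using pcomp_assoc_parallel[of ?p "Suc ?p" ?m ?\<xi> \<mu> a \<nu> b] assms m \<xi> by simp
  ultimately have "pcomp P (?m + a - 1) b ?p
      (pcomp P ?m a (Suc ?p) (comp_at P (?p + 2) m (act P m \<xi> ?\<sigma>) ys) \<mu>) \<nu> =
    act P (?m + a - 1 + b - 1) (pcomp P (?m + b - 1) a ?p (pcomp P ?m b (Suc ?p) ?\<xi> \<nu>) \<mu>)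
      (shift_perm ?p (block_swap a b))"
    using assms \<sigma>1 by (simp add: act_id)
  moreover have "comp_at P 0 (?m + a - 1 + b - 1) (act P (?m + a - 1 + b - 1)
        (pcomp P (?m + b - 1) a ?p (pcomp P ?m b (Suc ?p) ?\<xi> \<nu>) \<mu>) (shift_perm ?p (block_swap a b))) xs =
     act P (comp_arity (?m + a - 1 + b - 1) xs) (comp_at P 0 (?m + a - 1 + b - 1)
        (pcomp P (?m + b - 1) a ?p (pcomp P ?m b (Suc ?p) ?\<xi> \<nu>) \<mu>) xs)
      (shift_perm (comp_arity ?p xs) (block_swap a b))"
  proof (rule comp_at_act_shift_perm)
    show "block_swap a b permutes {..<?m + a - 1 + b - 1 - ?p}"
      by (rule permutes_subset[OF block_swap_permutes]) (use m in auto)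
  qed (use assms m \<zeta> in auto)
  ultimately show ?thesis by (simp only: eq ar comp_arity_length e)
qed

text \<open>Iterated parallel associativity: an insertion at a later input commutes with all of
  \<open>\<nu>s\<close>, once that input has been renumbered.\<close>

lemma comp_at_pcomp_after:
  "\<lbrakk>set \<nu>s \<subseteq> arity_ops; s + length \<nu>s \<le> i; i < m; \<xi> \<in> carrier (ops P m); \<nu> \<in> carrier (ops P n)\<rbrakk> \<Longrightarrow>
    comp_at P s (m + n - 1) (pcomp P m n i \<xi> \<nu>) \<nu>s =
      pcomp P (comp_arity m \<nu>s) n (comp_arity i \<nu>s) (comp_at P s m \<xi> \<nu>s) \<nu>"
proof (induction \<nu>s arbitrary: m i \<xi> rule: rev_induct)
  case (snoc y \<nu>s)
  obtain n' \<nu>' where y: "y = (n', \<nu>')" by force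
  let ?q = "s + length \<nu>s"
  have q: "?q < i" "?q < m" using snoc.prems by auto
  have "pcomp P (m + n - 1) n' ?q (pcomp P m n i \<xi> \<nu>) \<nu>' =
      pcomp P (m + n' - 1) n (i + n' - 1) (pcomp P m n' ?q \<xi> \<nu>') \<nu>"
    using pcomp_assoc_parallel[of ?q i m \<xi> \<nu>' n' \<nu> n] snoc.prems q by (simp add: y)
  moreover have "comp_at P s (m + n' - 1 + n - 1)
      (pcomp P (m + n' - 1) n (i + n' - 1) (pcomp P m n' ?q \<xi> \<nu>') \<nu>) \<nu>s =
    pcomp P (comp_arity (m + n' - 1) \<nu>s) n (comp_arity (i + n' - 1) \<nu>s)
      (comp_at P s (m + n' - 1) (pcomp P m n' ?q \<xi> \<nu>') \<nu>s) \<nu>"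
    by (rule snoc.IH) (use snoc.prems q in \<open>auto simp: y intro: pcomp_closed[unfolded One_nat_def]\<close>)
  moreover have "m + n' - 1 + n - 1 = m + n - 1 + n' - 1" using q by simp
  ultimately show ?case
    using snoc.prems q by (simp add: y comp_at_snoc comp_arity_snoc)
qed simp

lemma comp_at_comp_at_after:
  "\<lbrakk>set xs \<subseteq> arity_ops; set \<nu>s \<subseteq> arity_ops; s + length \<nu>s \<le> i; i + length xs \<le> m;
    \<xi> \<in> carrier (ops P m)\<rbrakk> \<Longrightarrow>
    comp_at P s (comp_arity m xs) (comp_at P i m \<xi> xs) \<nu>s =
      comp_at P (comp_arity i \<nu>s) (comp_arity m \<nu>s) (comp_at P s m \<xi> \<nu>s) xs"
proof (induction xs arbitrary: m \<xi> rule: rev_induct)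
  case (snoc y xs)
  obtain n \<nu> where y: "y = (n, \<nu>)" by force
  let ?i = "i + length xs"
  have i: "?i < m" using snoc.prems by auto
  have "comp_at P s (comp_arity (m + n - 1) xs) (comp_at P i (m + n - 1) (pcomp P m n ?i \<xi> \<nu>) xs) \<nu>s =
    comp_at P (comp_arity i \<nu>s) (comp_arity (m + n - 1) \<nu>s)
      (comp_at P s (m + n - 1) (pcomp P m n ?i \<xi> \<nu>) \<nu>s) xs"
    by (rule snoc.IH) (use snoc.prems i in \<open>auto simp: y intro: pcomp_closed[unfolded One_nat_def]\<close>)
  moreover have "comp_at P s (m + n - 1) (pcomp P m n ?i \<xi> \<nu>) \<nu>s =
      pcomp P (comp_arity m \<nu>s) n (comp_arity ?i \<nu>s) (comp_at P s m \<xi> \<nu>s) \<nu>"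
    by (rule comp_at_pcomp_after) (use snoc.prems i in \<open>auto simp: y\<close>)
  ultimately show ?case
    using snoc.prems i
    by (simp add: y comp_at_snoc comp_arity_snoc comp_arity_add
      comp_arity_add_minus[unfolded One_nat_def])
qed simp

text \<open>Iterated sequential associativity: filling the inputs that \<open>\<mu>\<close> has
  brought in amounts to filling \<open>\<mu>\<close> beforehand.\<close>

lemma comp_at_pcomp_inside:
  "\<lbrakk>set xs \<subseteq> arity_ops; length xs \<le> m; j < l; \<xi> \<in> carrier (ops P l); \<mu> \<in> carrier (ops P m)\<rbrakk> \<Longrightarrow>
    comp_at P j (l + m - 1) (pcomp P l m j \<xi> \<mu>) xs =
      pcomp P l (comp_arity m xs) j \<xi> (comp_at P 0 m \<mu> xs)"
proof (induction xs arbitrary: m \<mu> rule: rev_induct)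
  case (snoc y xs)
  obtain n \<nu> where y: "y = (n, \<nu>)" by force
  have m: "length xs < m" using snoc.prems by simp
  have "pcomp P (l + m - 1) n (j + length xs) (pcomp P l m j \<xi> \<mu>) \<nu> =
      pcomp P l (m + n - 1) j \<xi> (pcomp P m n (length xs) \<mu> \<nu>)"
    using snoc.prems m by (intro pcomp_assoc_sequential) (auto simp: y)
  moreover have "comp_at P j (l + (m + n - 1) - 1)
      (pcomp P l (m + n - 1) j \<xi> (pcomp P m n (length xs) \<mu> \<nu>)) xs =
    pcomp P l (comp_arity (m + n - 1) xs) j \<xi> (comp_at P 0 (m + n - 1) (pcomp P m n (length xs) \<mu> \<nu>) xs)"
    by (rule snoc.IH) (use snoc.prems m in \<open>auto simp: y intro: pcomp_closed[unfolded One_nat_def]\<close>)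
  moreover have "l + (m + n - 1) - 1 = l + m - 1 + n - 1" using m by simp
  ultimately show ?case using m by (simp add: y comp_at_snoc comp_arity_snoc)
qed simp

text \<open>Induction from the last operation: its own list \<open>xs\<close> is moved past the
  insertions of the earlier operations and absorbed into it. What remains is the claim for the
  shorter list, with the enlarged operation already inserted.\<close>

lemma comp_at_assoc:
  "\<lbrakk>\<And>n \<nu> xs. ((n, \<nu>), xs) \<in> set ts \<Longrightarrow> \<nu> \<in> carrier (ops P n) \<and> length xs = n \<and> set xs \<subseteq> arity_ops;
    length ts \<le> m; \<xi> \<in> carrier (ops P m)\<rbrakk> \<Longrightarrow>
    comp_at P 0 (comp_arity m (map fst ts)) (comp_at P 0 m \<xi> (map fst ts)) (concat (map snd ts)) =
      comp_at P 0 m \<xi> (map (\<lambda>((n, \<nu>), xs). (comp_arity n xs, comp_at P 0 n \<nu> xs)) ts)"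
proof (induction ts arbitrary: m \<xi> rule: rev_induct)
  case (snoc y ts)
  obtain n \<nu> xs where y: "y = ((n, \<nu>), xs)" by (cases y) auto
  have y': "\<nu> \<in> carrier (ops P n)" "length xs = n" "set xs \<subseteq> arity_ops"
    using snoc.prems(1)[of n \<nu> xs] by (auto simp: y)
  let ?t = "length ts" and ?\<nu>s = "map fst ts" and ?C = "concat (map snd ts)"
  let ?m = "m + n - 1" and ?\<xi> = "pcomp P m n (length ts) \<xi> \<nu>"
  let ?N = "comp_arity n xs"
  have ts: "\<nu> \<in> carrier (ops P n) \<and> length xs = n \<and> set xs \<subseteq> arity_ops" if "((n, \<nu>), xs) \<in> set ts" for n \<nu> xs
    using snoc.prems(1)[of n \<nu> xs] that by simp
  have t: "?t < m" using snoc.prems by simp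
  have ts': "fst x \<in> arity_ops \<and> length (snd x) = fst (fst x)" if "x \<in> set ts" for x
    using ts[of "fst (fst x)" "snd (fst x)" "snd x"] that by (simp add: arity_ops_def split_beta)
  then have \<nu>s: "set ?\<nu>s \<subseteq> arity_ops" by auto
  have "map (length \<circ> snd) ts = map (fst \<circ> fst) ts" using ts' by simp
  from arg_cong[OF this, of sum_list] have C: "length ?C = sum_list (map fst ?\<nu>s)"
    by (simp add: length_concat)
  \<comment> \<open>The inputs of the earlier operations are as many as the new number of position
    \<open>?t\<close>, so \<open>xs\<close> is inserted exactly where the inputs of
    \<open>\<nu>\<close> begin.\<close>
  have len_C: "length ?C = comp_arity ?t ?\<nu>s" using comp_arity_length[of ?\<nu>s] C by simp
  have \<xi>: "?\<xi> \<in> carrier (ops P ?m)" using snoc.prems y' t by (intro pcomp_closed)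
  have "comp_at P 0 (comp_arity m (map fst (ts @ [y]))) (comp_at P 0 m \<xi> (map fst (ts @ [y])))
      (concat (map snd (ts @ [y]))) =
    comp_at P 0 (comp_arity ?m ?\<nu>s) (comp_at P 0 ?m ?\<xi> ?\<nu>s) (?C @ xs)"
    using t by (simp add: y comp_at_snoc comp_arity_snoc)
  also have "\<dots> = comp_at P 0 (comp_arity (comp_arity ?m ?\<nu>s) xs)
      (comp_at P (0 + length ?C) (comp_arity ?m ?\<nu>s) (comp_at P 0 ?m ?\<xi> ?\<nu>s) xs) ?C"
    using t y' C by (intro comp_at_append) (simp add: comp_arity_def)
  \<comment> \<open>\<open>xs\<close> fills inputs behind those of \<open>\<nu>s\<close>, so it can
    be inserted before them, and then it starts at \<open>?t\<close>.\<close>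
  also have "comp_at P (0 + length ?C) (comp_arity ?m ?\<nu>s) (comp_at P 0 ?m ?\<xi> ?\<nu>s) xs =
      comp_at P 0 (comp_arity ?m xs) (comp_at P ?t ?m ?\<xi> xs) ?\<nu>s"
    using comp_at_comp_at_after[of xs ?\<nu>s 0 ?t ?m ?\<xi>] y' \<nu>s t \<xi> by (simp add: len_C)
  also have "comp_at P ?t ?m ?\<xi> xs = pcomp P m ?N ?t \<xi> (comp_at P 0 n \<nu> xs)"
    using y' t snoc.prems by (intro comp_at_pcomp_inside) auto
  also have "comp_arity ?m xs = m + ?N - 1" using y' t by (simp add: comp_arity_def)
  also have "comp_arity (comp_arity ?m ?\<nu>s) xs = comp_arity (m + ?N - 1) ?\<nu>s"
    using y' t by (simp add: comp_arity_def)
  also have "comp_at P 0 (comp_arity (m + ?N - 1) ?\<nu>s)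
      (comp_at P 0 (m + ?N - 1) (pcomp P m ?N ?t \<xi> (comp_at P 0 n \<nu> xs)) ?\<nu>s) ?C =
    comp_at P 0 (m + ?N - 1) (pcomp P m ?N ?t \<xi> (comp_at P 0 n \<nu> xs))
      (map (\<lambda>((n, \<nu>), xs). (comp_arity n xs, comp_at P 0 n \<nu> xs)) ts)"
    using ts t y' snoc.prems by (intro snoc.IH pcomp_closed comp_at_closed) auto
  finally show ?case by (simp add: y comp_at_snoc)
qed simp

lemma comp_at_unit_left: "\<nu> \<in> carrier (ops P n) \<Longrightarrow> comp_at P 0 1 (unit_op P) [(n, \<nu>)] = \<nu>"
  using comp_at_snoc[of P 0 1 "unit_op P" "[]" n \<nu>] pcomp_unit_left by simp

lemma comp_at_unit_right: "\<lbrakk>s + k \<le> m; \<xi> \<in> carrier (ops P m)\<rbrakk> \<Longrightarrow>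
    comp_at P s m \<xi> (replicate k (1, unit_op P)) = \<xi>"
proof (induction k)
  case (Suc k)
  have "replicate (Suc k) (1 :: nat, unit_op P) = replicate k (1, unit_op P) @ [(1, unit_op P)]"
    by (simp add: replicate_append_same)
  then have "comp_at P s m \<xi> (replicate (Suc k) (1, unit_op P)) =
      comp_at P s (m + 1 - 1) (pcomp P m 1 (s + k) \<xi> (unit_op P)) (replicate k (1, unit_op P))"
    by (simp only: comp_at_snoc length_replicate)
  also have "\<dots> = \<xi>" using Suc by (simp add: pcomp_unit_right[unfolded One_nat_def])
  finally show ?case .
qed simp

end

text \<open>A transposition of distant points is a conjugate of a shorter one by an adjacent
  transposition, and transpositions generate all permutations.\<close>

lemma permutes_adjacent_induct:
  assumes "\<sigma> permutes {..<n}" "Q id" "\<And>i. Suc i < n \<Longrightarrow> Q (transpose i (Suc i))"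
    and comp: "\<And>\<sigma> \<tau>. \<lbrakk>\<sigma> permutes {..<n}; \<tau> permutes {..<n}; Q \<sigma>; Q \<tau>\<rbrakk> \<Longrightarrow> Q (\<sigma> \<circ> \<tau>)"
  shows "Q \<sigma>"
proof -
  have lt: "Q (transpose a b)" if "a < b" "b < n" for a b :: nat
    using that
  proof (induction b)
    case (Suc b)
    show ?case
    proof (cases "a = b")
      case True
      then show ?thesis using assms(3) Suc.prems by simp
    next
      case False
      have p: "transpose b (Suc b) permutes {..<n}" "transpose a b permutes {..<n}"
        using Suc.prems by (auto intro!: permutes_swap_id)
      have "Q (transpose a b)" "Q (transpose b (Suc b))"
        using Suc False assms(3)[of b] by auto
      moreover have "transpose b (Suc b) \<circ> (transpose a b \<circ> transpose b (Suc b)) = transpose a (Suc b)"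
        using Suc.prems False by (auto simp: fun_eq_iff transpose_def)
      ultimately show ?thesis using comp p permutes_compose[OF p(1) p(2)] by metis
    qed
  qed simp
  have tr: "Q (transpose a b)" if "a < n" "b < n" for a b
    using lt[of a b] lt[of b a] that assms(2) by (cases a b rule: linorder_cases) (auto simp: transpose_commute)
  have fin: "finite {..<n}" by simp
  show ?thesis
    using assms(1) fin
  proof (induction rule: permutes_induct)
    case id
    then show ?case by (rule assms(2))
  next
    case (swap a b p)
    then show ?case using tr[of a b] by (intro comp permutes_swap_id) auto
  qed
qed

lemma permute_list_update:
  assumes "\<sigma> permutes {..<length vs}" "i < length vs"
  shows "permute_list \<sigma> (vs[\<sigma> i := x]) = (permute_list \<sigma> vs)[i := x]"
proof (rule nth_equalityI)
  fix k assume "k < length (permute_list \<sigma> (vs[\<sigma> i := x]))"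
  then have k: "k < length vs" by simp
  have "\<sigma> i = \<sigma> k \<longleftrightarrow> i = k" using permutes_inj[OF assms(1)] by (auto dest: injD)
  moreover have "\<sigma> k < length vs" using permutes_in_image[OF assms(1)] k by simp
  ultimately show "permute_list \<sigma> (vs[\<sigma> i := x]) ! k = (permute_list \<sigma> vs)[i := x] ! k"
    using assms k by (simp add: permute_list_nth nth_list_update)
qed simp

section \<open>Admissible functions from linear maps, and the tagged sums of the
  differential\<close>

context operad_universe
begin

lemma sym_multilinear_on_map:
  assumes g: "sym_multilinear_on R P W N g" and f: "linear_on R V W f"
  shows "sym_multilinear_on R P V N (\<lambda>\<mu> vs. g \<mu> (map f vs))"
proof (rule sym_multilinear_onI)
  fix vs assume "set vs \<subseteq> carrier V"
  then have vs: "set (map f vs) \<subseteq> carrier W" using linear_on_closed[OF f] by auto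
  show "linear_on R (ops P (length vs)) N (\<lambda>\<mu>. g \<mu> (map f vs))"
    using sym_multilinear_on_op[OF g vs] by simp
  fix \<mu> assume \<mu>: "\<mu> \<in> carrier (ops P (length vs))"
  show "linear_on R V N (\<lambda>x. g \<mu> (map f (vs[i := x])))" if "i < length vs" for i
    using linear_on_compose[OF f sym_multilinear_on_arg[OF g vs]] \<mu> that by (simp add: map_update)
  show "g (act P (length vs) \<mu> \<sigma>) (map f (permute_list \<sigma> vs)) = g \<mu> (map f vs)"
    if "\<sigma> permutes {..<length vs}" for \<sigma>
    using sym_multilinear_on_perm[OF g vs] \<mu> that by (simp add: permute_list_map)
qed

text \<open>One summand of the differential, with arbitrary maps in place of the two injections: its
  image under a functorial map is then again of this shape, with composed maps.\<close>

definition tag :: "('b \<Rightarrow> 'd) \<Rightarrow> ('b \<Rightarrow> 'd) \<Rightarrow> nat \<Rightarrow> 'b list \<Rightarrow> 'd list" where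
  "tag a b i vs = (map a vs)[i := b (vs ! i)]"

lemma length_tag [simp]: "length (tag a b i vs) = length vs"
  by (simp add: tag_def)

lemma nth_tag: "k < length vs \<Longrightarrow> tag a b i vs ! k = (if k = i then b (vs ! k) else a (vs ! k))"
  by (auto simp: tag_def nth_list_update)

lemma set_tag_subset:
  assumes "\<And>x. x \<in> X \<Longrightarrow> a x \<in> Y" "\<And>x. x \<in> X \<Longrightarrow> b x \<in> Y" "set vs \<subseteq> X"
  shows "set (tag a b i vs) \<subseteq> Y"
proof
  fix y assume "y \<in> set (tag a b i vs)"
  then obtain k where k: "k < length vs" "y = tag a b i vs ! k" by (auto simp: in_set_conv_nth)
  have "vs ! k \<in> X" using k(1) assms(3) by (auto dest: nth_mem)
  then show "y \<in> Y" using k assms(1,2) by (auto simp: nth_tag)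
qed

lemma tag_map_eq:
  assumes "\<And>x. x \<in> set vs \<Longrightarrow> f (a x) = a' x" "\<And>x. x \<in> set vs \<Longrightarrow> f (b x) = b' x"
  shows "map f (tag a b i vs) = tag a' b' i vs"
  by (rule nth_equalityI) (auto simp: nth_tag assms)

text \<open>A single summand is not invariant: tagging position \<open>i\<close> after permuting is
  permuting after tagging \<open>\<sigma> i\<close>. The permutation thus reindexes the sum.
  Linearity in an input goes through \<open>b\<close> in the summand that tags it and through
  \<open>a\<close> in all others.\<close>

lemma sym_multilinear_on_sum_tag:
  assumes g: "sym_multilinear_on R P W N g" and a: "linear_on R V W a" and b: "linear_on R V W b"
    and V: "Module.module R V" and N: "Module.module R N"
  shows "sym_multilinear_on R P V N (\<lambda>\<mu> vs. \<Oplus>\<^bsub>N\<^esub>i\<in>{..<length vs}. g \<mu> (tag a b i vs))"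
proof (rule sym_multilinear_onI)
  interpret N: Module.module R N by (rule N)
  fix vs assume vs: "set vs \<subseteq> carrier V"
  have tag: "set (tag a b i vs) \<subseteq> carrier W" for i
    using linear_on_closed[OF a] linear_on_closed[OF b] vs by (rule set_tag_subset)
  show "linear_on R (ops P (length vs)) N (\<lambda>\<mu>. \<Oplus>\<^bsub>N\<^esub>i\<in>{..<length vs}. g \<mu> (tag a b i vs))"
    by (rule linear_on_finsum_fun[OF finite_lessThan _ ops_module N])
      (use sym_multilinear_on_op[OF g tag] in simp)
  fix \<mu> assume \<mu>: "\<mu> \<in> carrier (ops P (length vs))"
  show "linear_on R V N (\<lambda>x. \<Oplus>\<^bsub>N\<^esub>i\<in>{..<length (vs[j := x])}. g \<mu> (tag a b i (vs[j := x])))"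
    if j: "j < length vs" for j
    unfolding length_list_update
  proof (rule linear_on_finsum_fun[OF finite_lessThan _ V N])
    fix i assume i: "i \<in> {..<length vs}"
    have "tag a b i (vs[j := x]) = (tag a b i vs)[j := (if i = j then b x else a x)]" for x
      using i j by (intro nth_equalityI) (auto simp: nth_tag nth_list_update)
    moreover have "linear_on R W N (\<lambda>y. g \<mu> ((tag a b i vs)[j := y]))"
      using sym_multilinear_on_arg[OF g tag] \<mu> j by simp
    note linear_on_compose[OF a this] linear_on_compose[OF b this]
    ultimately show "linear_on R V N (\<lambda>x. g \<mu> (tag a b i (vs[j := x])))"
      by (cases "i = j") simp_all
  qed
  fix \<sigma> assume \<sigma>: "\<sigma> permutes {..<length vs}"
  have inj: "inj_on \<sigma> {..<length vs}" using permutes_inj_on[OF \<sigma>] .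
  have "tag a b i (permute_list \<sigma> vs) = permute_list \<sigma> (tag a b (\<sigma> i) vs)" if "i < length vs" for i
  proof (rule nth_equalityI)
    fix k assume "k < length (tag a b i (permute_list \<sigma> vs))"
    then have k: "k < length vs" by simp
    have "\<sigma> k = \<sigma> i \<longleftrightarrow> k = i" using permutes_inj[OF \<sigma>] by (auto dest: injD)
    moreover have "\<sigma> k < length vs" using permutes_in_image[OF \<sigma>] k by simp
    ultimately show "tag a b i (permute_list \<sigma> vs) ! k = permute_list \<sigma> (tag a b (\<sigma> i) vs) ! k"
      using \<sigma> k by (simp add: nth_tag permute_list_nth)
  qed simp
  then have "g (act P (length vs) \<mu> \<sigma>) (tag a b i (permute_list \<sigma> vs)) = g \<mu> (tag a b (\<sigma> i) vs)"
    if "i < length vs" for i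
    using sym_multilinear_on_perm[OF g tag] \<mu> \<sigma> that by simp
  moreover have cl: "g \<mu> (tag a b i vs) \<in> carrier N" for i
    using sym_multilinear_on_closed[OF g tag] \<mu> by simp
  ultimately have "(\<Oplus>\<^bsub>N\<^esub>i\<in>{..<length vs}. g (act P (length vs) \<mu> \<sigma>) (tag a b i (permute_list \<sigma> vs))) =
      (\<Oplus>\<^bsub>N\<^esub>i\<in>{..<length vs}. g \<mu> (tag a b (\<sigma> i) vs))"
    by (intro N.finsum_cong') auto
  also have "\<dots> = (\<Oplus>\<^bsub>N\<^esub>i\<in>\<sigma> ` {..<length vs}. g \<mu> (tag a b i vs))"
    using cl inj by (intro N.finsum_reindex[symmetric]) auto
  also have "\<sigma> ` {..<length vs} = {..<length vs}" by (rule permutes_image[OF \<sigma>])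
  finally show "(\<Oplus>\<^bsub>N\<^esub>i\<in>{..<length (permute_list \<sigma> vs)}.
      g (act P (length vs) \<mu> \<sigma>) (tag a b i (permute_list \<sigma> vs))) =
    (\<Oplus>\<^bsub>N\<^esub>i\<in>{..<length vs}. g \<mu> (tag a b i vs))" by simp
qed

subsection \<open>The multiplication on symbols\<close>

definition symbol_ops :: "('u \<times> 'u list) list \<Rightarrow> (nat \<times> 'u) list" where
  "symbol_ops ss = map (\<lambda>(\<nu>, vs). (length vs, \<nu>)) ss"

definition symbol_args :: "('u \<times> 'u list) list \<Rightarrow> 'u list" where
  "symbol_args ss = concat (map snd ss)"

text \<open>The value prescribed for the multiplication, as a function of the chosen presentations
  of the entries. Compatibility with the relations is then shown for one entry at a time.\<close>

definition comp_symbols :: "('a, 'u) module \<Rightarrow> 'u \<Rightarrow> ('u \<times> 'u list) list \<Rightarrow> 'u" where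
  "comp_symbols V \<mu> ss =
     elt V (comp_at P 0 (length ss) \<mu> (symbol_ops ss)) (symbol_args ss)"

lemma symbol_ops_simps [simp]:
  "length (symbol_ops ss) = length ss" "symbol_ops (ss @ ts) = symbol_ops ss @ symbol_ops ts"
  "symbol_ops ((\<nu>, vs) # ss) = (length vs, \<nu>) # symbol_ops ss" "symbol_ops [] = []"
  by (simp_all add: symbol_ops_def)

lemma symbol_args_simps [simp]:
  "symbol_args (ss @ ts) = symbol_args ss @ symbol_args ts"
  "symbol_args ((\<nu>, vs) # ss) = vs @ symbol_args ss" "symbol_args [] = []"
  by (simp_all add: symbol_args_def)

lemma length_symbol_args: "length (symbol_args ss) = sum_list (map fst (symbol_ops ss))"
  by (induction ss) auto

lemma length_symbol_args': "length (symbol_args ss) = comp_arity (length ss) (symbol_ops ss)"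
  using comp_arity_length[of "symbol_ops ss"] by (simp add: length_symbol_args)

lemma set_symbol_args: "set ss \<subseteq> symbols V \<Longrightarrow> set (symbol_args ss) \<subseteq> carrier V"
  by (fastforce simp: symbol_args_def symbols_def)

lemma set_symbol_ops: "set ss \<subseteq> symbols V \<Longrightarrow> set (symbol_ops ss) \<subseteq> arity_ops"
  by (auto simp: symbol_ops_def symbols_def)

lemma symbols_iff: "(\<nu>, vs) \<in> symbols V \<longleftrightarrow> \<nu> \<in> carrier (ops P (length vs)) \<and> set vs \<subseteq> carrier V"
  by (simp add: symbols_def)

lemma comp_symbol_mem:
  assumes "set ss \<subseteq> symbols V" "\<mu> \<in> carrier (ops P (length ss))"
  shows "(comp_at P 0 (length ss) \<mu> (symbol_ops ss), symbol_args ss) \<in> symbols V"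
  using assms comp_at_closed[OF set_symbol_ops[OF assms(1)], of 0 "length ss" \<mu>]
  by (simp add: symbols_iff set_symbol_args length_symbol_args')

context
  fixes V :: "('a, 'u) module"
  assumes V: "Module.module R V"
begin

private lemma Schur_sym: "sym_multilinear_on R P V (SP V) (elt V)"
  by (rule Schur_elem_sym_multilinear[OF V])

lemma comp_symbols_closed:
  "\<lbrakk>set ss \<subseteq> symbols V; \<mu> \<in> carrier (ops P (length ss))\<rbrakk> \<Longrightarrow> comp_symbols V \<mu> ss \<in> carrier (SP V)"
  unfolding comp_symbols_def by (intro Schur_elem_closed[OF V] comp_symbol_mem)

lemma comp_symbols_linear_op:
  assumes "set ss \<subseteq> symbols V"
  shows "linear_on R (ops P (length ss)) (SP V) (\<lambda>\<mu>. comp_symbols V \<mu> ss)"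
proof -
  have "linear_on R (ops P (length ss)) (ops P (length (symbol_args ss)))
      (\<lambda>\<mu>. comp_at P 0 (length ss) \<mu> (symbol_ops ss))"
    unfolding length_symbol_args' using assms by (intro comp_at_linear_left set_symbol_ops) auto
  from linear_on_compose[OF this sym_multilinear_on_op[OF Schur_sym set_symbol_args[OF assms]]]
  show ?thesis by (simp add: comp_symbols_def)
qed

text \<open>A permutation of the entry acts on the composite as a block permutation by
  \<open>comp_at_act_arg\<close>, and the same block permutation rearranges the concatenated
  arguments, so the symmetry of \<open>elt\<close> cancels both.\<close>

lemma comp_symbols_sym_multilinear:
  assumes ss: "set ss \<subseteq> symbols V" and \<mu>: "\<mu> \<in> carrier (ops P (length ss))" and i: "i < length ss"
  shows "sym_multilinear_on R P V (SP V) (\<lambda>\<nu> vs. comp_symbols V \<mu> (ss[i := (\<nu>, vs)]))"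
proof -
  define xs ys where "xs = take i ss" and "ys = drop (Suc i) ss"
  have upd: "ss[i := s] = xs @ s # ys" for s
    using i by (simp add: xs_def ys_def upd_conv_take_nth_drop)
  have len: "length ss = length xs + length ys + 1" using i by (simp add: xs_def ys_def)
  have xys: "set xs \<subseteq> symbols V" "set ys \<subseteq> symbols V"
    using ss set_take_subset[of i ss] set_drop_subset[of "Suc i" ss] by (auto simp: xs_def ys_def)
  note xyo = set_symbol_ops[OF xys(1)] set_symbol_ops[OF xys(2)]
  note xya = set_symbol_args[OF xys(1)] set_symbol_args[OF xys(2)]
  let ?a = "\<lambda>vs. symbol_args xs @ vs @ symbol_args ys"
  let ?\<nu>s = "\<lambda>n \<nu>. symbol_ops xs @ (n, \<nu>) # symbol_ops ys"
  have eq: "comp_symbols V \<mu> (xs @ (\<nu>, vs) # ys) =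
      elt V (comp_at P 0 (length ss) \<mu> (?\<nu>s (length vs) \<nu>)) (?a vs)" for \<nu> vs
    by (simp add: comp_symbols_def len)
  have ar: "comp_arity (length ss) (?\<nu>s (length vs) \<nu>) = length (?a vs)" for \<nu> vs
    using length_symbol_args'[of "xs @ (\<nu>, vs) # ys"] by (simp add: len)
  have mem: "comp_at P 0 (length ss) \<mu> (?\<nu>s (length vs) \<nu>) \<in> carrier (ops P (length (?a vs)))"
    if "\<nu> \<in> carrier (ops P (length vs))" for \<nu> vs
    unfolding ar[symmetric, of vs \<nu>] using xyo that \<mu> by (intro comp_at_closed) (auto simp: len)
  show ?thesis
    unfolding upd
  proof (rule sym_multilinear_onI)
    fix vs assume vs: "set vs \<subseteq> carrier V"
    have avs: "set (?a vs) \<subseteq> carrier V" using vs xya by simp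
    have "linear_on R (ops P (length vs)) (ops P (length (?a vs)))
        (\<lambda>\<nu>. comp_at P 0 (length ss) \<mu> (?\<nu>s (length vs) \<nu>))"
      \<comment> \<open>The arity of the composite depends only on the length of \<open>vs\<close>,
        so any value can stand for the operation.\<close>
      unfolding ar[symmetric, of vs undefined]
      using xyo \<mu> by (intro comp_at_linear_arg) (auto simp: len)
    from linear_on_compose[OF this sym_multilinear_on_op[OF Schur_sym avs]]
    show "linear_on R (ops P (length vs)) (SP V) (\<lambda>\<nu>. comp_symbols V \<mu> (xs @ (\<nu>, vs) # ys))"
      by (simp add: eq)
    fix \<nu> assume \<nu>: "\<nu> \<in> carrier (ops P (length vs))"
    show "linear_on R V (SP V) (\<lambda>x. comp_symbols V \<mu> (xs @ (\<nu>, vs[j := x]) # ys))"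
      if j: "j < length vs" for j
    proof -
      have "?a (vs[j := x]) = (?a vs)[length (symbol_args xs) + j := x]" for x
        using j by (simp add: list_update_append)
      then show ?thesis
        using sym_multilinear_on_arg[OF Schur_sym avs mem[OF \<nu>], of "length (symbol_args xs) + j"] j
        by (simp add: eq)
    qed
    show "comp_symbols V \<mu> (xs @ (act P (length vs) \<nu> \<tau>, permute_list \<tau> vs) # ys) =
        comp_symbols V \<mu> (xs @ (\<nu>, vs) # ys)" if \<tau>: "\<tau> permutes {..<length vs}" for \<tau>
    proof -
      let ?\<rho> = "shift_perm (length (symbol_args xs)) \<tau>"
      have "comp_at P 0 (length ss) \<mu> (?\<nu>s (length vs) (act P (length vs) \<nu> \<tau>)) =
          act P (length (?a vs)) (comp_at P 0 (length ss) \<mu> (?\<nu>s (length vs) \<nu>)) ?\<rho>"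
        using xyo \<mu> \<nu> \<tau> comp_at_act_arg[of "symbol_ops xs" "symbol_ops ys" "length ss" \<mu> \<nu> "length vs" \<tau>]
          ar[of vs \<nu>]
        by (simp add: len length_symbol_args[symmetric])
      moreover have "permute_list ?\<rho> (?a vs) = ?a (permute_list \<tau> vs)"
        by (rule permute_list_shift_perm[OF \<tau>])
      moreover have "?\<rho> permutes {..<length (?a vs)}"
        by (rule shift_perm_permutes[OF \<tau>]) simp
      ultimately show ?thesis
        using sym_multilinear_on_perm[OF Schur_sym avs mem[OF \<nu>], of ?\<rho>] by (simp add: eq)
    qed
  qed
qed

text \<open>The transposition turns into an exchange of the argument blocks of two neighbouring
  symbols. It affects the composite operation and the concatenated arguments alike, and is absorbed
  by the symmetry of \<open>elt\<close>.\<close>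

lemma comp_symbols_transpose:
  assumes ss: "set ss \<subseteq> symbols V" and \<mu>: "\<mu> \<in> carrier (ops P (length ss))" and p: "Suc p < length ss"
  shows "comp_symbols V (act P (length ss) \<mu> (transpose p (Suc p))) (permute_list (transpose p (Suc p)) ss) =
    comp_symbols V \<mu> ss"
proof -
  define xs ys where "xs = take p ss" and "ys = drop (Suc (Suc p)) ss"
  obtain \<nu> vs where s: "ss ! p = (\<nu>, vs)" by force
  obtain \<nu>' vs' where s': "ss ! Suc p = (\<nu>', vs')" by force
  have ss_eq: "ss = xs @ (\<nu>, vs) # (\<nu>', vs') # ys"
    using p by (simp add: xs_def ys_def s[symmetric] s'[symmetric] id_take_nth_drop[symmetric] Cons_nth_drop_Suc)
  have lx: "length xs = p" using p by (simp add: xs_def)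
  have xys: "set xs \<subseteq> symbols V" "set ys \<subseteq> symbols V" "(\<nu>, vs) \<in> symbols V" "(\<nu>', vs') \<in> symbols V"
    using ss by (auto simp: ss_eq)
  note xyo = set_symbol_ops[OF xys(1)] set_symbol_ops[OF xys(2)]
  let ?\<sigma> = "transpose p (Suc p)"
  have perm: "permute_list ?\<sigma> ss = xs @ (\<nu>', vs') # (\<nu>, vs) # ys"
  proof (rule nth_equalityI)
    fix k assume "k < length (permute_list ?\<sigma> ss)"
    moreover have "?\<sigma> permutes {..<length ss}" by (rule permutes_swap_id) (use p in auto)
    ultimately show "permute_list ?\<sigma> ss ! k = (xs @ (\<nu>', vs') # (\<nu>, vs) # ys) ! k"
      using p by (auto simp: permute_list_nth ss_eq transpose_def nth_append lx nth_Cons split: nat.splits)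
  qed (simp add: ss_eq)
  let ?\<rho> = "shift_perm (length (symbol_args xs)) (block_swap (length vs) (length vs'))"
  let ?\<zeta> = "comp_at P 0 (length ss) \<mu> (symbol_ops ss)"
  have ar: "comp_arity (length ss) (symbol_ops ss) = length (symbol_args ss)"
    using length_symbol_args'[of ss] by simp
  have "comp_at P 0 (length ss) (act P (length ss) \<mu> ?\<sigma>) (symbol_ops (permute_list ?\<sigma> ss)) =
      act P (length (symbol_args ss)) ?\<zeta> ?\<rho>"
    unfolding perm
    using comp_at_act_transpose[of "symbol_ops xs" "symbol_ops ys" "length ss" \<mu> \<nu> "length vs" \<nu>' "length vs'"]
      xyo \<mu> xys ar by (simp add: lx length_symbol_args[of xs, symmetric] symbols_iff) (simp add: ss_eq lx)
  moreover have sw: "block_swap (length vs) (length vs') permutes {..<length (vs @ vs')}"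
    using block_swap_permutes by simp
  then have "permute_list ?\<rho> (symbol_args ss) = symbol_args (permute_list ?\<sigma> ss)"
    using permute_list_shift_perm[OF sw, of "symbol_args xs" "symbol_args ys"]
    unfolding perm by (simp add: ss_eq permute_list_block_swap)
  moreover have "?\<rho> permutes {..<length (symbol_args ss)}"
    by (rule shift_perm_permutes[OF sw]) (simp add: ss_eq)
  moreover have "?\<zeta> \<in> carrier (ops P (length (symbol_args ss)))" "set (symbol_args ss) \<subseteq> carrier V"
    using comp_symbol_mem[OF ss \<mu>] by (auto simp: symbols_iff)
  ultimately show ?thesis
    using sym_multilinear_on_perm[OF Schur_sym, of "symbol_args ss" ?\<zeta> ?\<rho>]
    by (simp add: comp_symbols_def)
qed

lemma ex_symbols:
  assumes "set ws \<subseteq> eval_symbol V ` symbols V"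
  shows "\<exists>ss. ws = map (eval_symbol V) ss \<and> set ss \<subseteq> symbols V"
proof -
  have "ws \<in> lists (eval_symbol V ` symbols V)" using assms by auto
  then show ?thesis by (auto simp: lists_image)
qed

private lemma Schur_V: "Module.module R (SP V)"
  by (rule Schur_module[OF V])

lemma multilinear_on_permute:
  assumes F: "multilinear_on R (replicate k M) N F" and \<sigma>: "\<sigma> permutes {..<k}"
  shows "multilinear_on R (replicate k M) N (\<lambda>ws. F (permute_list \<sigma> ws))"
  unfolding multilinear_on_replicate
proof (intro allI impI conjI)
  fix xs assume xs: "length xs = k" "set xs \<subseteq> carrier M"
  have p: "length (permute_list \<sigma> xs) = k" "set (permute_list \<sigma> xs) \<subseteq> carrier M"
    using xs \<sigma> by auto
  show "F (permute_list \<sigma> xs) \<in> carrier N" by (rule multilinear_on_replicateD(1)[OF F p])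
  fix i assume i: "i < k"
  obtain j where j: "j < k" "i = \<sigma> j"
    using permutes_image[OF \<sigma>] i by (metis imageE lessThan_iff)
  have "linear_on R M N (\<lambda>x. F ((permute_list \<sigma> xs)[j := x]))"
    by (rule multilinear_on_replicateD(2)[OF F p j(1)])
  moreover have "permute_list \<sigma> (xs[i := x]) = (permute_list \<sigma> xs)[j := x]" for x
    using permute_list_update[of \<sigma> xs j x] \<sigma> xs j by simp
  ultimately show "linear_on R M N (\<lambda>x. F (permute_list \<sigma> (xs[i := x])))" by simp
qed

text \<open>\<open>Schur_multilinear_lift\<close> treats each outer operation by itself. Linearity
  in that operation and invariance are then identities between multilinear maps, so they may be
  checked on symbols.\<close>

lemma ex_Schur_mult_multilinear:
  "\<exists>G. sym_multilinear_on R P (SP V) (SP V) G \<and>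
    (\<forall>\<mu> ss. set ss \<subseteq> symbols V \<longrightarrow> \<mu> \<in> carrier (ops P (length ss)) \<longrightarrow>
      G \<mu> (map (eval_symbol V) ss) = comp_symbols V \<mu> ss)"
proof -
  let ?S = "SP V"
  interpret S: Module.module R ?S by (rule Schur_V)
  \<comment> \<open>The choice is indexed by operation and arity together, since the carriers of the
    \<open>ops P k\<close> may overlap.\<close>
  define A where "A = {(\<mu>, k). \<mu> \<in> carrier (ops P k)}"
  have "\<exists>F. multilinear_on R (replicate k ?S) ?S F \<and>
      (\<forall>ss. length ss = k \<longrightarrow> set ss \<subseteq> symbols V \<longrightarrow> F (map (eval_symbol V) ss) = comp_symbols V \<mu> ss)"
    if "\<mu> \<in> carrier (ops P k)" for k \<mu>
    by (rule Schur_multilinear_lift[OF V Schur_V])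
      (use that comp_symbols_closed comp_symbols_sym_multilinear in auto)
  then have "\<forall>t\<in>A. \<exists>F. multilinear_on R (replicate (snd t) ?S) ?S F \<and>
      (\<forall>ss. length ss = snd t \<longrightarrow> set ss \<subseteq> symbols V \<longrightarrow>
        F (map (eval_symbol V) ss) = comp_symbols V (fst t) ss)"
    by (simp add: A_def split_beta)
  then obtain F where "\<forall>t\<in>A. multilinear_on R (replicate (snd t) ?S) ?S (F t) \<and>
      (\<forall>ss. length ss = snd t \<longrightarrow> set ss \<subseteq> symbols V \<longrightarrow>
        F t (map (eval_symbol V) ss) = comp_symbols V (fst t) ss)"
    by (rule bchoice[THEN exE])
  then have F: "multilinear_on R (replicate k ?S) ?S (F (\<mu>, k))"
    and FS: "\<And>ss. \<lbrakk>length ss = k; set ss \<subseteq> symbols V\<rbrakk> \<Longrightarrow>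
      F (\<mu>, k) (map (eval_symbol V) ss) = comp_symbols V \<mu> ss"
    if "\<mu> \<in> carrier (ops P k)" for \<mu> k
    using that by (force simp: A_def)+
  note eqI = multilinear_on_eqI[OF eval_symbol_spans[OF V] Schur_V Schur_V]
  have "sym_multilinear_on R P ?S ?S (\<lambda>\<mu> ws. F (\<mu>, length ws) ws)"
  proof (rule sym_multilinear_onI)
    fix ws assume ws: "set ws \<subseteq> carrier ?S"
    let ?k = "length ws"
    interpret Pk: Module.module R "ops P ?k" by (rule ops_module)
    show "linear_on R (ops P ?k) ?S (\<lambda>\<mu>. F (\<mu>, ?k) ws)"
    proof (rule linear_onI)
      fix \<mu> assume \<mu>: "\<mu> \<in> carrier (ops P ?k)"
      show "F (\<mu>, ?k) ws \<in> carrier ?S" by (rule multilinear_on_replicateD(1)[OF F[OF \<mu>] refl ws])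
      fix \<mu>' assume \<mu>': "\<mu>' \<in> carrier (ops P ?k)"
      show "F (\<mu> \<oplus>\<^bsub>ops P ?k\<^esub> \<mu>', ?k) ws = F (\<mu>, ?k) ws \<oplus>\<^bsub>?S\<^esub> F (\<mu>', ?k) ws"
      proof (rule eqI[where F = "F (\<mu> \<oplus>\<^bsub>ops P ?k\<^esub> \<mu>', ?k)" and
            F' = "\<lambda>ws. F (\<mu>, ?k) ws \<oplus>\<^bsub>?S\<^esub> F (\<mu>', ?k) ws", OF F multilinear_on_plus[OF F F Schur_V] _ refl ws])
        fix us assume us: "length us = ?k" "set us \<subseteq> eval_symbol V ` symbols V"
        then obtain ss where ss: "us = map (eval_symbol V) ss" "set ss \<subseteq> symbols V"
          using ex_symbols by blast
        then have l: "length ss = ?k" using us by simp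
        show "F (\<mu> \<oplus>\<^bsub>ops P ?k\<^esub> \<mu>', ?k) us = F (\<mu>, ?k) us \<oplus>\<^bsub>?S\<^esub> F (\<mu>', ?k) us"
          unfolding ss(1) using \<mu> \<mu>' linear_on_add[OF comp_symbols_linear_op[OF ss(2), unfolded l]]
          by (simp add: FS l ss(2))
      qed (use \<mu> \<mu>' in auto)
    next
      fix a \<mu> assume a: "a \<in> carrier R" and \<mu>: "\<mu> \<in> carrier (ops P ?k)"
      show "F (a \<odot>\<^bsub>ops P ?k\<^esub> \<mu>, ?k) ws = a \<odot>\<^bsub>?S\<^esub> F (\<mu>, ?k) ws"
      proof (rule eqI[where F = "F (a \<odot>\<^bsub>ops P ?k\<^esub> \<mu>, ?k)" and
            F' = "\<lambda>ws. a \<odot>\<^bsub>?S\<^esub> F (\<mu>, ?k) ws", OF F multilinear_on_scaled[OF F a Schur_V] _ refl ws])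
        fix us assume us: "length us = ?k" "set us \<subseteq> eval_symbol V ` symbols V"
        then obtain ss where ss: "us = map (eval_symbol V) ss" "set ss \<subseteq> symbols V"
          using ex_symbols by blast
        then have l: "length ss = ?k" using us by simp
        show "F (a \<odot>\<^bsub>ops P ?k\<^esub> \<mu>, ?k) us = a \<odot>\<^bsub>?S\<^esub> F (\<mu>, ?k) us"
          unfolding ss(1) using \<mu> a linear_on_smult[OF comp_symbols_linear_op[OF ss(2), unfolded l]]
          by (simp add: FS l ss(2))
      qed (use \<mu> a in auto)
    qed
    fix \<mu> assume \<mu>: "\<mu> \<in> carrier (ops P ?k)"
    show "linear_on R ?S ?S (\<lambda>x. F (\<mu>, length (ws[i := x])) (ws[i := x]))" if "i < ?k" for i
      using multilinear_on_replicateD(2)[OF F[OF \<mu>] refl ws that] by simp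
  next
    fix \<mu> ws \<sigma>
    assume *: "\<mu> \<in> carrier (ops P (length ws))" "set ws \<subseteq> carrier ?S" "\<sigma> permutes {..<length ws}"
    define k where "k = length ws"
    \<comment> \<open>The operation and the inputs are quantified so that, for a composite
      permutation, the hypothesis on the second factor can be used at the data already permuted by
      the first.\<close>
    have "\<forall>\<mu>\<in>carrier (ops P k). \<forall>ws. length ws = k \<longrightarrow> set ws \<subseteq> carrier ?S \<longrightarrow>
      F (act P k \<mu> \<sigma>, k) (permute_list \<sigma> ws) = F (\<mu>, k) ws"
      using *(3)[folded k_def]
    proof (rule permutes_adjacent_induct)
      show "\<forall>\<mu>\<in>carrier (ops P k). \<forall>ws. length ws = k \<longrightarrow> set ws \<subseteq> carrier ?S \<longrightarrow>
          F (act P k \<mu> id, k) (permute_list id ws) = F (\<mu>, k) ws"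
        by (simp add: act_id)
    next
      fix i assume i: "Suc i < k"
      let ?\<tau> = "transpose i (Suc i)"
      have \<tau>: "?\<tau> permutes {..<k}" by (rule permutes_swap_id) (use i in auto)
      show "\<forall>\<mu>\<in>carrier (ops P k). \<forall>ws. length ws = k \<longrightarrow> set ws \<subseteq> carrier ?S \<longrightarrow>
          F (act P k \<mu> ?\<tau>, k) (permute_list ?\<tau> ws) = F (\<mu>, k) ws"
      proof (intro ballI allI impI)
        fix \<mu> ws assume \<mu>: "\<mu> \<in> carrier (ops P k)" and ws: "length ws = k" "set ws \<subseteq> carrier ?S"
        show "F (act P k \<mu> ?\<tau>, k) (permute_list ?\<tau> ws) = F (\<mu>, k) ws"
        proof (rule eqI[where F = "\<lambda>ws. F (act P k \<mu> ?\<tau>, k) (permute_list ?\<tau> ws)" and F' = "F (\<mu>, k)",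
              OF multilinear_on_permute[OF F \<tau>] F _ ws])
          fix us assume us: "length us = k" "set us \<subseteq> eval_symbol V ` symbols V"
          then obtain ss where ss: "us = map (eval_symbol V) ss" "set ss \<subseteq> symbols V"
            using ex_symbols by blast
          then have l: "length ss = k" using us by simp
          show "F (act P k \<mu> ?\<tau>, k) (permute_list ?\<tau> us) = F (\<mu>, k) us"
            unfolding ss(1) using \<mu> \<tau> ss(2) comp_symbols_transpose[OF ss(2), of \<mu> i] i
            by (simp add: permute_list_map l FS act_closed)
        qed (use \<mu> \<tau> act_closed in auto)
      qed
    next
      fix \<sigma> \<tau> assume p: "\<sigma> permutes {..<k}" "\<tau> permutes {..<k}"
        and IH: "\<forall>\<mu>\<in>carrier (ops P k). \<forall>ws. length ws = k \<longrightarrow> set ws \<subseteq> carrier ?S \<longrightarrow>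
          F (act P k \<mu> \<sigma>, k) (permute_list \<sigma> ws) = F (\<mu>, k) ws"
          "\<forall>\<mu>\<in>carrier (ops P k). \<forall>ws. length ws = k \<longrightarrow> set ws \<subseteq> carrier ?S \<longrightarrow>
          F (act P k \<mu> \<tau>, k) (permute_list \<tau> ws) = F (\<mu>, k) ws"
      show "\<forall>\<mu>\<in>carrier (ops P k). \<forall>ws. length ws = k \<longrightarrow> set ws \<subseteq> carrier ?S \<longrightarrow>
          F (act P k \<mu> (\<sigma> \<circ> \<tau>), k) (permute_list (\<sigma> \<circ> \<tau>) ws) = F (\<mu>, k) ws"
      proof (intro ballI allI impI)
        fix \<mu> ws assume \<mu>: "\<mu> \<in> carrier (ops P k)" and ws: "length ws = k" "set ws \<subseteq> carrier ?S"
        have "F (act P k \<mu> (\<sigma> \<circ> \<tau>), k) (permute_list (\<sigma> \<circ> \<tau>) ws) =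
            F (act P k (act P k \<mu> \<sigma>) \<tau>, k) (permute_list \<tau> (permute_list \<sigma> ws))"
          using p \<mu> ws by (simp add: act_comp permute_list_compose)
        also have "\<dots> = F (act P k \<mu> \<sigma>, k) (permute_list \<sigma> ws)"
          using IH(2) p \<mu> ws by (simp add: act_closed)
        also have "\<dots> = F (\<mu>, k) ws" using IH(1) \<mu> ws by simp
        finally show "F (act P k \<mu> (\<sigma> \<circ> \<tau>), k) (permute_list (\<sigma> \<circ> \<tau>) ws) = F (\<mu>, k) ws" .
      qed
    qed
    then show "F (act P (length ws) \<mu> \<sigma>, length (permute_list \<sigma> ws)) (permute_list \<sigma> ws) =
        F (\<mu>, length ws) ws"
      using * by (simp add: k_def)
  qed
  moreover have "F (\<mu>, length (map (eval_symbol V) ss)) (map (eval_symbol V) ss) = comp_symbols V \<mu> ss"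
    if "set ss \<subseteq> symbols V" "\<mu> \<in> carrier (ops P (length ss))" for \<mu> ss
    using FS[of \<mu> "length ss" ss] that by simp
  ultimately show ?thesis by (intro exI[of _ "\<lambda>\<mu> ws. F (\<mu>, length ws) ws"]) blast
qed

end

end

section \<open>The category of modules is semi-additive\<close>

lemma MOD_simps [simp]:
  "Ob (MOD R) = {M. Module.module R M}" "Dom (MOD R) = src" "Cod (MOD R) = tgt"
  "Prod (MOD R) = biprod_module"
  by (simp_all add: MOD_def)

lemma Hom_MOD_iff: "f \<in> Hom (MOD R) M N \<longleftrightarrow> Module.module R M \<and> Module.module R N \<and>
    src f = M \<and> tgt f = N \<and> linear_on R M N (app f) \<and> app f \<in> extensional (carrier M)"
  by (auto simp: Hom_def MOD_def linear_maps_def linear_on_def PiE_def)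

lemma Hom_MOD_linear: "f \<in> Hom (MOD R) M N \<Longrightarrow> linear_on R M N (app f)"
  and Hom_MOD_src: "f \<in> Hom (MOD R) M N \<Longrightarrow> src f = M"
  and Hom_MOD_tgt: "f \<in> Hom (MOD R) M N \<Longrightarrow> tgt f = N"
  and Hom_MOD_module: "f \<in> Hom (MOD R) M N \<Longrightarrow> Module.module R M"
    "f \<in> Hom (MOD R) M N \<Longrightarrow> Module.module R N"
  by (simp_all add: Hom_MOD_iff)

lemma Hom_MOD_closed: "\<lbrakk>f \<in> Hom (MOD R) M N; x \<in> carrier M\<rbrakk> \<Longrightarrow> app f x \<in> carrier N"
  by (rule linear_on_closed[OF Hom_MOD_linear])

lemma Hom_MOD_eqI:
  assumes "f \<in> Hom (MOD R) M N" "g \<in> Hom (MOD R) M N" "\<And>x. x \<in> carrier M \<Longrightarrow> app f x = app g x"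
  shows "f = g"
proof -
  have "app f = app g"
    using assms by (intro extensionalityI[of _ "carrier M"]) (auto simp: Hom_MOD_iff)
  then show ?thesis using assms by (cases f; cases g) (auto simp: Hom_MOD_iff)
qed

text \<open>Arrows of \<open>MOD\<close> must be extensional, whereas \<open>linear_on\<close> does
  not ask for it. Restricting only here lets linear maps be written as plain lambda terms.\<close>

definition mk_arr :: "('a, 'u) module \<Rightarrow> ('a, 'u) module \<Rightarrow> ('u \<Rightarrow> 'u) \<Rightarrow> ('a, 'u) module_arr" where
  "mk_arr M N f = \<lparr>src = M, tgt = N, app = restrict f (carrier M)\<rparr>"

lemma app_mk_arr [simp]: "x \<in> carrier M \<Longrightarrow> app (mk_arr M N f) x = f x"
  and src_mk_arr [simp]: "src (mk_arr M N f) = M"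
  and tgt_mk_arr [simp]: "tgt (mk_arr M N f) = N"
  by (simp_all add: mk_arr_def)

lemma mk_arr_in_Hom:
  assumes "linear_on R M N f" "Module.module R M" "Module.module R N"
  shows "mk_arr M N f \<in> Hom (MOD R) M N"
proof -
  have "linear_on R M N (restrict f (carrier M))"
    by (rule linear_on_cong[OF assms(1) _ assms(2)]) simp
  then show ?thesis using assms by (simp add: Hom_MOD_iff mk_arr_def)
qed

lemma Ident_MOD: "Ident (MOD R) M = mk_arr M M (\<lambda>x. x)"
  by (simp add: MOD_def mk_arr_def)

lemma app_Ident_MOD [simp]: "x \<in> carrier M \<Longrightarrow> app (Ident (MOD R) M) x = x"
  by (simp add: Ident_MOD)

lemma Ident_MOD_in_Hom: "Module.module R M \<Longrightarrow> Ident (MOD R) M \<in> Hom (MOD R) M M"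
  unfolding Ident_MOD by (intro mk_arr_in_Hom linear_on_id)

lemma Comp_MOD: "Comp (MOD R) g f =
    \<lparr>src = src f, tgt = tgt g, app = compose (carrier (src f)) (app g) (app f)\<rparr>"
  by (simp add: MOD_def)

lemma app_Comp_MOD:
  "\<lbrakk>f \<in> Hom (MOD R) M N; x \<in> carrier M\<rbrakk> \<Longrightarrow> app (Comp (MOD R) g f) x = app g (app f x)"
  by (simp add: Comp_MOD Hom_MOD_src compose_def)

lemma Comp_MOD_in_Hom:
  assumes "f \<in> Hom (MOD R) M N" "g \<in> Hom (MOD R) N L"
  shows "Comp (MOD R) g f \<in> Hom (MOD R) M L"
proof -
  have "Comp (MOD R) g f = mk_arr M L (\<lambda>x. app g (app f x))"
    by (simp add: Comp_MOD mk_arr_def Hom_MOD_src[OF assms(1)] Hom_MOD_tgt[OF assms(2)] compose_def)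
  then show ?thesis
    using mk_arr_in_Hom[OF linear_on_compose[OF Hom_MOD_linear[OF assms(1)] Hom_MOD_linear[OF assms(2)]]
        Hom_MOD_module(1)[OF assms(1)] Hom_MOD_module(2)[OF assms(2)]] by simp
qed

lemma category_MOD: "category (MOD R)"
proof
  fix f g h A B D E
  show "Comp (MOD R) (Comp (MOD R) h g) f = Comp (MOD R) h (Comp (MOD R) g f)"
    if "f \<in> Hom (MOD R) A B" "g \<in> Hom (MOD R) B D" "h \<in> Hom (MOD R) D E"
    using that
    by (intro Hom_MOD_eqI[of _ R A E] Comp_MOD_in_Hom[of _ _ A B] Comp_MOD_in_Hom[of _ _ A D]
        Comp_MOD_in_Hom[of g R B D])
      (auto simp: app_Comp_MOD[of _ R A B] app_Comp_MOD[of _ R A D] app_Comp_MOD[of _ R B D]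
        Comp_MOD_in_Hom Hom_MOD_closed)
  show "Comp (MOD R) f (Ident (MOD R) A) = f" if f: "f \<in> Hom (MOD R) A B"
    by (rule Hom_MOD_eqI[OF Comp_MOD_in_Hom[OF Ident_MOD_in_Hom[OF Hom_MOD_module(1)[OF f]] f] f])
      (simp add: app_Comp_MOD[OF Ident_MOD_in_Hom[OF Hom_MOD_module(1)[OF f]]])
  show "Comp (MOD R) (Ident (MOD R) B) f = f" if f: "f \<in> Hom (MOD R) A B"
    by (rule Hom_MOD_eqI[OF Comp_MOD_in_Hom[OF f Ident_MOD_in_Hom[OF Hom_MOD_module(2)[OF f]]] f])
      (simp add: app_Comp_MOD[OF f] Hom_MOD_closed[OF f])
qed (auto simp: Ident_MOD_in_Hom intro: Comp_MOD_in_Hom, auto simp: MOD_def)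

subsection \<open>Biproducts\<close>

text \<open>Pairs and projections seen through the chosen copy. Once their laws are known, the
  coding of pairs is not unfolded again.\<close>

definition mk_pair :: "('a, 'u) module \<Rightarrow> ('a, 'u) module \<Rightarrow> 'u \<Rightarrow> 'u \<Rightarrow> 'u" where
  "mk_pair M N x y = code (prod_module M N) (x, y)"

definition proj1 :: "('a, 'u) module \<Rightarrow> ('a, 'u) module \<Rightarrow> 'u \<Rightarrow> 'u" where
  "proj1 M N z = fst (decode (prod_module M N) z)"

definition proj2 :: "('a, 'u) module \<Rightarrow> ('a, 'u) module \<Rightarrow> 'u \<Rightarrow> 'u" where
  "proj2 M N z = snd (decode (prod_module M N) z)"

lemma prod_module_simps:
  "carrier (prod_module M N) = carrier M \<times> carrier N"
  "\<zero>\<^bsub>prod_module M N\<^esub> = (\<zero>\<^bsub>M\<^esub>, \<zero>\<^bsub>N\<^esub>)"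
  "(x, y) \<oplus>\<^bsub>prod_module M N\<^esub> (x', y') = (x \<oplus>\<^bsub>M\<^esub> x', y \<oplus>\<^bsub>N\<^esub> y')"
  "a \<odot>\<^bsub>prod_module M N\<^esub> (x, y) = (a \<odot>\<^bsub>M\<^esub> x, a \<odot>\<^bsub>N\<^esub> y)"
  by (simp_all add: prod_module_def)

lemma prod_module_module:
  assumes "Module.module R M" "Module.module R N"
  shows "Module.module R (prod_module M N)"
proof -
  interpret M: Module.module R M by fact
  interpret N: Module.module R N by fact
  show ?thesis
  proof (rule moduleI)
    show "cring R" by (rule M.is_cring)
    show "abelian_group (prod_module M N)"
    proof (rule abelian_groupI)
      fix z assume "z \<in> carrier (prod_module M N)"
      then show "\<exists>y\<in>carrier (prod_module M N). y \<oplus>\<^bsub>prod_module M N\<^esub> z = \<zero>\<^bsub>prod_module M N\<^esub>"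
        by (intro bexI[of _ "(\<ominus>\<^bsub>M\<^esub> fst z, \<ominus>\<^bsub>N\<^esub> snd z)"])
          (auto simp: prod_module_simps M.l_neg N.l_neg)
    qed (auto simp: prod_module_simps M.a_ac N.a_ac)
  qed (auto simp: prod_module_simps M.smult_l_distr N.smult_l_distr M.smult_r_distr
      N.smult_r_distr M.smult_assoc1 N.smult_assoc1)
qed

lemma prod_module_ex_inj:
  fixes M N :: "('a, 'u::infinite) module"
  shows "\<exists>e :: 'u \<times> 'u \<Rightarrow> 'u. inj_on e (carrier (prod_module M N))"
proof -
  obtain e :: "'u list \<Rightarrow> 'u" where e: "inj e" using ex_inj_list by blast
  have "inj_on (\<lambda>(x, y). e [x, y]) (carrier (prod_module M N))"
    by (auto intro!: inj_onI dest: injD[OF e])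
  then show ?thesis by blast
qed

context
  fixes R :: "('a, 'c) ring_scheme" and M N :: "('a, 'u::infinite) module"
  assumes M: "Module.module R M" and N: "Module.module R N"
begin

private lemmas copy = decode_code[OF prod_module_ex_inj[of M N]]
  copy_module_carrier[OF prod_module_ex_inj prod_module_module[OF M N], folded biprod_module_def]
  copy_module_zero[OF prod_module_ex_inj prod_module_module[OF M N], folded biprod_module_def]
  code_linear[OF prod_module_ex_inj prod_module_module[OF M N], folded biprod_module_def]
  decode_linear[OF prod_module_ex_inj prod_module_module[OF M N], folded biprod_module_def]

lemma biprod_module_module: "Module.module R (biprod_module M N)"
  unfolding biprod_module_def
  by (rule copy_module_module[OF prod_module_ex_inj prod_module_module[OF M N]])

lemma proj1_mk_pair: "\<lbrakk>x \<in> carrier M; y \<in> carrier N\<rbrakk> \<Longrightarrow> proj1 M N (mk_pair M N x y) = x"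
  and proj2_mk_pair: "\<lbrakk>x \<in> carrier M; y \<in> carrier N\<rbrakk> \<Longrightarrow> proj2 M N (mk_pair M N x y) = y"
  using copy(1)[of "(x, y)"] by (simp_all add: proj1_def proj2_def mk_pair_def prod_module_simps)

lemma mk_pair_closed: "\<lbrakk>x \<in> carrier M; y \<in> carrier N\<rbrakk> \<Longrightarrow> mk_pair M N x y \<in> carrier (biprod_module M N)"
  by (simp add: copy(2) mk_pair_def prod_module_simps)

lemma biprod_module_cases:
  assumes "z \<in> carrier (biprod_module M N)"
  obtains x y where "x \<in> carrier M" "y \<in> carrier N" "z = mk_pair M N x y"
  using assms by (auto simp: copy(2) mk_pair_def prod_module_simps)

lemma proj1_linear: "linear_on R (biprod_module M N) M (proj1 M N)"
proof -
  have "linear_on R (prod_module M N) M fst"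
    by (auto simp: linear_on_def prod_module_simps)
  from linear_on_compose[OF copy(5) this] show ?thesis by (simp add: proj1_def[abs_def])
qed

lemma proj2_linear: "linear_on R (biprod_module M N) N (proj2 M N)"
proof -
  have "linear_on R (prod_module M N) N snd"
    by (auto simp: linear_on_def prod_module_simps)
  from linear_on_compose[OF copy(5) this] show ?thesis by (simp add: proj2_def[abs_def])
qed

lemma mk_pair_proj: "z \<in> carrier (biprod_module M N) \<Longrightarrow> mk_pair M N (proj1 M N z) (proj2 M N z) = z"
  by (auto elim!: biprod_module_cases simp: proj1_mk_pair proj2_mk_pair)

lemma mk_pair_linear:
  assumes "linear_on R L M f" "linear_on R L N g"
  shows "linear_on R L (biprod_module M N) (\<lambda>x. mk_pair M N (f x) (g x))"
proof -
  have "linear_on R L (prod_module M N) (\<lambda>x. (f x, g x))"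
    using assms by (auto simp: linear_on_def prod_module_simps)
  from linear_on_compose[OF this copy(4)] show ?thesis by (simp add: mk_pair_def)
qed

lemma mk_pair_add:
  assumes "x \<in> carrier M" "y \<in> carrier N" "x' \<in> carrier M" "y' \<in> carrier N"
  shows "mk_pair M N x y \<oplus>\<^bsub>biprod_module M N\<^esub> mk_pair M N x' y' =
    mk_pair M N (x \<oplus>\<^bsub>M\<^esub> x') (y \<oplus>\<^bsub>N\<^esub> y')"
  using linear_on_add[OF copy(4), of "(x, y)" "(x', y')"] assms
  by (simp add: mk_pair_def prod_module_simps)

lemma Pr1_MOD: "Pr1 (MOD R) M N = mk_arr (biprod_module M N) M (proj1 M N)"
  and Pr2_MOD: "Pr2 (MOD R) M N = mk_arr (biprod_module M N) N (proj2 M N)"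
  and In1_MOD: "In1 (MOD R) M N = mk_arr M (biprod_module M N) (\<lambda>x. mk_pair M N x \<zero>\<^bsub>N\<^esub>)"
  and In2_MOD: "In2 (MOD R) M N = mk_arr N (biprod_module M N) (\<lambda>y. mk_pair M N \<zero>\<^bsub>M\<^esub> y)"
  by (simp_all add: MOD_def mk_arr_def proj1_def[abs_def] proj2_def[abs_def] mk_pair_def)

lemma Pr1_MOD_in_Hom: "Pr1 (MOD R) M N \<in> Hom (MOD R) (biprod_module M N) M"
  and Pr2_MOD_in_Hom: "Pr2 (MOD R) M N \<in> Hom (MOD R) (biprod_module M N) N"
  by (simp_all add: Pr1_MOD Pr2_MOD mk_arr_in_Hom proj1_linear proj2_linear biprod_module_module M N)

lemma In1_MOD_in_Hom: "In1 (MOD R) M N \<in> Hom (MOD R) M (biprod_module M N)"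
  unfolding In1_MOD
  by (intro mk_arr_in_Hom mk_pair_linear linear_on_id linear_on_const_zero N biprod_module_module M)

lemma In2_MOD_in_Hom: "In2 (MOD R) M N \<in> Hom (MOD R) N (biprod_module M N)"
  unfolding In2_MOD
  by (intro mk_arr_in_Hom mk_pair_linear linear_on_id linear_on_const_zero N biprod_module_module M)

lemma app_Pr1_MOD [simp]: "z \<in> carrier (biprod_module M N) \<Longrightarrow> app (Pr1 (MOD R) M N) z = proj1 M N z"
  and app_Pr2_MOD [simp]: "z \<in> carrier (biprod_module M N) \<Longrightarrow> app (Pr2 (MOD R) M N) z = proj2 M N z"
  and app_In1_MOD [simp]: "x \<in> carrier M \<Longrightarrow> app (In1 (MOD R) M N) x = mk_pair M N x \<zero>\<^bsub>N\<^esub>"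
  and app_In2_MOD [simp]: "y \<in> carrier N \<Longrightarrow> app (In2 (MOD R) M N) y = mk_pair M N \<zero>\<^bsub>M\<^esub> y"
  by (simp_all add: Pr1_MOD Pr2_MOD In1_MOD In2_MOD)

text \<open>Stated as an equivalence with a closed form: this gives unique existence and at the same
  time evaluates the definite description in \<open>pairing\<close>.\<close>

lemma product_MOD:
  assumes f: "f \<in> Hom (MOD R) X M" and g: "g \<in> Hom (MOD R) X N"
  shows "h \<in> Hom (MOD R) X (biprod_module M N) \<and> Comp (MOD R) (Pr1 (MOD R) M N) h = f \<and>
      Comp (MOD R) (Pr2 (MOD R) M N) h = g \<longleftrightarrow>
    h = mk_arr X (biprod_module M N) (\<lambda>x. mk_pair M N (app f x) (app g x))" (is "?P \<longleftrightarrow> h = ?h")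
proof
  note X = Hom_MOD_module(1)[OF f]
  have h: "?h \<in> Hom (MOD R) X (biprod_module M N)"
    by (intro mk_arr_in_Hom mk_pair_linear Hom_MOD_linear f g X biprod_module_module)
  note cl = Hom_MOD_closed[OF f] Hom_MOD_closed[OF g]
  show "h = ?h" if P: ?P
  proof (rule Hom_MOD_eqI[OF conjunct1[OF P] h])
    fix x assume x: "x \<in> carrier X"
    have hx: "app h x \<in> carrier (biprod_module M N)" by (rule Hom_MOD_closed[OF conjunct1[OF P] x])
    have "app f x = proj1 M N (app h x)" "app g x = proj2 M N (app h x)"
      using P x app_Comp_MOD[of h R X "biprod_module M N" x] hx by auto
    then show "app h x = app ?h x" using x mk_pair_proj[OF hx] by simp
  qed
  assume "h = ?h"
  moreover have "Comp (MOD R) (Pr1 (MOD R) M N) ?h = f"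
    by (rule Hom_MOD_eqI[OF Comp_MOD_in_Hom[OF h Pr1_MOD_in_Hom] f])
      (simp add: app_Comp_MOD[OF h] mk_pair_closed proj1_mk_pair cl)
  moreover have "Comp (MOD R) (Pr2 (MOD R) M N) ?h = g"
    by (rule Hom_MOD_eqI[OF Comp_MOD_in_Hom[OF h Pr2_MOD_in_Hom] g])
      (simp add: app_Comp_MOD[OF h] mk_pair_closed proj2_mk_pair cl)
  ultimately show ?P using h by simp
qed

text \<open>The mediating map is forced because every pair is the sum of its two injected
  components. The equivalence also evaluates \<open>copairing\<close>.\<close>

lemma coproduct_MOD:
  assumes f: "f \<in> Hom (MOD R) M X" and g: "g \<in> Hom (MOD R) N X"
  shows "h \<in> Hom (MOD R) (biprod_module M N) X \<and> Comp (MOD R) h (In1 (MOD R) M N) = f \<and>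
      Comp (MOD R) h (In2 (MOD R) M N) = g \<longleftrightarrow>
    h = mk_arr (biprod_module M N) X (\<lambda>z. app f (proj1 M N z) \<oplus>\<^bsub>X\<^esub> app g (proj2 M N z))"
    (is "?P \<longleftrightarrow> h = ?h")
proof
  interpret M: Module.module R M by (rule M)
  interpret N: Module.module R N by (rule N)
  interpret X: Module.module R X by (rule Hom_MOD_module(2)[OF f])
  note X = X.module_axioms
  have h: "?h \<in> Hom (MOD R) (biprod_module M N) X"
    by (intro mk_arr_in_Hom linear_on_plus linear_on_compose[OF proj1_linear]
        linear_on_compose[OF proj2_linear] Hom_MOD_linear f g X biprod_module_module)
  note cl = Hom_MOD_closed[OF f] Hom_MOD_closed[OF g]
  have f0: "app f \<zero>\<^bsub>M\<^esub> = \<zero>\<^bsub>X\<^esub>" by (rule linear_on_zero[OF Hom_MOD_linear[OF f] M X])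
  have g0: "app g \<zero>\<^bsub>N\<^esub> = \<zero>\<^bsub>X\<^esub>" by (rule linear_on_zero[OF Hom_MOD_linear[OF g] N X])
  show "h = ?h" if P: ?P
  proof (rule Hom_MOD_eqI[OF conjunct1[OF P] h])
    fix z assume "z \<in> carrier (biprod_module M N)"
    then obtain x y where z: "x \<in> carrier M" "y \<in> carrier N" "z = mk_pair M N x y"
      by (rule biprod_module_cases)
    have hl: "linear_on R (biprod_module M N) X (app h)" by (rule Hom_MOD_linear[OF conjunct1[OF P]])
    have "app f x = app h (mk_pair M N x \<zero>\<^bsub>N\<^esub>)" "app g y = app h (mk_pair M N \<zero>\<^bsub>M\<^esub> y)"
      using P z app_Comp_MOD[OF In1_MOD_in_Hom, of x h] app_Comp_MOD[OF In2_MOD_in_Hom, of y h] by auto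
    moreover have "z = mk_pair M N x \<zero>\<^bsub>N\<^esub> \<oplus>\<^bsub>biprod_module M N\<^esub> mk_pair M N \<zero>\<^bsub>M\<^esub> y"
      using z by (simp add: mk_pair_add)
    ultimately show "app h z = app ?h z"
      using z linear_on_add[OF hl, of "mk_pair M N x \<zero>\<^bsub>N\<^esub>" "mk_pair M N \<zero>\<^bsub>M\<^esub> y"]
      by (simp add: mk_pair_closed proj1_mk_pair proj2_mk_pair mk_pair_add)
  qed
  assume "h = ?h"
  moreover have "Comp (MOD R) ?h (In1 (MOD R) M N) = f"
    by (rule Hom_MOD_eqI[OF Comp_MOD_in_Hom[OF In1_MOD_in_Hom h] f])
      (simp add: app_Comp_MOD[OF In1_MOD_in_Hom] mk_pair_closed proj1_mk_pair proj2_mk_pair cl g0)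
  moreover have "Comp (MOD R) ?h (In2 (MOD R) M N) = g"
    by (rule Hom_MOD_eqI[OF Comp_MOD_in_Hom[OF In2_MOD_in_Hom h] g])
      (simp add: app_Comp_MOD[OF In2_MOD_in_Hom] mk_pair_closed proj1_mk_pair proj2_mk_pair cl f0)
  ultimately show ?P using h by simp
qed

lemma pairing_MOD:
  assumes f: "f \<in> Hom (MOD R) X M" and g: "g \<in> Hom (MOD R) X N"
  shows "pairing (MOD R) f g = mk_arr X (biprod_module M N) (\<lambda>x. mk_pair M N (app f x) (app g x))"
  unfolding pairing_def
  using product_MOD[OF f g] Hom_MOD_src[OF f] Hom_MOD_tgt[OF f] Hom_MOD_tgt[OF g] by simp

lemma copairing_MOD:
  assumes f: "f \<in> Hom (MOD R) M X" and g: "g \<in> Hom (MOD R) N X"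
  shows "copairing (MOD R) f g =
    mk_arr (biprod_module M N) X (\<lambda>z. app f (proj1 M N z) \<oplus>\<^bsub>X\<^esub> app g (proj2 M N z))"
  unfolding copairing_def
  using coproduct_MOD[OF f g] Hom_MOD_src[OF f] Hom_MOD_tgt[OF f] Hom_MOD_src[OF g] by simp

lemma pairing_MOD_in_Hom:
  assumes f: "f \<in> Hom (MOD R) X M" and g: "g \<in> Hom (MOD R) X N"
  shows "pairing (MOD R) f g \<in> Hom (MOD R) X (biprod_module M N)"
  using product_MOD[OF f g] pairing_MOD[OF f g] by blast

lemma app_pairing_MOD:
  assumes f: "f \<in> Hom (MOD R) X M" and g: "g \<in> Hom (MOD R) X N" and x: "x \<in> carrier X"
  shows "app (pairing (MOD R) f g) x = mk_pair M N (app f x) (app g x)"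
  using pairing_MOD[OF f g] x by simp

end

text \<open>The codiagonal adds the two components of a pair, so the sum induced by biproducts is
  the pointwise one.\<close>

lemma
  fixes M :: "('a, 'u::infinite) module"
  assumes f: "f \<in> Hom (MOD R) X M" and g: "g \<in> Hom (MOD R) X M"
  shows arr_add_MOD_in_Hom: "arr_add (MOD R) f g \<in> Hom (MOD R) X M"
    and app_arr_add_MOD: "\<And>x. x \<in> carrier X \<Longrightarrow> app (arr_add (MOD R) f g) x = app f x \<oplus>\<^bsub>M\<^esub> app g x"
proof -
  note M = Hom_MOD_module(2)[OF f]
  note I = Ident_MOD_in_Hom[OF M]
  note p = pairing_MOD_in_Hom[OF M M f g]
  note c = copairing_MOD[OF M M I I]
  have cH: "copairing (MOD R) (Ident (MOD R) M) (Ident (MOD R) M) \<in> Hom (MOD R) (biprod_module M M) M"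
    using coproduct_MOD[OF M M I I] c by blast
  have eq: "arr_add (MOD R) f g =
      Comp (MOD R) (copairing (MOD R) (Ident (MOD R) M) (Ident (MOD R) M)) (pairing (MOD R) f g)"
    by (simp add: arr_add_def Hom_MOD_tgt[OF f])
  show "arr_add (MOD R) f g \<in> Hom (MOD R) X M"
    unfolding eq by (rule Comp_MOD_in_Hom[OF p cH])
  show "app (arr_add (MOD R) f g) x = app f x \<oplus>\<^bsub>M\<^esub> app g x" if "x \<in> carrier X" for x
    unfolding eq app_Comp_MOD[OF p that] app_pairing_MOD[OF M M f g that] c
    using Hom_MOD_closed[OF f that] Hom_MOD_closed[OF g that]
    by (simp add: mk_pair_closed[OF M M] proj1_mk_pair[OF M M] proj2_mk_pair[OF M M])
qed

subsection \<open>The zero object\<close>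

definition zero_module :: "('a, 'u) module" where
  "zero_module = mk_module {undefined} undefined (\<lambda>_ _. undefined) (\<lambda>_ _. undefined)"

lemma Zero_ob_MOD: "Zero_ob (MOD R) = zero_module"
  by (simp add: MOD_def zero_module_def)

lemma zero_module_module: "cring R \<Longrightarrow> Module.module R zero_module"
  by (intro moduleI abelian_groupI) (auto simp: zero_module_def)

lemma Hom_to_zero_module:
  assumes R: "cring R" and A: "Module.module R A"
  shows "f \<in> Hom (MOD R) A zero_module \<longleftrightarrow> f = mk_arr A zero_module (\<lambda>_. undefined)"
proof
  have h: "mk_arr A zero_module (\<lambda>_. undefined) \<in> Hom (MOD R) A zero_module"
    by (intro mk_arr_in_Hom zero_module_module R A) (simp add: linear_on_def zero_module_def)
  then show "f \<in> Hom (MOD R) A zero_module" if "f = mk_arr A zero_module (\<lambda>_. undefined)"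
    using that by simp
  assume f: "f \<in> Hom (MOD R) A zero_module"
  show "f = mk_arr A zero_module (\<lambda>_. undefined)"
    by (rule Hom_MOD_eqI[OF f h]) (use Hom_MOD_closed[OF f] in \<open>auto simp: zero_module_def\<close>)
qed

lemma Hom_from_zero_module:
  assumes R: "cring R" and A: "Module.module R A"
  shows "f \<in> Hom (MOD R) zero_module A \<longleftrightarrow> f = mk_arr zero_module A (\<lambda>_. \<zero>\<^bsub>A\<^esub>)"
proof
  have h: "mk_arr zero_module A (\<lambda>_. \<zero>\<^bsub>A\<^esub>) \<in> Hom (MOD R) zero_module A"
    by (intro mk_arr_in_Hom linear_on_const_zero zero_module_module R A)
  then show "f \<in> Hom (MOD R) zero_module A" if "f = mk_arr zero_module A (\<lambda>_. \<zero>\<^bsub>A\<^esub>)"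
    using that by simp
  assume f: "f \<in> Hom (MOD R) zero_module A"
  show "f = mk_arr zero_module A (\<lambda>_. \<zero>\<^bsub>A\<^esub>)"
    by (rule Hom_MOD_eqI[OF f h])
      (use linear_on_zero[OF Hom_MOD_linear[OF f] zero_module_module[OF R] A] in \<open>auto simp: zero_module_def\<close>)
qed

lemma zero_arr_MOD:
  assumes R: "cring R" and A: "Module.module R A" and B: "Module.module R B"
  shows "zero_arr (MOD R) A B = mk_arr A B (\<lambda>_. \<zero>\<^bsub>B\<^esub>)"
proof -
  let ?f = "mk_arr A zero_module (\<lambda>_. undefined)" and ?g = "mk_arr zero_module B (\<lambda>_. \<zero>\<^bsub>B\<^esub>)"
  have f: "?f \<in> Hom (MOD R) A zero_module" and g: "?g \<in> Hom (MOD R) zero_module B"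
    using Hom_to_zero_module[OF R A] Hom_from_zero_module[OF R B] by auto
  have "zero_arr (MOD R) A B = Comp (MOD R) ?g ?f"
    unfolding zero_arr_def Zero_ob_MOD Hom_to_zero_module[OF R A] Hom_from_zero_module[OF R B] by simp
  also have "\<dots> = mk_arr A B (\<lambda>_. \<zero>\<^bsub>B\<^esub>)"
  proof (rule Hom_MOD_eqI[OF Comp_MOD_in_Hom[OF f g]])
    show "mk_arr A B (\<lambda>_. \<zero>\<^bsub>B\<^esub>) \<in> Hom (MOD R) A B"
      by (intro mk_arr_in_Hom linear_on_const_zero A B)
    show "app (Comp (MOD R) ?g ?f) x = app (mk_arr A B (\<lambda>_. \<zero>\<^bsub>B\<^esub>)) x"
      if "x \<in> carrier A" for x
      using that by (simp add: app_Comp_MOD[OF f]) (simp add: zero_module_def)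
  qed
  finally show ?thesis .
qed

lemma
  assumes R: "cring R" and A: "Module.module R A" and B: "Module.module R B"
  shows zero_arr_MOD_in_Hom: "zero_arr (MOD R) A B \<in> Hom (MOD R) A B"
    and app_zero_arr_MOD: "x \<in> carrier A \<Longrightarrow> app (zero_arr (MOD R) A B) x = \<zero>\<^bsub>B\<^esub>"
  unfolding zero_arr_MOD[OF R A B]
  by (auto intro!: mk_arr_in_Hom linear_on_const_zero A B)

lemma semi_additive_category_MOD:
  assumes R: "cring R"
  shows "semi_additive_category (MOD R :: (('a, 'u::infinite) module, ('a, 'u) module_arr) biprod_category)"
proof (intro semi_additive_category.intro category_MOD semi_additive_category_axioms.intro; unfold MOD_simps mem_Collect_eq Zero_ob_MOD)
  show "Module.module R zero_module" by (rule zero_module_module[OF R])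
  fix A B X :: "('a, 'u) module" and f g :: "('a, 'u) module_arr"
  assume A: "Module.module R A"
  show "\<exists>!f. f \<in> Hom (MOD R) A zero_module" using Hom_to_zero_module[OF R A] by simp
  show "\<exists>!f. f \<in> Hom (MOD R) zero_module A" using Hom_from_zero_module[OF R A] by simp
  assume B: "Module.module R B"
  interpret A: Module.module R A by (rule A)
  interpret B: Module.module R B by (rule B)
  show "Module.module R (biprod_module A B)" by (rule biprod_module_module[OF A B])
  show "Pr1 (MOD R) A B \<in> Hom (MOD R) (biprod_module A B) A" by (rule Pr1_MOD_in_Hom[OF A B])
  show "Pr2 (MOD R) A B \<in> Hom (MOD R) (biprod_module A B) B" by (rule Pr2_MOD_in_Hom[OF A B])
  show i1: "In1 (MOD R) A B \<in> Hom (MOD R) A (biprod_module A B)" by (rule In1_MOD_in_Hom[OF A B])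
  show i2: "In2 (MOD R) A B \<in> Hom (MOD R) B (biprod_module A B)" by (rule In2_MOD_in_Hom[OF A B])
  show "\<exists>!h. h \<in> Hom (MOD R) X (biprod_module A B) \<and> Comp (MOD R) (Pr1 (MOD R) A B) h = f \<and>
      Comp (MOD R) (Pr2 (MOD R) A B) h = g"
    if "f \<in> Hom (MOD R) X A" "g \<in> Hom (MOD R) X B"
    using product_MOD[OF A B that] by simp
  show "\<exists>!h. h \<in> Hom (MOD R) (biprod_module A B) X \<and> Comp (MOD R) h (In1 (MOD R) A B) = f \<and>
      Comp (MOD R) h (In2 (MOD R) A B) = g"
    if "f \<in> Hom (MOD R) A X" "g \<in> Hom (MOD R) B X"
    using coproduct_MOD[OF A B that] by simp
  note p1 = Pr1_MOD_in_Hom[OF A B] and p2 = Pr2_MOD_in_Hom[OF A B]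
  note s = mk_pair_closed[OF A B] proj1_mk_pair[OF A B] proj2_mk_pair[OF A B]
    app_Comp_MOD[OF i1] app_Comp_MOD[OF i2] app_In1_MOD[OF A B] app_In2_MOD[OF A B]
    app_Pr1_MOD[OF A B] app_Pr2_MOD[OF A B] app_zero_arr_MOD[OF R A B] app_zero_arr_MOD[OF R B A]
  show "Comp (MOD R) (Pr1 (MOD R) A B) (In1 (MOD R) A B) = Ident (MOD R) A"
    by (rule Hom_MOD_eqI[OF Comp_MOD_in_Hom[OF i1 p1] Ident_MOD_in_Hom[OF A]]) (simp add: s)
  show "Comp (MOD R) (Pr2 (MOD R) A B) (In2 (MOD R) A B) = Ident (MOD R) B"
    by (rule Hom_MOD_eqI[OF Comp_MOD_in_Hom[OF i2 p2] Ident_MOD_in_Hom[OF B]]) (simp add: s)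
  show "Comp (MOD R) (Pr2 (MOD R) A B) (In1 (MOD R) A B) = zero_arr (MOD R) A B"
    by (rule Hom_MOD_eqI[OF Comp_MOD_in_Hom[OF i1 p2] zero_arr_MOD_in_Hom[OF R A B]]) (simp add: s)
  show "Comp (MOD R) (Pr1 (MOD R) A B) (In2 (MOD R) A B) = zero_arr (MOD R) B A"
    by (rule Hom_MOD_eqI[OF Comp_MOD_in_Hom[OF i2 p1] zero_arr_MOD_in_Hom[OF R B A]]) (simp add: s)
qed

section \<open>The structure maps\<close>

context abelian_monoid
begin

lemma finsum_swap:
  assumes "finite A" "finite B" "\<And>i j. \<lbrakk>i \<in> A; j \<in> B\<rbrakk> \<Longrightarrow> f i j \<in> carrier G"
  shows "(\<Oplus>i\<in>A. \<Oplus>j\<in>B. f i j) = (\<Oplus>j\<in>B. \<Oplus>i\<in>A. f i j)"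
  using assms(1,3)
proof (induction A rule: finite_induct)
  case (insert a A)
  have "(\<Oplus>j\<in>B. \<Oplus>i\<in>insert a A. f i j) = (\<Oplus>j\<in>B. f a j \<oplus> (\<Oplus>i\<in>A. f i j))"
    using insert by (intro finsum_cong') (auto simp: Pi_def intro!: finsum_closed)
  also have "\<dots> = (\<Oplus>j\<in>B. f a j) \<oplus> (\<Oplus>j\<in>B. \<Oplus>i\<in>A. f i j)"
    using insert by (intro finsum_addf) (auto simp: Pi_def intro!: finsum_closed)
  also have "\<dots> = (\<Oplus>j\<in>B. f a j) \<oplus> (\<Oplus>i\<in>A. \<Oplus>j\<in>B. f i j)"
    using insert by simp
  also have "\<dots> = (\<Oplus>i\<in>insert a A. \<Oplus>j\<in>B. f i j)"
    using insert by (intro finsum_insert[symmetric]) (auto simp: Pi_def intro!: finsum_closed)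
  finally show ?case by simp
qed simp

lemma finsum_single:
  assumes "finite A" "i \<in> A" "f i \<in> carrier G" "\<And>j. \<lbrakk>j \<in> A; j \<noteq> i\<rbrakk> \<Longrightarrow> f j = \<zero>"
  shows "(\<Oplus>j\<in>A. f j) = f i"
proof -
  have "(\<Oplus>j\<in>A. f j) = (\<Oplus>j\<in>{i}. f j)"
  proof (rule add.finprod_mono_neutral_cong_right)
    show "f \<in> A \<rightarrow> carrier G"
    proof
      fix j assume "j \<in> A"
      then show "f j \<in> carrier G" using assms by (cases "j = i") auto
    qed
  qed (use assms in auto)
  then show ?thesis using assms(3) by simp
qed

lemma finsum_all_zero:
  assumes "\<And>i. i \<in> A \<Longrightarrow> f i = \<zero>"
  shows "(\<Oplus>i\<in>A. f i) = \<zero>"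
proof -
  have "(\<Oplus>i\<in>A. f i) = (\<Oplus>i\<in>A. \<zero>)" using assms by (intro finsum_cong') auto
  then show ?thesis by simp
qed

text \<open>A position in a concatenation is a block together with a position in it, offset by the
  length of the earlier blocks. This is the combinatorics of the chain rule
  \<open>DC4\<close>.\<close>

lemma finsum_concat:
  "(\<And>p. p < length (concat xss) \<Longrightarrow> F p \<in> carrier G) \<Longrightarrow>
    (\<Oplus>p\<in>{..<length (concat xss)}. F p) =
    (\<Oplus>i\<in>{..<length xss}. \<Oplus>j\<in>{..<length (xss ! i)}. F (length (concat (take i xss)) + j))"
proof (induction xss rule: rev_induct)
  case (snoc xs xss)
  let ?m = "length (concat xss)" and ?n = "length xs" and ?k = "length xss"
  let ?f = "\<lambda>i. \<Oplus>j\<in>{..<length ((xss @ [xs]) ! i)}. F (length (concat (take i (xss @ [xs]))) + j)"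
  have Pi: "?f \<in> {..<?k} \<rightarrow> carrier G"
  proof (intro Pi_I finsum_closed)
    fix i j assume i: "i \<in> {..<?k}" and j: "j \<in> {..<length ((xss @ [xs]) ! i)}"
    \<comment> \<open>The offset of block \<open>i\<close> plus its length is the length of the
      first \<open>i + 1\<close> blocks together, so the index stays below
      \<open>?m\<close>.\<close>
    have "length (concat (take i xss)) + length (xss ! i) = length (concat (take (Suc i) xss))"
      using i by (simp add: take_Suc_conv_app_nth)
    also have "\<dots> \<le> length (concat (take (Suc i) xss @ drop (Suc i) xss))"
      unfolding concat_append by simp
    also have "\<dots> = ?m" by simp
    finally show "F (length (concat (take i (xss @ [xs]))) + j) \<in> carrier G"
      using i j by (intro snoc.prems) (simp add: nth_append)
  qed
  have un: "{..<?m + ?n} = {..<?m} \<union> (+) ?m ` {..<?n}"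
  proof -
    have "p \<in> (+) ?m ` {..<?n}" if "p < ?m + ?n" "\<not> p < ?m" for p
      using that by (intro image_eqI[of _ _ "p - ?m"]) auto
    then show ?thesis by auto
  qed
  have "(\<Oplus>p\<in>{..<?m + ?n}. F p) = (\<Oplus>p\<in>{..<?m}. F p) \<oplus> (\<Oplus>p\<in>(+) ?m ` {..<?n}. F p)"
    unfolding un by (rule finsum_Un_disjoint) (use snoc.prems in auto)
  also have "(\<Oplus>p\<in>(+) ?m ` {..<?n}. F p) = (\<Oplus>j\<in>{..<?n}. F (?m + j))"
    by (rule finsum_reindex) (use snoc.prems in auto)
  also have "(\<Oplus>p\<in>{..<?m}. F p) =
      (\<Oplus>i\<in>{..<?k}. \<Oplus>j\<in>{..<length (xss ! i)}. F (length (concat (take i xss)) + j))"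
    using snoc.prems by (intro snoc.IH) auto
  also have "\<dots> = finsum G ?f {..<?k}"
    by (rule finsum_cong'[OF refl Pi]) (simp add: nth_append)
  finally have *: "(\<Oplus>p\<in>{..<?m + ?n}. F p) = finsum G ?f {..<?k} \<oplus> (\<Oplus>j\<in>{..<?n}. F (?m + j))" .
  have "finsum G ?f (insert ?k {..<?k}) = ?f ?k \<oplus> finsum G ?f {..<?k}"
    using Pi snoc.prems by (intro finsum_insert) (auto intro!: finsum_closed)
  also have "?f ?k = (\<Oplus>j\<in>{..<?n}. F (?m + j))" by simp
  also have "\<dots> \<oplus> finsum G ?f {..<?k} = (\<Oplus>p\<in>{..<?m + ?n}. F p)"
    unfolding * using Pi snoc.prems by (intro a_comm finsum_closed) auto
  finally show ?case by (simp add: lessThan_Suc)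
qed simp

end

section \<open>Existence, uniqueness and values of the structure maps\<close>

context operad_universe
begin

lemma Schur_arr_eqI:
  assumes f: "f \<in> Lin (SP V) N" and g: "g \<in> Lin (SP V) N"
    and V: "Module.module R V" and G: "spans R V G"
    and eq: "\<And>\<mu> vs. \<lbrakk>\<mu> \<in> carrier (ops P (length vs)); set vs \<subseteq> G\<rbrakk> \<Longrightarrow>
      app f (elt V \<mu> vs) = app g (elt V \<mu> vs)"
  shows "f = g"
  by (rule Hom_MOD_eqI[OF f g])
    (rule Schur_linear_eqI[OF V G Hom_MOD_linear[OF f] Hom_MOD_linear[OF g] Hom_MOD_module(2)[OF f] eq])

lemma Schur_arr_eqI_symbols:
  assumes "f \<in> Lin (SP V) N" "g \<in> Lin (SP V) N"
    "Module.module R V"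
    "\<And>\<mu> vs. (\<mu>, vs) \<in> symbols V \<Longrightarrow> app f (elt V \<mu> vs) = app g (elt V \<mu> vs)"
  shows "f = g"
  by (rule Schur_arr_eqI[OF assms(1-3) spans_carrier assms(4)]) (simp add: symbols_iff)

text \<open>Evaluated symbols span \<open>S(P, V)\<close>, so arrows out of the iterated functor may
  be compared on operations applied to symbols, exactly where the multiplication has a
  formula.\<close>

lemma Schur_Schur_arr_eqI:
  assumes f: "f \<in> Lin (SP (SP V)) N"
    and g: "g \<in> Lin (SP (SP V)) N"
    and V: "Module.module R V"
    and eq: "\<And>\<mu> ss. \<lbrakk>\<mu> \<in> carrier (ops P (length ss)); set ss \<subseteq> symbols V\<rbrakk> \<Longrightarrow>
      app f (elt (SP V) \<mu> (map (eval_symbol V) ss)) =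
      app g (elt (SP V) \<mu> (map (eval_symbol V) ss))"
  shows "f = g"
proof (rule Schur_arr_eqI[OF f g Schur_module[OF V] eval_symbol_spans[OF V]])
  fix \<mu> ws assume *: "\<mu> \<in> carrier (ops P (length ws))" "set ws \<subseteq> eval_symbol V ` symbols V"
  then obtain ss where "ws = map (eval_symbol V) ss" "set ss \<subseteq> symbols V"
    using ex_symbols[OF V] by blast
  then show "app f (elt (SP V) \<mu> ws) = app g (elt (SP V) \<mu> ws)"
    using eq * by simp
qed

lemma ex_Schur_arr:
  assumes V: "Module.module R V" and N: "Module.module R N" and g: "sym_multilinear_on R P V N g"
  shows "\<exists>h \<in> Lin (SP V) N. \<forall>\<mu> vs. (\<mu>, vs) \<in> symbols V \<longrightarrow>
    app h (elt V \<mu> vs) = g \<mu> vs"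
proof -
  obtain h where h: "linear_on R (SP V) N h"
    "\<And>\<mu> vs. (\<mu>, vs) \<in> symbols V \<Longrightarrow> h (elt V \<mu> vs) = g \<mu> vs"
    using Schur_lift[OF V N g] by blast
  then show ?thesis
    using mk_arr_in_Hom[OF h(1) Schur_module[OF V] N] Schur_elem_closed[OF V]
    by (intro bexI[of _ "mk_arr (SP V) N h"]) auto
qed

lemma symbols_map:
  assumes "(\<mu>, vs) \<in> symbols V" "\<And>x. x \<in> carrier V \<Longrightarrow> f x \<in> carrier W"
  shows "(\<mu>, map f vs) \<in> symbols W"
  using assms by (auto simp: symbols_iff)

lemma symbols_tag:
  assumes "(\<mu>, vs) \<in> symbols V" "\<And>x. x \<in> carrier V \<Longrightarrow> a x \<in> carrier W"
    "\<And>x. x \<in> carrier V \<Longrightarrow> b x \<in> carrier W"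
  shows "(\<mu>, tag a b i vs) \<in> symbols W"
  using assms(1) set_tag_subset[of "carrier V" a "carrier W" b vs i, OF assms(2,3)] by (simp add: symbols_iff)

lemma Schur_map_props:
  assumes f: "f \<in> Lin V W"
  shows "Smap f \<in> Lin (SP V) (SP W) \<and>
    (\<forall>\<mu> vs. (\<mu>, vs) \<in> symbols V \<longrightarrow>
      app (Smap f) (elt V \<mu> vs) = elt W \<mu> (map (app f) vs))"
proof -
  note V = Hom_MOD_module(1)[OF f] and W = Hom_MOD_module(2)[OF f]
  let ?Q = "\<lambda>h. h \<in> Lin (SP V) (SP W) \<and>
    (\<forall>\<mu> vs. \<mu> \<in> carrier (ops P (length vs)) \<longrightarrow> set vs \<subseteq> carrier V \<longrightarrow>
      app h (elt V \<mu> vs) = elt W \<mu> (map (app f) vs))"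
  have "\<exists>!h. ?Q h"
  proof (rule ex_ex1I)
    show "\<exists>h. ?Q h"
      using ex_Schur_arr[OF V Schur_module[OF W]
          sym_multilinear_on_map[OF Schur_elem_sym_multilinear[OF W] Hom_MOD_linear[OF f]]]
      unfolding symbols_iff by blast
    show "h = h'" if "?Q h" "?Q h'" for h h'
    proof (rule Schur_arr_eqI_symbols[OF _ _ V])
      fix \<mu> vs assume "(\<mu>, vs) \<in> symbols V"
      then have "\<mu> \<in> carrier (ops P (length vs))" "set vs \<subseteq> carrier V" by (simp_all add: symbols_iff)
      then show "app h (elt V \<mu> vs) = app h' (elt V \<mu> vs)" using that by simp
    qed (use that in blast)+
  qed
  from theI'[OF this] show ?thesis
    unfolding Schur_map_def Hom_MOD_src[OF f] Hom_MOD_tgt[OF f] symbols_iff by blast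
qed

lemma Schur_map_in_Hom: "f \<in> Lin V W \<Longrightarrow> Smap f \<in> Lin (SP V) (SP W)"
  using Schur_map_props by blast

lemma app_Schur_map: "\<lbrakk>f \<in> Lin V W; (\<mu>, vs) \<in> symbols V\<rbrakk> \<Longrightarrow>
    app (Smap f) (elt V \<mu> vs) = elt W \<mu> (map (app f) vs)"
  using Schur_map_props by blast

lemma unit_linear: "Module.module R V \<Longrightarrow> linear_on R V (SP V) (\<lambda>v. elt V (unit_op P) [v])"
proof -
  assume V: "Module.module R V"
  interpret V: Module.module R V by (rule V)
  \<comment> \<open>The one-element list with entry zero is again a placeholder to be
    updated.\<close>
  have "linear_on R V (SP V) (\<lambda>x. elt V (unit_op P) ([\<zero>\<^bsub>V\<^esub>][0 := x]))"
    using unit_closed by (intro sym_multilinear_on_arg[OF Schur_elem_sym_multilinear[OF V]]) auto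
  then show ?thesis by simp
qed

lemma Schur_unit_eq: "Sunit V = mk_arr V (SP V) (\<lambda>v. elt V (unit_op P) [v])"
  by (simp add: Schur_unit_def mk_arr_def)

lemma Schur_unit_in_Hom: "Module.module R V \<Longrightarrow> Sunit V \<in> Lin V (SP V)"
  unfolding Schur_unit_eq by (intro mk_arr_in_Hom unit_linear Schur_module)

lemma app_Schur_unit: "v \<in> carrier V \<Longrightarrow> app (Sunit V) v = elt V (unit_op P) [v]"
  by (simp add: Schur_unit_eq)

lemma unit_symbol: "v \<in> carrier V \<Longrightarrow> (unit_op P, [v]) \<in> symbols V"
  using unit_closed by (simp add: symbols_iff)

lemma eval_symbols_mem:
  assumes "Module.module R V" "set ss \<subseteq> symbols V" "\<mu> \<in> carrier (ops P (length ss))"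
  shows "(\<mu>, map (eval_symbol V) ss) \<in> symbols (SP V)"
  using assms Schur_elem_closed[OF assms(1)] by (fastforce simp: symbols_iff[of \<mu>] eval_symbol_def)

text \<open>The definite description is legitimate: a solution comes from
  \<open>ex_Schur_mult_multilinear\<close>, and two solutions agree on a spanning set.
  \<open>sub\<close> and \<open>ev\<close> translate the description into symbols.\<close>

lemma Schur_mult_props:
  assumes V: "Module.module R V"
  shows "Smult V \<in> Lin (SP (SP V)) (SP V) \<and>
    (\<forall>\<mu> ss. \<mu> \<in> carrier (ops P (length ss)) \<longrightarrow> set ss \<subseteq> symbols V \<longrightarrow>
      app (Smult V) (elt (SP V) \<mu> (map (eval_symbol V) ss)) = comp_symbols V \<mu> ss)"
proof -
  let ?Q = "\<lambda>h. h \<in> Lin (SP (SP V)) (SP V) \<and>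
    (\<forall>\<mu> ss. \<mu> \<in> carrier (ops P (length ss)) \<longrightarrow> set ss \<subseteq> symbols V \<longrightarrow>
      app h (elt (SP V) \<mu> (map (eval_symbol V) ss)) = comp_symbols V \<mu> ss)"
  have sub: "(\<forall>(\<nu>, vs)\<in>set ss. \<nu> \<in> carrier (ops P (length vs)) \<and> set vs \<subseteq> carrier V) \<longleftrightarrow>
      set ss \<subseteq> symbols V" for ss
    by (auto simp: symbols_def)
  have ev: "map (\<lambda>(\<nu>, vs). elt V \<nu> vs) ss = map (eval_symbol V) ss" for ss
    by (simp add: eval_symbol_def[abs_def] split_beta')
  have "\<exists>!h. ?Q h"
  proof (rule ex_ex1I)
    obtain G where G: "sym_multilinear_on R P (SP V) (SP V) G"
      "\<And>\<mu> ss. \<lbrakk>set ss \<subseteq> symbols V; \<mu> \<in> carrier (ops P (length ss))\<rbrakk> \<Longrightarrow>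
        G \<mu> (map (eval_symbol V) ss) = comp_symbols V \<mu> ss"
      using ex_Schur_mult_multilinear[OF V] by blast
    obtain h where h: "h \<in> Lin (SP (SP V)) (SP V)"
      "\<And>\<mu> ws. (\<mu>, ws) \<in> symbols (SP V) \<Longrightarrow> app h (elt (SP V) \<mu> ws) = G \<mu> ws"
      using ex_Schur_arr[OF Schur_module[OF V] Schur_module[OF V] G(1)] by blast
    have "?Q h" using h(1) by (simp add: h(2) eval_symbols_mem[OF V] G(2))
    then show "\<exists>h. ?Q h" by (rule exI)
    show "h = h'" if Q: "?Q h" "?Q h'" for h h'
      by (rule Schur_Schur_arr_eqI[OF conjunct1[OF Q(1)] conjunct1[OF Q(2)] V]) (use Q in simp)
  qed
  from theI'[OF this] show ?thesis
    unfolding Schur_mult_def sub ev full_comp_eq comp_symbols_def symbol_ops_def symbol_args_def .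
qed

lemma Schur_mult_in_Hom:
  "Module.module R V \<Longrightarrow> Smult V \<in> Lin (SP (SP V)) (SP V)"
  using Schur_mult_props by blast

lemma app_Schur_mult: "\<lbrakk>Module.module R V; \<mu> \<in> carrier (ops P (length ss)); set ss \<subseteq> symbols V\<rbrakk> \<Longrightarrow>
    app (Smult V) (elt (SP V) \<mu> (map (eval_symbol V) ss)) = comp_symbols V \<mu> ss"
  using Schur_mult_props by blast

abbreviation (input) "inl V \<equiv> app (In1 (MOD R) V V)"
abbreviation (input) "inr V \<equiv> app (In2 (MOD R) V V)"

text \<open>Existence rests on the invariance of the whole sum over tagged positions; uniqueness
  holds because the symbols span.\<close>

lemma is_Schur_diff_unique:
  assumes V: "Module.module R V"
  shows "\<exists>!h. is_Schur_diff R P V h"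
proof (rule ex_ex1I)
  let ?VV = "biprod_module V V"
  note VV = biprod_module_module[OF V V]
  note i1 = In1_MOD_in_Hom[OF V V] and i2 = In2_MOD_in_Hom[OF V V]
  obtain h where h: "h \<in> Lin (SP V) (SP ?VV)"
    "\<And>\<mu> vs. (\<mu>, vs) \<in> symbols V \<Longrightarrow> app h (elt V \<mu> vs) =
      (\<Oplus>\<^bsub>SP ?VV\<^esub>i\<in>{..<length vs}. elt ?VV \<mu> (tag (inl V) (inr V) i vs))"
    using ex_Schur_arr[OF V Schur_module[OF VV] sym_multilinear_on_sum_tag[OF
        Schur_elem_sym_multilinear[OF VV] Hom_MOD_linear[OF i1] Hom_MOD_linear[OF i2] V Schur_module[OF VV]]]
    by blast
  then show "\<exists>h. is_Schur_diff R P V h"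
    unfolding is_Schur_diff_def MOD_simps by (intro exI[of _ h]) (simp add: symbols_iff tag_def)
  fix h h' assume *: "is_Schur_diff R P V h" "is_Schur_diff R P V h'"
  show "h = h'"
  proof (rule Schur_arr_eqI_symbols[OF _ _ V])
    show "h \<in> Lin (SP V) (SP ?VV)" "h' \<in> Lin (SP V) (SP ?VV)"
      using * by (simp_all add: is_Schur_diff_def)
    fix \<mu> vs assume "(\<mu>, vs) \<in> symbols V"
    then show "app h (elt V \<mu> vs) = app h' (elt V \<mu> vs)"
      using * by (simp add: is_Schur_diff_def symbols_iff)
  qed
qed

lemma is_Schur_diff_Schur_diff: "Module.module R V \<Longrightarrow> is_Schur_diff R P V (Sdiff V)"
  unfolding Schur_diff_def by (rule theI'[OF is_Schur_diff_unique])

lemma Schur_diff_in_Hom: "Module.module R V \<Longrightarrow>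
    Sdiff V \<in> Lin (SP V) (SP (biprod_module V V))"
  using is_Schur_diff_Schur_diff[of V] by (simp add: is_Schur_diff_def)

lemma app_Schur_diff: "\<lbrakk>Module.module R V; (\<mu>, vs) \<in> symbols V\<rbrakk> \<Longrightarrow>
    app (Sdiff V) (elt V \<mu> vs) =
    (\<Oplus>\<^bsub>SP (biprod_module V V)\<^esub>i\<in>{..<length vs}.
      elt (biprod_module V V) \<mu> (tag (inl V) (inr V) i vs))"
  using is_Schur_diff_Schur_diff[of V] by (simp add: is_Schur_diff_def symbols_iff tag_def)

subsection \<open>The monad laws\<close>

lemma app_eval_symbol_map:
  assumes "f \<in> Lin V W" "s \<in> symbols V"
  shows "app (Smap f) (eval_symbol V s) = eval_symbol W (fst s, map (app f) (snd s))"
  using app_Schur_map[OF assms(1), of "fst s" "snd s"] assms(2) by (simp add: eval_symbol_def)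

lemma symbol_ops_map: "symbol_ops (map (\<lambda>s. (fst s, map f (snd s))) ss) = symbol_ops ss"
  by (simp add: symbol_ops_def split_beta)

lemma symbol_args_map: "symbol_args (map (\<lambda>s. (fst s, map f (snd s))) ss) = map f (symbol_args ss)"
  by (simp add: symbol_args_def map_concat comp_def)

lemma symbol_args_concat: "symbol_args (concat sss) = concat (map symbol_args sss)"
  by (induction sss) simp_all

lemma symbols_map_subset:
  assumes "set ss \<subseteq> symbols V" "\<And>x. x \<in> carrier V \<Longrightarrow> f x \<in> carrier W"
  shows "set (map (\<lambda>s. (fst s, map f (snd s))) ss) \<subseteq> symbols W"
  using assms symbols_map[of _ _ V f W] by auto

lemma comp_symbols_map:
  assumes f: "f \<in> Lin V W" and ss: "set ss \<subseteq> symbols V" "\<mu> \<in> carrier (ops P (length ss))"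
  shows "app (Smap f) (comp_symbols V \<mu> ss) =
    comp_symbols W \<mu> (map (\<lambda>s. (fst s, map (app f) (snd s))) ss)"
  unfolding comp_symbols_def symbol_ops_map symbol_args_map length_map
  by (rule app_Schur_map[OF f comp_symbol_mem[OF ss]])

lemma Schur_map_ident:
  assumes V: "Module.module R V"
  shows "Smap (Ident (MOD R) V) = Ident (MOD R) (SP V)"
proof (rule Schur_arr_eqI_symbols[OF Schur_map_in_Hom[OF Ident_MOD_in_Hom[OF V]]
      Ident_MOD_in_Hom[OF Schur_module[OF V]] V])
  fix \<mu> vs assume s: "(\<mu>, vs) \<in> symbols V"
  then have "map (app (Ident (MOD R) V)) vs = vs" by (intro map_idI) (auto simp: symbols_iff)
  then show "app (Smap (Ident (MOD R) V)) (elt V \<mu> vs) =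
      app (Ident (MOD R) (SP V)) (elt V \<mu> vs)"
    by (simp add: app_Schur_map[OF Ident_MOD_in_Hom[OF V] s] Schur_elem_closed[OF V s])
qed

lemma Schur_map_comp:
  assumes f: "f \<in> Lin A B" and g: "g \<in> Lin B D"
  shows "Smap (g \<bullet> f) = Smap g \<bullet> Smap f"
proof -
  note A = Hom_MOD_module(1)[OF f]
  note gf = Comp_MOD_in_Hom[OF f g]
  show ?thesis
  proof (rule Schur_arr_eqI_symbols[OF Schur_map_in_Hom[OF gf]
        Comp_MOD_in_Hom[OF Schur_map_in_Hom[OF f] Schur_map_in_Hom[OF g]] A])
    fix \<mu> vs assume s: "(\<mu>, vs) \<in> symbols A"
    have "map (app (g \<bullet> f)) vs = map (app g) (map (app f) vs)"
      using s by (auto simp: symbols_iff app_Comp_MOD[OF f] subset_iff)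
    then show "app (Smap (g \<bullet> f)) (elt A \<mu> vs) =
        app (Smap g \<bullet> Smap f) (elt A \<mu> vs)"
      by (simp only: app_Schur_map[OF gf s] app_Comp_MOD[OF Schur_map_in_Hom[OF f] Schur_elem_closed[OF A s]]
          app_Schur_map[OF f s] app_Schur_map[OF g symbols_map[OF s Hom_MOD_closed[OF f]]])
  qed
qed

lemma Schur_mult_natural:
  assumes f: "f \<in> Lin A B"
  shows "Smult B \<bullet> Smap (Smap f) = Smap f \<bullet> Smult A"
proof -
  note A = Hom_MOD_module(1)[OF f] and B = Hom_MOD_module(2)[OF f]
  note Sf = Schur_map_in_Hom[OF f] note SSf = Schur_map_in_Hom[OF Sf]
  note mA = Schur_mult_in_Hom[OF A] and mB = Schur_mult_in_Hom[OF B]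
  show ?thesis
  proof (rule Schur_Schur_arr_eqI[OF Comp_MOD_in_Hom[OF SSf mB] Comp_MOD_in_Hom[OF mA Sf] A])
    fix \<mu> ss assume \<mu>: "\<mu> \<in> carrier (ops P (length ss))" and ss: "set ss \<subseteq> symbols A"
    let ?ss = "map (\<lambda>s. (fst s, map (app f) (snd s))) ss"
    let ?x = "elt (SP A) \<mu> (map (eval_symbol A) ss)"
    note mem = eval_symbols_mem[OF A ss \<mu>]
    note x = Schur_elem_closed[OF Schur_module[OF A] mem]
    have "map (app (Smap f)) (map (eval_symbol A) ss) = map (eval_symbol B) ?ss"
      using ss app_eval_symbol_map[OF f] by auto
    then have "app (Smult B \<bullet> Smap (Smap f)) ?x =
        app (Smult B) (elt (SP B) \<mu> (map (eval_symbol B) ?ss))"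
      by (simp only: app_Comp_MOD[OF SSf x] app_Schur_map[OF Sf mem])
    also have "\<dots> = comp_symbols B \<mu> ?ss"
      using \<mu> by (intro app_Schur_mult[OF B _ symbols_map_subset[OF ss Hom_MOD_closed[OF f]]]) simp_all
    also have "\<dots> = app (Smap f \<bullet> Smult A) ?x"
      by (simp only: app_Comp_MOD[OF mA x] app_Schur_mult[OF A \<mu> ss] comp_symbols_map[OF f ss \<mu>])
    finally show "app (Smult B \<bullet> Smap (Smap f)) ?x = app (Smap f \<bullet> Smult A) ?x" .
  qed
qed

lemma Schur_unit_natural:
  assumes f: "f \<in> Lin A B"
  shows "Sunit B \<bullet> f = Smap f \<bullet> Sunit A"
proof -
  note A = Hom_MOD_module(1)[OF f] and B = Hom_MOD_module(2)[OF f]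
  note Sf = Schur_map_in_Hom[OF f]
  note uA = Schur_unit_in_Hom[OF A] and uB = Schur_unit_in_Hom[OF B]
  show ?thesis
  proof (rule Hom_MOD_eqI[OF Comp_MOD_in_Hom[OF f uB] Comp_MOD_in_Hom[OF uA Sf]])
    fix x assume x: "x \<in> carrier A"
    show "app (Sunit B \<bullet> f) x = app (Smap f \<bullet> Sunit A) x"
      by (simp add: app_Comp_MOD[OF f x] app_Comp_MOD[OF uA x] app_Schur_unit[OF x]
          app_Schur_unit[OF Hom_MOD_closed[OF f x]] app_Schur_map[OF f unit_symbol[OF x]])
  qed
qed

lemma Schur_mult_unit_left:
  assumes V: "Module.module R V"
  shows "Smult V \<bullet> Sunit (SP V) = Ident (MOD R) (SP V)"
proof -
  note SV = Schur_module[OF V] note u = Schur_unit_in_Hom[OF SV] and m = Schur_mult_in_Hom[OF V]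
  show ?thesis
  proof (rule Schur_arr_eqI_symbols[OF Comp_MOD_in_Hom[OF u m] Ident_MOD_in_Hom[OF SV] V])
    fix \<mu> vs assume s: "(\<mu>, vs) \<in> symbols V"
    note x = Schur_elem_closed[OF V s]
    have "app (Smult V \<bullet> Sunit (SP V)) (elt V \<mu> vs) =
        app (Smult V) (elt (SP V) (unit_op P) (map (eval_symbol V) [(\<mu>, vs)]))"
      by (simp add: app_Comp_MOD[OF u x] app_Schur_unit[OF x] eval_symbol_def)
    also have "\<dots> = comp_symbols V (unit_op P) [(\<mu>, vs)]"
      using s unit_closed by (intro app_Schur_mult[OF V]) auto
    also have "\<dots> = elt V \<mu> vs"
      using s comp_at_unit_left[of \<mu> "length vs"] by (simp add: comp_symbols_def symbols_iff)
    finally show "app (Smult V \<bullet> Sunit (SP V)) (elt V \<mu> vs) =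
        app (Ident (MOD R) (SP V)) (elt V \<mu> vs)" using x by simp
  qed
qed

lemma Schur_mult_unit_right:
  assumes V: "Module.module R V"
  shows "Smult V \<bullet> Smap (Sunit V) = Ident (MOD R) (SP V)"
proof -
  note SV = Schur_module[OF V] note u = Schur_unit_in_Hom[OF V] and m = Schur_mult_in_Hom[OF V]
  note Su = Schur_map_in_Hom[OF u]
  show ?thesis
  proof (rule Schur_arr_eqI_symbols[OF Comp_MOD_in_Hom[OF Su m] Ident_MOD_in_Hom[OF SV] V])
    fix \<mu> vs assume s: "(\<mu>, vs) \<in> symbols V"
    note x = Schur_elem_closed[OF V s]
    let ?ss = "map (\<lambda>v. (unit_op P, [v])) vs"
    have vs: "\<mu> \<in> carrier (ops P (length vs))" "set vs \<subseteq> carrier V" using s by (auto simp: symbols_iff)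
    have ops: "symbol_ops ?ss = replicate (length vs) (1, unit_op P)"
      by (simp add: symbol_ops_def map_replicate_const comp_def)
    have args: "symbol_args ?ss = vs" by (simp add: symbol_args_def comp_def)
    have "map (app (Sunit V)) vs = map (eval_symbol V) ?ss"
      using vs app_Schur_unit by (auto simp: eval_symbol_def)
    then have "app (Smult V \<bullet> Smap (Sunit V)) (elt V \<mu> vs) =
        app (Smult V) (elt (SP V) \<mu> (map (eval_symbol V) ?ss))"
      by (simp only: app_Comp_MOD[OF Su x] app_Schur_map[OF u s])
    also have "\<dots> = comp_symbols V \<mu> ?ss"
      using vs unit_symbol by (intro app_Schur_mult[OF V]) auto
    also have "\<dots> = elt V \<mu> vs"
      unfolding comp_symbols_def ops args length_map
      using comp_at_unit_right[of 0 "length vs" "length vs" \<mu>] vs by simp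
    finally show "app (Smult V \<bullet> Smap (Sunit V)) (elt V \<mu> vs) =
        app (Ident (MOD R) (SP V)) (elt V \<mu> vs)" using x by simp
  qed
qed

text \<open>For the associativity law, an operation with a list of symbols in place of its inputs
  stands for an element of \<open>S (S V)\<close>.\<close>

lemma Schur_mult_assoc:
  assumes V: "Module.module R V"
  shows "Smult V \<bullet> Smap (Smult V) = Smult V \<bullet> Smult (SP V)"
proof -
  let ?S = "SP V"
  let ?SS = "SP ?S"
  note SV = Schur_module[OF V]
  note SSV = Schur_module[OF SV]
  note m = Schur_mult_in_Hom[OF V] and mS = Schur_mult_in_Hom[OF SV]
  note Sm = Schur_map_in_Hom[OF m]
  \<comment> \<open>Formal presentations of the elements of \<open>S(P, S(P, V))\<close>: an
    operation with a symbol in each input.\<close>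
  define X where "X = {(\<nu>, ts). \<nu> \<in> carrier (ops P (length ts)) \<and> set ts \<subseteq> symbols V}"
  define e where "e r = (fst r, map (eval_symbol V) (snd r))" for r :: "'u \<times> ('u \<times> 'u list) list"
  \<comment> \<open>\<open>e\<close> evaluates the inner symbols only, giving a symbol over
    \<open>S(P, V)\<close>; \<open>c\<close> composes them with the operation, giving the symbol
    over \<open>V\<close> that presents the product.\<close>
  define c where "c r = (comp_at P 0 (length (snd r)) (fst r) (symbol_ops (snd r)), symbol_args (snd r))"
    for r :: "'u \<times> ('u \<times> 'u list) list"
  have e: "e r \<in> symbols ?S" if "r \<in> X" for r
    using that eval_symbols_mem[OF V] by (auto simp: X_def e_def)
  have c: "c r \<in> symbols V" if "r \<in> X" for r
    using that comp_symbol_mem by (auto simp: X_def c_def)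
  \<comment> \<open>Three layers of generators are needed. Presentations in \<open>X\<close> span
    the twofold iterate, so in the threefold iterate it suffices to take operations whose inputs
    come from \<open>X\<close>.\<close>
  have gen: "spans R ?SS ((\<lambda>r. eval_symbol ?S (e r)) ` X)"
  proof -
    have "{elt ?S \<mu> ws | \<mu> ws. \<mu> \<in> carrier (ops P (length ws)) \<and>
        set ws \<subseteq> eval_symbol V ` symbols V} \<subseteq> (\<lambda>r. eval_symbol ?S (e r)) ` X"
    proof clarify
      fix \<mu> ws assume *: "\<mu> \<in> carrier (ops P (length ws))" "set ws \<subseteq> eval_symbol V ` symbols V"
      then obtain ss where "ws = map (eval_symbol V) ss" "set ss \<subseteq> symbols V"
        using ex_symbols[OF V] by blast
      then show "elt ?S \<mu> ws \<in> (\<lambda>r. eval_symbol ?S (e r)) ` X"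
        using * by (intro image_eqI[of _ _ "(\<mu>, ss)"]) (auto simp: e_def eval_symbol_def X_def)
    qed
    moreover have "(\<lambda>r. eval_symbol ?S (e r)) ` X \<subseteq> carrier ?SS"
      using e Schur_elem_closed[OF SV] by (auto simp: eval_symbol_def)
    ultimately show ?thesis
      using Schur_elem_spans[OF V] Schur_elem_spans[OF SV eval_symbol_spans[OF V]]
      unfolding spans_def by (meson order_trans)
  qed
  show ?thesis
  proof (rule Schur_arr_eqI[OF Comp_MOD_in_Hom[OF Sm m] Comp_MOD_in_Hom[OF mS m] SSV gen])
    fix \<mu> us assume \<mu>: "\<mu> \<in> carrier (ops P (length us))" and us: "set us \<subseteq> (\<lambda>r. eval_symbol ?S (e r)) ` X"
    have "us \<in> lists ((\<lambda>r. eval_symbol ?S (e r)) ` X)" using us by auto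
    then obtain rs where rs: "us = map (\<lambda>r. eval_symbol ?S (e r)) rs" "set rs \<subseteq> X"
      by (auto simp: lists_image)
    have \<mu>': "\<mu> \<in> carrier (ops P (length rs))" using \<mu> rs by simp
    have us_eq: "us = map (eval_symbol ?S) (map e rs)" using rs by simp
    have ers: "set (map e rs) \<subseteq> symbols ?S" and crs: "set (map c rs) \<subseteq> symbols V"
      using rs e c by auto
    have mem: "(\<mu>, us) \<in> symbols ?SS"
      unfolding us_eq using \<mu>' by (intro eval_symbols_mem[OF SV ers]) simp
    note x = Schur_elem_closed[OF SSV mem]
    have "app (Smult V) (eval_symbol ?S (e r)) = eval_symbol V (c r)" if "r \<in> X" for r
      using that app_Schur_mult[OF V, of "fst r" "snd r"]
      by (auto simp: X_def e_def c_def eval_symbol_def comp_symbols_def)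
    then have "map (app (Smult V)) us = map (eval_symbol V) (map c rs)"
      using rs by auto
    then have "app (Smult V \<bullet> Smap (Smult V)) (elt ?SS \<mu> us) =
        app (Smult V) (elt ?S \<mu> (map (eval_symbol V) (map c rs)))"
      by (simp only: app_Comp_MOD[OF Sm x] app_Schur_map[OF m mem])
    also have "\<dots> = comp_symbols V \<mu> (map c rs)"
      using \<mu>' by (intro app_Schur_mult[OF V _ crs]) simp
    finally have L: "app (Smult V \<bullet> Smap (Smult V))
        (elt ?SS \<mu> us) = comp_symbols V \<mu> (map c rs)" .
    let ?tts = "concat (map snd rs)" and ?\<zeta> = "comp_at P 0 (length rs) \<mu> (symbol_ops (map e rs))"
    have tts: "set ?tts \<subseteq> symbols V" using rs by (fastforce simp: X_def)
    have args_e: "symbol_args (map e rs) = map (eval_symbol V) ?tts"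
      by (simp add: symbol_args_def e_def map_concat comp_def)
    have "(comp_at P 0 (length (map e rs)) \<mu> (symbol_ops (map e rs)), symbol_args (map e rs)) \<in> symbols ?S"
      using \<mu>' by (intro comp_symbol_mem[OF ers]) simp
    then have \<zeta>: "?\<zeta> \<in> carrier (ops P (length ?tts))"
      unfolding args_e by (simp add: symbols_iff)
    have "app (Smult V \<bullet> Smult ?S) (elt ?SS \<mu> us) =
        app (Smult V) (comp_symbols ?S \<mu> (map e rs))"
      unfolding app_Comp_MOD[OF mS x] unfolding us_eq using \<mu>' by (subst app_Schur_mult[OF SV _ ers]) simp_all
    also have "comp_symbols ?S \<mu> (map e rs) = elt ?S ?\<zeta> (map (eval_symbol V) ?tts)"
      unfolding comp_symbols_def args_e by simp
    also have "app (Smult V) \<dots> = comp_symbols V ?\<zeta> ?tts"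
      by (rule app_Schur_mult[OF V \<zeta> tts])
    also have "\<dots> = comp_symbols V \<mu> (map c rs)"
    proof -
      \<comment> \<open>Each middle operation with its arity and the list of operations inserted
        into it, as \<open>comp_at_assoc\<close> expects.\<close>
      let ?ts = "map (\<lambda>r. ((length (snd r), fst r), symbol_ops (snd r))) rs"
      have "comp_at P 0 (comp_arity (length rs) (map fst ?ts)) (comp_at P 0 (length rs) \<mu> (map fst ?ts))
          (concat (map snd ?ts)) =
        comp_at P 0 (length rs) \<mu> (map (\<lambda>((n, \<nu>), xs). (comp_arity n xs, comp_at P 0 n \<nu> xs)) ?ts)"
      proof (rule comp_at_assoc)
        fix n \<nu> xs assume "((n, \<nu>), xs) \<in> set ?ts"
        then obtain r where r: "r \<in> X" "n = length (snd r)" "\<nu> = fst r" "xs = symbol_ops (snd r)"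
          using rs by auto
        then show "\<nu> \<in> carrier (ops P n) \<and> length xs = n \<and> set xs \<subseteq> arity_ops"
          using set_symbol_ops[of "snd r" V] by (simp add: X_def split_beta)
      qed (use \<mu>' in auto)
      moreover have "map fst ?ts = symbol_ops (map e rs)" by (simp add: symbol_ops_def e_def comp_def)
      moreover have "concat (map snd ?ts) = symbol_ops ?tts"
        by (simp add: symbol_ops_def comp_def map_concat)
      moreover have "map (\<lambda>((n, \<nu>), xs). (comp_arity n xs, comp_at P 0 n \<nu> xs)) ?ts = symbol_ops (map c rs)"
        by (simp add: symbol_ops_def[of "map c rs"] c_def length_symbol_args')
      moreover have "comp_arity (length rs) (symbol_ops (map e rs)) = length ?tts"
        using length_symbol_args'[of "map e rs"] unfolding args_e by simp
      moreover have "symbol_args ?tts = symbol_args (map c rs)"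
        by (simp add: symbol_args_concat symbol_args_def[of "map c rs"] c_def comp_def)
      ultimately show ?thesis by (simp add: comp_symbols_def)
    qed
    finally show "app (Smult V \<bullet> Smap (Smult V)) (elt ?SS \<mu> us) =
      app (Smult V \<bullet> Smult ?S) (elt ?SS \<mu> us)"
      using L by simp
  qed
qed

lemma Schur_monad: "monad (MOD R) SP Smap Smult Sunit"
  by (intro monad.intro monad_axioms.intro category_MOD)
    (simp_all add: Schur_module Schur_map_in_Hom Schur_map_ident Schur_map_comp Schur_mult_in_Hom
      Schur_mult_natural Schur_unit_in_Hom Schur_unit_natural Schur_mult_assoc
      Schur_mult_unit_left Schur_mult_unit_right)

subsection \<open>The differential combinator\<close>

lemma tag_map: "i < length vs \<Longrightarrow> tag a b i (map f vs) = tag (\<lambda>x. a (f x)) (\<lambda>x. b (f x)) i vs"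
  by (rule nth_equalityI) (auto simp: nth_tag)

text \<open>Linearity in the input that is zero. This kills all terms in \<open>DC1\<close> and the
  mixed terms in \<open>DC5\<close>.\<close>

lemma Schur_elem_zero_entry:
  assumes V: "Module.module R V" and s: "(\<mu>, vs) \<in> symbols V" and k: "k < length vs" "vs ! k = \<zero>\<^bsub>V\<^esub>"
  shows "elt V \<mu> vs = \<zero>\<^bsub>SP V\<^esub>"
proof -
  have "linear_on R V (SP V) (\<lambda>x. elt V \<mu> (vs[k := x]))"
    using s k by (intro sym_multilinear_on_arg[OF Schur_elem_sym_multilinear[OF V]]) (auto simp: symbols_iff)
  from linear_on_zero[OF this V Schur_module[OF V]] show ?thesis
    unfolding k(2)[symmetric] by simp
qed

lemma symbols_tag_inl_inr:
  assumes V: "Module.module R V" and s: "(\<mu>, vs) \<in> symbols V"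
  shows "(\<mu>, tag (inl V) (inr V) i vs) \<in> symbols (biprod_module V V)"
  by (rule symbols_tag[OF s Hom_MOD_closed[OF In1_MOD_in_Hom[OF V V]] Hom_MOD_closed[OF In2_MOD_in_Hom[OF V V]]])

text \<open>Functoriality composes \<open>h\<close> with the two injections: \<open>a\<close> is
  what happens to untagged inputs and \<open>b\<close> to the tagged one. Most axioms reduce to
  reading off these two maps.\<close>

lemma app_Schur_map_diff:
  assumes V: "Module.module R V" and h: "h \<in> Lin (biprod_module V V) W"
    and s: "(\<mu>, vs) \<in> symbols V"
    and ab: "\<And>x. x \<in> carrier V \<Longrightarrow> app h (inl V x) = a x" "\<And>x. x \<in> carrier V \<Longrightarrow> app h (inr V x) = b x"
  shows "app (Smap h \<bullet> Sdiff V) (elt V \<mu> vs) =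
    (\<Oplus>\<^bsub>SP W\<^esub>i\<in>{..<length vs}. elt W \<mu> (tag a b i vs))"
proof -
  let ?VV = "biprod_module V V"
  note VV = biprod_module_module[OF V V]
  note W = Hom_MOD_module(2)[OF h]
  note tm = symbols_tag_inl_inr[OF V s]
  interpret SW: Module.module R "SP W" by (rule Schur_module[OF W])
  have vs: "set vs \<subseteq> carrier V" using s by (simp add: symbols_iff)
  have "app (Smap h \<bullet> Sdiff V) (elt V \<mu> vs) =
      app (Smap h) (\<Oplus>\<^bsub>SP ?VV\<^esub>i\<in>{..<length vs}. elt ?VV \<mu> (tag (inl V) (inr V) i vs))"
    by (simp only: app_Comp_MOD[OF Schur_diff_in_Hom[OF V] Schur_elem_closed[OF V s]] app_Schur_diff[OF V s])
  also have "\<dots> = (\<Oplus>\<^bsub>SP W\<^esub>i\<in>{..<length vs}.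
      app (Smap h) (elt ?VV \<mu> (tag (inl V) (inr V) i vs)))"
    by (rule linear_on_finsum[OF Hom_MOD_linear[OF Schur_map_in_Hom[OF h]] Schur_module[OF VV] Schur_module[OF W]])
      (simp_all add: Schur_elem_closed[OF VV tm])
  also have "\<dots> = (\<Oplus>\<^bsub>SP W\<^esub>i\<in>{..<length vs}. elt W \<mu> (tag a b i vs))"
  proof (rule SW.finsum_cong')
    show "app (Smap h) (elt ?VV \<mu> (tag (inl V) (inr V) i vs)) =
        elt W \<mu> (tag a b i vs)" for i
      unfolding app_Schur_map[OF h tm]
      using vs ab tag_map_eq[of vs "app h" "inl V" a "inr V" b i] by (simp add: subset_iff)
    show "(\<lambda>i. elt W \<mu> (tag a b i vs)) \<in> {..<length vs} \<rightarrow> carrier (SP W)"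
    proof
      fix i
      have "(\<mu>, tag a b i vs) \<in> symbols W"
        by (rule symbols_tag[OF s]) (use ab Hom_MOD_closed[OF h]
            Hom_MOD_closed[OF In1_MOD_in_Hom[OF V V]] Hom_MOD_closed[OF In2_MOD_in_Hom[OF V V]] in metis)+
      then show "elt W \<mu> (tag a b i vs) \<in> carrier (SP W)"
        by (rule Schur_elem_closed[OF W])
    qed
  qed simp
  finally show ?thesis .
qed

text \<open>The inner derivative tags position \<open>i\<close> and the outer one position
  \<open>j\<close>; both run over all inputs, so coinciding positions occur.\<close>

lemma app_Schur_map_diff_diff:
  assumes V: "Module.module R V"
    and h: "h \<in> Lin (biprod_module (biprod_module V V) (biprod_module V V)) W"
    and s: "(\<mu>, vs) \<in> symbols V"
    and ab: "\<And>z. z \<in> carrier (biprod_module V V) \<Longrightarrow> app h (inl (biprod_module V V) z) = a z"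
      "\<And>z. z \<in> carrier (biprod_module V V) \<Longrightarrow> app h (inr (biprod_module V V) z) = b z"
  shows "app (Smap h \<bullet> Sdiff (biprod_module V V) \<bullet> Sdiff V) (elt V \<mu> vs) =
    (\<Oplus>\<^bsub>SP W\<^esub>i\<in>{..<length vs}. \<Oplus>\<^bsub>SP W\<^esub>j\<in>{..<length vs}.
      elt W \<mu> (tag a b j (tag (inl V) (inr V) i vs)))"
proof -
  let ?VV = "biprod_module V V"
  note VV = biprod_module_module[OF V V]
  note W = Hom_MOD_module(2)[OF h]
  note tm = symbols_tag_inl_inr[OF V s]
  note D = Schur_diff_in_Hom[OF V] and DD = Schur_diff_in_Hom[OF VV]
  note hD = Comp_MOD_in_Hom[OF DD Schur_map_in_Hom[OF h]]
  interpret SW: Module.module R "SP W" by (rule Schur_module[OF W])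
  note x = Schur_elem_closed[OF V s]
  have "app (Smap h \<bullet> Sdiff ?VV \<bullet> Sdiff V) (elt V \<mu> vs) =
    app (Smap h \<bullet> Sdiff ?VV) (app (Sdiff V) (elt V \<mu> vs))"
    by (simp only: app_Comp_MOD[OF Comp_MOD_in_Hom[OF D DD] x] app_Comp_MOD[OF D x]
        app_Comp_MOD[OF DD Hom_MOD_closed[OF D x]])
  also have "\<dots> = (\<Oplus>\<^bsub>SP W\<^esub>i\<in>{..<length vs}.
      app (Smap h \<bullet> Sdiff ?VV) (elt ?VV \<mu> (tag (inl V) (inr V) i vs)))"
    unfolding app_Schur_diff[OF V s]
    by (rule linear_on_finsum[OF Hom_MOD_linear[OF hD] Schur_module[OF VV] Schur_module[OF W]])
      (simp_all add: Schur_elem_closed[OF VV tm])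
  finally show ?thesis
    by (simp add: app_Schur_map_diff[OF VV h tm, of a b] ab)
qed

lemma Schur_diff_natural:
  assumes f: "f \<in> Lin A B"
  shows "Sdiff B \<bullet> Smap f =
    Smap (pairing (MOD R) (f \<bullet> Pr1 (MOD R) A A) (f \<bullet> Pr2 (MOD R) A A)) \<bullet>
      Sdiff A"
proof -
  note A = Hom_MOD_module(1)[OF f] and B = Hom_MOD_module(2)[OF f]
  interpret A: Module.module R A by (rule A)
  let ?AA = "biprod_module A A" and ?BB = "biprod_module B B"
  let ?h = "pairing (MOD R) (f \<bullet> Pr1 (MOD R) A A) (f \<bullet> Pr2 (MOD R) A A)"
  note BB = biprod_module_module[OF B B]
  note p1 = Pr1_MOD_in_Hom[OF A A] and p2 = Pr2_MOD_in_Hom[OF A A]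
  note fp1 = Comp_MOD_in_Hom[OF p1 f] and fp2 = Comp_MOD_in_Hom[OF p2 f]
  note h = pairing_MOD_in_Hom[OF B B fp1 fp2]
  note D = Schur_diff_in_Hom[OF A] and DB = Schur_diff_in_Hom[OF B] and Sf = Schur_map_in_Hom[OF f]
  interpret SB: Module.module R "SP ?BB" by (rule Schur_module[OF BB])
  \<comment> \<open>The paired map applies \<open>f\<close> to both components, and one component of
    an injected element is zero.\<close>
  have f0: "app f \<zero>\<^bsub>A\<^esub> = \<zero>\<^bsub>B\<^esub>" by (rule linear_on_zero[OF Hom_MOD_linear[OF f] A B])
  show ?thesis
  proof (rule Schur_arr_eqI_symbols[OF Comp_MOD_in_Hom[OF Sf DB] Comp_MOD_in_Hom[OF D Schur_map_in_Hom[OF h]] A])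
    fix \<mu> vs assume s: "(\<mu>, vs) \<in> symbols A"
    have fs: "(\<mu>, map (app f) vs) \<in> symbols B" by (rule symbols_map[OF s Hom_MOD_closed[OF f]])
    note ev = app_pairing_MOD[OF B B fp1 fp2] app_Comp_MOD[OF p1] app_Comp_MOD[OF p2]
      mk_pair_closed[OF A A] proj1_mk_pair[OF A A] proj2_mk_pair[OF A A] app_In1_MOD[OF A A] app_In2_MOD[OF A A]
      app_In1_MOD[OF B B] app_In2_MOD[OF B B] app_Pr1_MOD[OF A A] app_Pr2_MOD[OF A A] f0 Hom_MOD_closed[OF f]
    have "app (Smap ?h \<bullet> Sdiff A) (elt A \<mu> vs) =
        (\<Oplus>\<^bsub>SP ?BB\<^esub>i\<in>{..<length vs}. elt ?BB \<mu> (tag (\<lambda>x. inl B (app f x)) (\<lambda>x. inr B (app f x)) i vs))"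
      by (rule app_Schur_map_diff[OF A h s]) (simp_all add: ev)
    also have "\<dots> = (\<Oplus>\<^bsub>SP ?BB\<^esub>i\<in>{..<length vs}. elt ?BB \<mu> (tag (inl B) (inr B) i (map (app f) vs)))"
      using Schur_elem_closed[OF BB symbols_tag_inl_inr[OF B fs]]
      by (intro SB.finsum_cong') (auto simp: tag_map)
    also have "\<dots> = app (Sdiff B \<bullet> Smap f) (elt A \<mu> vs)"
      using app_Schur_diff[OF B fs]
      by (simp add: app_Comp_MOD[OF Sf Schur_elem_closed[OF A s]] app_Schur_map[OF f s])
    finally show "app (Sdiff B \<bullet> Smap f) (elt A \<mu> vs) =
        app (Smap ?h \<bullet> Sdiff A) (elt A \<mu> vs)" by simp
  qed
qed

section \<open>The axioms of the differential combinator for a fixed module\<close>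

context
  fixes A :: "('a, 'u) module"
  assumes A: "Module.module R A"
begin

private abbreviation "AA \<equiv> biprod_module A A"
private abbreviation "AAA \<equiv> biprod_module AA A"
private abbreviation "A4 \<equiv> biprod_module AA AA"

private lemma AA: "Module.module R AA" by (rule biprod_module_module[OF A A])
private lemma AAA: "Module.module R AAA" by (rule biprod_module_module[OF AA A])
private lemma A4: "Module.module R A4" by (rule biprod_module_module[OF AA AA])

private lemmas p1 = Pr1_MOD_in_Hom[OF A A] and p2 = Pr2_MOD_in_Hom[OF A A]
  and P1 = Pr1_MOD_in_Hom[OF AA AA] and P2 = Pr2_MOD_in_Hom[OF AA AA]
  and D = Schur_diff_in_Hom[OF A] and DD = Schur_diff_in_Hom[OF AA]
  and z = zero_arr_MOD_in_Hom[OF is_cring AA A] and zA = zero_arr_MOD_in_Hom[OF is_cring A A]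

private lemmas ev = mk_pair_closed[OF A A] proj1_mk_pair[OF A A] proj2_mk_pair[OF A A]
  app_In1_MOD[OF A A] app_In2_MOD[OF A A] app_Pr1_MOD[OF A A] app_Pr2_MOD[OF A A]
  mk_pair_closed[OF AA AA] proj1_mk_pair[OF AA AA] proj2_mk_pair[OF AA AA]
  app_In1_MOD[OF AA AA] app_In2_MOD[OF AA AA] app_Pr1_MOD[OF AA AA] app_Pr2_MOD[OF AA AA]
  app_zero_arr_MOD[OF is_cring AA A] app_zero_arr_MOD[OF is_cring A A]

private lemma zero_A: "\<zero>\<^bsub>A\<^esub> \<in> carrier A"
proof -
  interpret A: Module.module R A by (rule A)
  show ?thesis by simp
qed

private lemma zero_AA: "\<zero>\<^bsub>AA\<^esub> = mk_pair A A \<zero>\<^bsub>A\<^esub> \<zero>\<^bsub>A\<^esub>"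
  using linear_on_zero[OF Hom_MOD_linear[OF In1_MOD_in_Hom[OF A A]] A AA] app_In1_MOD[OF A A zero_A] by simp

text \<open>The first projection composed with the second injection is zero, so every summand has a
  zero input at its tagged position.\<close>

lemma Schur_DC1: "Smap (Pr1 (MOD R) A A) \<bullet> Sdiff A = zero_arr (MOD R) (SP A) (SP A)"
proof -
  note SA = Schur_module[OF A]
  interpret SA: Module.module R "SP A" by (rule SA)
  show ?thesis
  proof (rule Schur_arr_eqI_symbols[OF Comp_MOD_in_Hom[OF D Schur_map_in_Hom[OF p1]]
        zero_arr_MOD_in_Hom[OF is_cring SA SA] A])
    fix \<mu> vs assume s: "(\<mu>, vs) \<in> symbols A"
    have "app (Smap (Pr1 (MOD R) A A) \<bullet> Sdiff A) (elt A \<mu> vs) =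
        (\<Oplus>\<^bsub>SP A\<^esub>i\<in>{..<length vs}. elt A \<mu> (tag (\<lambda>x. x) (\<lambda>_. \<zero>\<^bsub>A\<^esub>) i vs))"
      by (rule app_Schur_map_diff[OF A p1 s]) (simp_all add: ev zero_A)
    also have "\<dots> = \<zero>\<^bsub>SP A\<^esub>"
    proof (rule SA.finsum_all_zero)
      fix i assume i: "i \<in> {..<length vs}"
      show "elt A \<mu> (tag (\<lambda>x. x) (\<lambda>_. \<zero>\<^bsub>A\<^esub>) i vs) = \<zero>\<^bsub>SP A\<^esub>"
        by (rule Schur_elem_zero_entry[OF A symbols_tag[OF s], of _ _ _ i]) (use i zero_A in \<open>auto simp: nth_tag\<close>)
    qed
    finally show "app (Smap (Pr1 (MOD R) A A) \<bullet> Sdiff A) (elt A \<mu> vs) =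
        app (zero_arr (MOD R) (SP A) (SP A)) (elt A \<mu> vs)"
      by (simp add: app_zero_arr_MOD[OF is_cring SA SA Schur_elem_closed[OF A s]])
  qed
qed

text \<open>The three maps agree on untagged inputs, all giving \<open>?a\<close>; on the tagged one
  the left-hand map is the sum \<open>?b1 + ?b2\<close> of the other two. Linearity in that single
  input splits each summand.\<close>

lemma Schur_DC2:
  "Smap (pairing3 (MOD R) (Pr1 (MOD R) A A) (Pr2 (MOD R) A A) (Pr2 (MOD R) A A)) \<bullet> Sdiff A =
   arr_add (MOD R)
    (Smap (pairing3 (MOD R) (Pr1 (MOD R) A A) (Pr2 (MOD R) A A) (zero_arr (MOD R) AA A)) \<bullet> Sdiff A)
    (Smap (pairing3 (MOD R) (Pr1 (MOD R) A A) (zero_arr (MOD R) AA A) (Pr2 (MOD R) A A)) \<bullet> Sdiff A)"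
proof -
  interpret A: Module.module R A by (rule A)
  interpret S: Module.module R "SP AAA" by (rule Schur_module[OF AAA])
  let ?p1 = "Pr1 (MOD R) A A" and ?p2 = "Pr2 (MOD R) A A" and ?z = "zero_arr (MOD R) AA A"
  let ?a = "\<lambda>x. mk_pair AA A (mk_pair A A x \<zero>\<^bsub>A\<^esub>) \<zero>\<^bsub>A\<^esub>"
    and ?b = "\<lambda>x. mk_pair AA A (mk_pair A A \<zero>\<^bsub>A\<^esub> x) x"
    and ?b1 = "\<lambda>x. mk_pair AA A (mk_pair A A \<zero>\<^bsub>A\<^esub> x) \<zero>\<^bsub>A\<^esub>"
    and ?b2 = "\<lambda>x. mk_pair AA A (mk_pair A A \<zero>\<^bsub>A\<^esub> \<zero>\<^bsub>A\<^esub>) x"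
  note p12 = pairing_MOD_in_Hom[OF A A p1 p2] and p1z = pairing_MOD_in_Hom[OF A A p1 z]
  note h = pairing_MOD_in_Hom[OF AA A p12 p2, folded pairing3_def]
    and h1 = pairing_MOD_in_Hom[OF AA A p12 z, folded pairing3_def]
    and h2 = pairing_MOD_in_Hom[OF AA A p1z p2, folded pairing3_def]
  note app_h = app_pairing_MOD[OF AA A p12 p2, folded pairing3_def]
    app_pairing_MOD[OF AA A p12 z, folded pairing3_def] app_pairing_MOD[OF AA A p1z p2, folded pairing3_def]
    app_pairing_MOD[OF A A p1 p2] app_pairing_MOD[OF A A p1 z]
  let ?h = "pairing3 (MOD R) ?p1 ?p2 ?p2" and ?h1 = "pairing3 (MOD R) ?p1 ?p2 ?z" and ?h2 = "pairing3 (MOD R) ?p1 ?z ?p2"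
  note hD = Comp_MOD_in_Hom[OF D Schur_map_in_Hom[OF h]] and h1D = Comp_MOD_in_Hom[OF D Schur_map_in_Hom[OF h1]]
    and h2D = Comp_MOD_in_Hom[OF D Schur_map_in_Hom[OF h2]]
  show ?thesis
  proof (rule Schur_arr_eqI_symbols[OF hD arr_add_MOD_in_Hom[OF h1D h2D] A])
    fix \<mu> vs assume s: "(\<mu>, vs) \<in> symbols A"
    have cl: "?a x \<in> carrier AAA" "?b1 x \<in> carrier AAA" "?b2 x \<in> carrier AAA" "?b x \<in> carrier AAA"
      "?b x = ?b1 x \<oplus>\<^bsub>AAA\<^esub> ?b2 x" if "x \<in> carrier A" for x
      using that by (simp_all add: mk_pair_closed[OF AA A] ev mk_pair_add[OF AA A] mk_pair_add[OF A A])
    have mem: "(\<mu>, tag ?a ?b1 i vs) \<in> symbols AAA" "(\<mu>, tag ?a ?b2 i vs) \<in> symbols AAA" for i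
      using cl by (auto intro!: symbols_tag[OF s])
    have split: "elt AAA \<mu> (tag ?a ?b i vs) =
        elt AAA \<mu> (tag ?a ?b1 i vs) \<oplus>\<^bsub>SP AAA\<^esub> elt AAA \<mu> (tag ?a ?b2 i vs)"
      if i: "i < length vs" for i
    proof -
      have vi: "vs ! i \<in> carrier A" using s i by (auto simp: symbols_iff dest: nth_mem)
      have "linear_on R AAA (SP AAA) (\<lambda>x. elt AAA \<mu> ((tag ?a ?b1 i vs)[i := x]))"
        using mem(1)[of i] i by (intro sym_multilinear_on_arg[OF Schur_elem_sym_multilinear[OF AAA]]) (auto simp: symbols_iff)
      from linear_on_add[OF this cl(2,3)[OF vi]] show ?thesis
        by (simp add: tag_def cl(5)[OF vi])
    qed
    have "app (Smap ?h \<bullet> Sdiff A) (elt A \<mu> vs) =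
        (\<Oplus>\<^bsub>SP AAA\<^esub>i\<in>{..<length vs}. elt AAA \<mu> (tag ?a ?b i vs))"
      by (rule app_Schur_map_diff[OF A h s]) (simp_all add: ev app_h)
    also have "\<dots> = (\<Oplus>\<^bsub>SP AAA\<^esub>i\<in>{..<length vs}.
        elt AAA \<mu> (tag ?a ?b1 i vs) \<oplus>\<^bsub>SP AAA\<^esub> elt AAA \<mu> (tag ?a ?b2 i vs))"
      using Schur_elem_closed[OF AAA mem(1)] Schur_elem_closed[OF AAA mem(2)] split
      by (intro S.finsum_cong') auto
    also have "\<dots> = (\<Oplus>\<^bsub>SP AAA\<^esub>i\<in>{..<length vs}. elt AAA \<mu> (tag ?a ?b1 i vs)) \<oplus>\<^bsub>SP AAA\<^esub>
        (\<Oplus>\<^bsub>SP AAA\<^esub>i\<in>{..<length vs}. elt AAA \<mu> (tag ?a ?b2 i vs))"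
      using Schur_elem_closed[OF AAA mem(1)] Schur_elem_closed[OF AAA mem(2)] by (intro S.finsum_addf) auto
    also have "(\<Oplus>\<^bsub>SP AAA\<^esub>i\<in>{..<length vs}. elt AAA \<mu> (tag ?a ?b1 i vs)) =
        app (Smap ?h1 \<bullet> Sdiff A) (elt A \<mu> vs)"
      by (rule app_Schur_map_diff[OF A h1 s, symmetric]) (simp_all add: ev app_h)
    also have "(\<Oplus>\<^bsub>SP AAA\<^esub>i\<in>{..<length vs}. elt AAA \<mu> (tag ?a ?b2 i vs)) =
        app (Smap ?h2 \<bullet> Sdiff A) (elt A \<mu> vs)"
      by (rule app_Schur_map_diff[OF A h2 s, symmetric]) (simp_all add: ev app_h)
    finally show "app (Smap ?h \<bullet> Sdiff A) (elt A \<mu> vs) =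
        app (arr_add (MOD R) (Smap ?h1 \<bullet> Sdiff A)
          (Smap ?h2 \<bullet> Sdiff A)) (elt A \<mu> vs)"
      by (simp only: app_arr_add_MOD[OF h1D h2D Schur_elem_closed[OF A s]])
  qed
qed

lemma Schur_DC3:
  "Sdiff A \<bullet> Sunit A =
    Sunit AA \<bullet> pairing (MOD R) (zero_arr (MOD R) A A) (Ident (MOD R) A)"
proof -
  note I = Ident_MOD_in_Hom[OF A] and u = Schur_unit_in_Hom[OF A] and uA = Schur_unit_in_Hom[OF AA]
  note p = pairing_MOD_in_Hom[OF A A zA I]
  interpret S: Module.module R "SP AA" by (rule Schur_module[OF AA])
  show ?thesis
  proof (rule Hom_MOD_eqI[OF Comp_MOD_in_Hom[OF u D] Comp_MOD_in_Hom[OF p uA]])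
    fix v assume v: "v \<in> carrier A"
    \<comment> \<open>The unit operation has one input, so the sum has a single term, in which that
      input is tagged.\<close>
    have t: "tag (inl A) (inr A) 0 [v] = [mk_pair A A \<zero>\<^bsub>A\<^esub> v]" using v by (simp add: tag_def ev)
    have m: "mk_pair A A \<zero>\<^bsub>A\<^esub> v \<in> carrier AA" using v zero_A by (simp add: ev)
    have "app (Sdiff A \<bullet> Sunit A) v =
        (\<Oplus>\<^bsub>SP AA\<^esub>i\<in>{..<length [v]}. elt AA (unit_op P) (tag (inl A) (inr A) i [v]))"
      by (simp only: app_Comp_MOD[OF u v] app_Schur_unit[OF v] app_Schur_diff[OF A unit_symbol[OF v]])
    also have "{..<length [v]} = {0}" by auto
    also have "(\<Oplus>\<^bsub>SP AA\<^esub>i\<in>{0}. elt AA (unit_op P) (tag (inl A) (inr A) i [v])) =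
        elt AA (unit_op P) [mk_pair A A \<zero>\<^bsub>A\<^esub> v]"
      using Schur_elem_closed[OF AA unit_symbol[OF m]] by (simp add: t)
    finally show "app (Sdiff A \<bullet> Sunit A) v =
        app (Sunit AA \<bullet> pairing (MOD R) (zero_arr (MOD R) A A) (Ident (MOD R) A)) v"
      using v by (simp add: app_Comp_MOD[OF p v] app_pairing_MOD[OF A A zA I v] ev app_Schur_unit[OF m])
  qed
qed

text \<open>Only the diagonal of the double sum survives, and it reproduces the terms of the single
  derivative.\<close>

lemma Schur_DC5:
  "Smap (pairing (MOD R) (quad1 (MOD R) A) (quad4 (MOD R) A)) \<bullet>
    Sdiff AA \<bullet> Sdiff A = Sdiff A"
proof -
  interpret A: Module.module R A by (rule A)
  interpret S: Module.module R "SP AA" by (rule Schur_module[OF AA])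
  note q1 = Comp_MOD_in_Hom[OF P1 p1] and q4 = Comp_MOD_in_Hom[OF P2 p2]
  let ?h = "pairing (MOD R) (quad1 (MOD R) A) (quad4 (MOD R) A)"
  have Q: "quad1 (MOD R) A = Pr1 (MOD R) A A \<bullet> Pr1 (MOD R) AA AA"
    "quad4 (MOD R) A = Pr2 (MOD R) A A \<bullet> Pr2 (MOD R) AA AA"
    by (simp_all add: quad1_def quad4_def)
  have h: "?h \<in> Lin A4 AA" unfolding Q by (rule pairing_MOD_in_Hom[OF A A q1 q4])
  \<comment> \<open>The first and fourth components of \<open>(z, 0)\<close> and of
    \<open>(0, z)\<close>, for \<open>z\<close> a pair: the untagged map keeps the first entry of
    \<open>z\<close> and the tagged map keeps the second.\<close>
  let ?a = "\<lambda>z. mk_pair A A (proj1 A A z) \<zero>\<^bsub>A\<^esub>" and ?b = "\<lambda>z. mk_pair A A \<zero>\<^bsub>A\<^esub> (proj2 A A z)"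
  have zz: "\<zero>\<^bsub>AA\<^esub> \<in> carrier AA" by (simp add: zero_AA ev)
  have ab: "app ?h (inl AA z) = ?a z" "app ?h (inr AA z) = ?b z" if "z \<in> carrier AA" for z
    using that zz zero_AA unfolding Q
    by (simp_all add: app_pairing_MOD[OF A A q1 q4] app_Comp_MOD[OF P1] app_Comp_MOD[OF P2] ev)
  show ?thesis
  proof (rule Schur_arr_eqI_symbols[OF Comp_MOD_in_Hom[OF Comp_MOD_in_Hom[OF D DD] Schur_map_in_Hom[OF h]] D A])
    fix \<mu> vs assume s: "(\<mu>, vs) \<in> symbols A"
    have va: "vs ! k \<in> carrier A" if "k < length vs" for k using s that by (auto simp: symbols_iff dest: nth_mem)
    let ?t = "\<lambda>i j. tag ?a ?b j (tag (inl A) (inr A) i vs)"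
    have tm: "(\<mu>, ?t i j) \<in> symbols AA" for i j
    proof (rule symbols_tag[OF symbols_tag_inl_inr[OF A s]])
      fix z assume "z \<in> carrier AA"
      then show "?a z \<in> carrier AA" "?b z \<in> carrier AA"
        by (auto elim!: biprod_module_cases[OF A A] simp: ev)
    qed
    have diag: "?t i i = tag (inl A) (inr A) i vs" if "i < length vs" for i
      by (rule nth_equalityI) (auto simp: nth_tag ev va)
    \<comment> \<open>At position \<open>i\<close> the inner tag leaves the first entry zero, and
      the outer untagged map keeps only that entry, so the input there is zero.\<close>
    have off: "elt AA \<mu> (?t i j) = \<zero>\<^bsub>SP AA\<^esub>" if "i < length vs" "j < length vs" "j \<noteq> i" for i j
      by (rule Schur_elem_zero_entry[OF AA tm, of i]) (use that in \<open>auto simp: nth_tag ev va zero_AA\<close>)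
    have "app (Smap ?h \<bullet> Sdiff AA \<bullet> Sdiff A) (elt A \<mu> vs) =
      (\<Oplus>\<^bsub>SP AA\<^esub>i\<in>{..<length vs}. \<Oplus>\<^bsub>SP AA\<^esub>j\<in>{..<length vs}. elt AA \<mu> (?t i j))"
      by (rule app_Schur_map_diff_diff[OF A h s ab])
    also have "\<dots> = (\<Oplus>\<^bsub>SP AA\<^esub>i\<in>{..<length vs}. elt AA \<mu> (tag (inl A) (inr A) i vs))"
    proof (rule S.finsum_cong')
      fix i assume i: "i \<in> {..<length vs}"
      have "(\<Oplus>\<^bsub>SP AA\<^esub>j\<in>{..<length vs}. elt AA \<mu> (?t i j)) = elt AA \<mu> (?t i i)"
        using i by (intro S.finsum_single) (auto intro: off Schur_elem_closed[OF AA tm])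
      then show "(\<Oplus>\<^bsub>SP AA\<^esub>j\<in>{..<length vs}. elt AA \<mu> (?t i j)) =
          elt AA \<mu> (tag (inl A) (inr A) i vs)" using i diag by simp
    qed (use Schur_elem_closed[OF AA symbols_tag_inl_inr[OF A s]] in auto)
    also have "\<dots> = app (Sdiff A) (elt A \<mu> vs)" by (rule app_Schur_diff[OF A s, symmetric])
    finally show "app (Smap ?h \<bullet> Sdiff AA \<bullet> Sdiff A) (elt A \<mu> vs) =
      app (Sdiff A) (elt A \<mu> vs)" .
  qed
qed

text \<open>Exchanging the second and third components exchanges the two positions at which the
  double derivative applies second injections.\<close>

lemma Schur_DC6:
  "Smap (pairing4 (MOD R) (quad1 (MOD R) A) (quad3 (MOD R) A) (quad2 (MOD R) A) (quad4 (MOD R) A)) \<bullet>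
    Sdiff AA \<bullet> Sdiff A = Sdiff AA \<bullet> Sdiff A"
proof -
  interpret A: Module.module R A by (rule A)
  interpret S: Module.module R "SP A4" by (rule Schur_module[OF A4])
  note q1 = Comp_MOD_in_Hom[OF P1 p1] and q2 = Comp_MOD_in_Hom[OF P1 p2]
    and q3 = Comp_MOD_in_Hom[OF P2 p1] and q4 = Comp_MOD_in_Hom[OF P2 p2]
  let ?h = "pairing4 (MOD R) (quad1 (MOD R) A) (quad3 (MOD R) A) (quad2 (MOD R) A) (quad4 (MOD R) A)"
  have Q: "quad1 (MOD R) A = Pr1 (MOD R) A A \<bullet> Pr1 (MOD R) AA AA"
    "quad2 (MOD R) A = Pr2 (MOD R) A A \<bullet> Pr1 (MOD R) AA AA"
    "quad3 (MOD R) A = Pr1 (MOD R) A A \<bullet> Pr2 (MOD R) AA AA"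
    "quad4 (MOD R) A = Pr2 (MOD R) A A \<bullet> Pr2 (MOD R) AA AA"
    by (simp_all add: quad1_def quad2_def quad3_def quad4_def)
  note q13 = pairing_MOD_in_Hom[OF A A q1 q3] and q24 = pairing_MOD_in_Hom[OF A A q2 q4]
  have h: "?h \<in> Lin A4 A4" unfolding Q pairing4_def by (rule pairing_MOD_in_Hom[OF AA AA q13 q24])
  \<comment> \<open>The exchange of the two middle components applied to \<open>(z, 0)\<close> and
    to \<open>(0, z)\<close>: it applies the corresponding injection of \<open>A\<close> to each
    entry of \<open>z\<close>.\<close>
  let ?a = "\<lambda>z. mk_pair AA AA (mk_pair A A (proj1 A A z) \<zero>\<^bsub>A\<^esub>) (mk_pair A A (proj2 A A z) \<zero>\<^bsub>A\<^esub>)"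
    and ?b = "\<lambda>z. mk_pair AA AA (mk_pair A A \<zero>\<^bsub>A\<^esub> (proj1 A A z)) (mk_pair A A \<zero>\<^bsub>A\<^esub> (proj2 A A z))"
  have zz: "\<zero>\<^bsub>AA\<^esub> \<in> carrier AA" by (simp add: zero_AA ev)
  have ab: "app ?h (inl AA z) = ?a z" "app ?h (inr AA z) = ?b z" if "z \<in> carrier AA" for z
    using that zz zero_AA unfolding Q pairing4_def
    by (simp_all add: app_pairing_MOD[OF A A q1 q3] app_pairing_MOD[OF A A q2 q4] app_pairing_MOD[OF AA AA q13 q24]
        app_Comp_MOD[OF P1] app_Comp_MOD[OF P2] ev)
  show ?thesis
  proof (rule Schur_arr_eqI_symbols[OF Comp_MOD_in_Hom[OF Comp_MOD_in_Hom[OF D DD] Schur_map_in_Hom[OF h]] Comp_MOD_in_Hom[OF D DD] A])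
    fix \<mu> vs assume s: "(\<mu>, vs) \<in> symbols A"
    have va: "vs ! k \<in> carrier A" if "k < length vs" for k using s that by (auto simp: symbols_iff dest: nth_mem)
    let ?t = "\<lambda>i j. tag (inl AA) (inr AA) j (tag (inl A) (inr A) i vs)"
    have tm: "(\<mu>, ?t i j) \<in> symbols A4" for i j
      by (rule symbols_tag_inl_inr[OF AA symbols_tag_inl_inr[OF A s]])
    note tm1 = symbols_tag_inl_inr[OF A s]
    have swap: "tag ?a ?b j (tag (inl A) (inr A) i vs) = ?t j i" for i j
      by (rule nth_equalityI) (auto simp: nth_tag ev va zero_AA zz)
    have "app (Smap ?h \<bullet> Sdiff AA \<bullet> Sdiff A) (elt A \<mu> vs) =
      (\<Oplus>\<^bsub>SP A4\<^esub>i\<in>{..<length vs}. \<Oplus>\<^bsub>SP A4\<^esub>j\<in>{..<length vs}. elt A4 \<mu> (?t j i))"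
      using app_Schur_map_diff_diff[OF A h s ab] by (simp only: swap)
    also have "\<dots> = (\<Oplus>\<^bsub>SP A4\<^esub>j\<in>{..<length vs}. \<Oplus>\<^bsub>SP A4\<^esub>i\<in>{..<length vs}. elt A4 \<mu> (?t j i))"
      by (rule S.finsum_swap) (auto intro: Schur_elem_closed[OF A4 tm])
    also have "\<dots> = (\<Oplus>\<^bsub>SP A4\<^esub>j\<in>{..<length vs}. app (Sdiff AA) (elt AA \<mu> (tag (inl A) (inr A) j vs)))"
      by (simp add: app_Schur_diff[OF AA tm1])
    also have "\<dots> = app (Sdiff AA) (app (Sdiff A) (elt A \<mu> vs))"
      unfolding app_Schur_diff[OF A s]
      by (rule linear_on_finsum[OF Hom_MOD_linear[OF DD] Schur_module[OF AA] Schur_module[OF A4], symmetric])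
        (simp_all add: Schur_elem_closed[OF AA tm1])
    finally show "app (Smap ?h \<bullet> Sdiff AA \<bullet> Sdiff A) (elt A \<mu> vs) =
      app (Sdiff AA \<bullet> Sdiff A) (elt A \<mu> vs)"
      by (simp only: app_Comp_MOD[OF D Schur_elem_closed[OF A s]])
  qed
qed

private abbreviation "SA \<equiv> SP A"
private abbreviation "SAA \<equiv> SP AA"

private lemmas SA = Schur_module[OF A] and SAA = Schur_module[OF AA]

text \<open>Index bookkeeping for \<open>DC4\<close>: tagging input \<open>j\<close> of the
  \<open>i\<close>-th symbol tags one position of the concatenated arguments, offset by the inputs
  of the earlier symbols, and leaves all operations unchanged.\<close>

lemma symbols_update_tag:
  assumes ss: "set ss \<subseteq> symbols A" and i: "i < length ss" and j: "j < length (snd (ss ! i))"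
  defines "ts \<equiv> (map (\<lambda>s. (fst s, map (inl A) (snd s))) ss)[i := (fst (ss ! i), tag (inl A) (inr A) j (snd (ss ! i)))]"
  shows "set ts \<subseteq> symbols AA" "symbol_ops ts = symbol_ops ss"
    "symbol_args ts = tag (inl A) (inr A) (length (symbol_args (take i ss)) + j) (symbol_args ss)"
proof -
  let ?g = "\<lambda>s. (fst s, map (inl A) (snd s))"
  obtain \<nu> vs where s: "ss ! i = (\<nu>, vs)" by force
  define xs ys where "xs = take i ss" and "ys = drop (Suc i) ss"
  have ss_eq: "ss = xs @ (\<nu>, vs) # ys"
    using i id_take_nth_drop[OF i] by (simp add: xs_def ys_def s)
  have lx: "length xs = i" using i by (simp add: xs_def)
  have ts: "ts = map ?g xs @ (\<nu>, tag (inl A) (inr A) j vs) # map ?g ys"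
    by (simp add: ts_def s) (simp add: ss_eq list_update_append lx[symmetric])
  have mem: "(\<nu>, vs) \<in> symbols A" "set xs \<subseteq> symbols A" "set ys \<subseteq> symbols A" using ss by (auto simp: ss_eq)
  note inl_cl = Hom_MOD_closed[OF In1_MOD_in_Hom[OF A A]]
  show "set ts \<subseteq> symbols AA"
    using symbols_map_subset[of xs A "inl A" AA] symbols_map_subset[of ys A "inl A" AA] mem inl_cl
      symbols_tag_inl_inr[OF A mem(1), of j]
    by (simp add: ts)
  show "symbol_ops ts = symbol_ops ss" by (simp add: ts ss_eq symbol_ops_map)
  show "symbol_args ts = tag (inl A) (inr A) (length (symbol_args (take i ss)) + j) (symbol_args ss)"
    using j unfolding xs_def[symmetric]
    by (simp add: ts ss_eq symbol_args_map tag_def list_update_append nth_append lx[symmetric])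
qed

text \<open>The outer derivative selects one inner symbol, which is differentiated while the others
  are injected as untagged. Multiplying out gives a double sum over blocks and positions in them,
  which is the sum over all inputs of the composite.\<close>

lemma Schur_DC4:
  "Sdiff A \<bullet> Smult A = Smult AA \<bullet> Comp (MOD R)
        (Smap (arr_add (MOD R)
          (Smap (pairing (MOD R) (Ident (MOD R) A) (zero_arr (MOD R) A A)) \<bullet> Pr1 (MOD R) SA SA)
          (Sdiff A \<bullet> Pr2 (MOD R) SA SA)))
        (Sdiff SA)"
proof -
  interpret A: Module.module R A by (rule A)
  interpret SA: Module.module R SA by (rule SA)
  interpret SAA: Module.module R SAA by (rule SAA)
  let ?in = "pairing (MOD R) (Ident (MOD R) A) (zero_arr (MOD R) A A)"
  let ?f = "Smap ?in \<bullet> Pr1 (MOD R) SA SA"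
    and ?g = "Sdiff A \<bullet> Pr2 (MOD R) SA SA"
  let ?\<phi> = "arr_add (MOD R) ?f ?g"
  note I = Ident_MOD_in_Hom[OF A] and zA = zero_arr_MOD_in_Hom[OF is_cring A A]
  note inH = pairing_MOD_in_Hom[OF A A I zA]
  note Sin = Schur_map_in_Hom[OF inH] and D = Schur_diff_in_Hom[OF A]
  note p1 = Pr1_MOD_in_Hom[OF SA SA] and p2 = Pr2_MOD_in_Hom[OF SA SA]
  note f = Comp_MOD_in_Hom[OF p1 Sin] and g = Comp_MOD_in_Hom[OF p2 D]
  note \<phi> = arr_add_MOD_in_Hom[OF f g]
  note m = Schur_mult_in_Hom[OF A] and mAA = Schur_mult_in_Hom[OF AA] and DS = Schur_diff_in_Hom[OF SA]
  note S\<phi>D = Comp_MOD_in_Hom[OF DS Schur_map_in_Hom[OF \<phi>]]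
  have in_eq: "app ?in x = inl A x" if "x \<in> carrier A" for x
    using that by (simp add: app_pairing_MOD[OF A A I zA] app_zero_arr_MOD[OF is_cring A A] app_In1_MOD[OF A A])
  \<comment> \<open>An injected element of the product has one zero component, and the summand of
    \<open>?\<phi>\<close> that reads this component vanishes.\<close>
  have zeros: "app (Smap ?in) \<zero>\<^bsub>SA\<^esub> = \<zero>\<^bsub>SAA\<^esub>" "app (Sdiff A) \<zero>\<^bsub>SA\<^esub> = \<zero>\<^bsub>SAA\<^esub>"
    by (rule linear_on_zero[OF Hom_MOD_linear[OF Sin] SA SAA], rule linear_on_zero[OF Hom_MOD_linear[OF D] SA SAA])
  have \<phi>_in: "app ?\<phi> (inl SA w) = app (Smap ?in) w" "app ?\<phi> (inr SA w) = app (Sdiff A) w"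
    if "w \<in> carrier SA" for w
    using that zeros Hom_MOD_closed[OF Sin] Hom_MOD_closed[OF D]
    by (simp_all add: app_arr_add_MOD[OF f g] app_Comp_MOD[OF p1] app_Comp_MOD[OF p2] mk_pair_closed[OF SA SA]
        proj1_mk_pair[OF SA SA] proj2_mk_pair[OF SA SA] app_In1_MOD[OF SA SA] app_In2_MOD[OF SA SA]
        app_Pr1_MOD[OF SA SA] app_Pr2_MOD[OF SA SA])
  show ?thesis
  proof (rule Schur_Schur_arr_eqI[OF Comp_MOD_in_Hom[OF m D] Comp_MOD_in_Hom[OF S\<phi>D mAA] A])
    fix \<mu> ss assume \<mu>: "\<mu> \<in> carrier (ops P (length ss))" and ss: "set ss \<subseteq> symbols A"
    let ?k = "length ss" and ?ws = "map (eval_symbol A) ss" and ?\<zeta> = "comp_at P 0 (length ss) \<mu> (symbol_ops ss)"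
    let ?us = "map (\<lambda>s. (fst s, map (inl A) (snd s))) ss"
    let ?a = "app (Smap ?in)" and ?b = "app (Sdiff A)"
    note mem = eval_symbols_mem[OF A ss \<mu>]
    note x = Schur_elem_closed[OF SA mem]
    note \<zeta> = comp_symbol_mem[OF ss \<mu>]
    note inl_cl = Hom_MOD_closed[OF In1_MOD_in_Hom[OF A A]]
    have us: "set ?us \<subseteq> symbols AA" by (rule symbols_map_subset[OF ss inl_cl])
    have s_mem: "ss ! i \<in> symbols A" if "i < ?k" for i using ss that by (auto dest: nth_mem)
    have a_eval: "?a (eval_symbol A s) = eval_symbol AA (fst s, map (inl A) (snd s))" if "s \<in> symbols A" for s
    proof -
      have "set (snd s) \<subseteq> carrier A" using that by (cases s) (simp add: symbols_iff)
      then have "map (app ?in) (snd s) = map (inl A) (snd s)" using in_eq by auto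
      then show ?thesis by (simp only: app_eval_symbol_map[OF inH that])
    qed
    \<comment> \<open>One outer term: the differentiated entry is itself a sum, and linearity in
      that entry followed by linearity of the multiplication distributes over it.\<close>
    have summand: "app (Smult AA) (elt SAA \<mu> (tag ?a ?b i ?ws)) =
        (\<Oplus>\<^bsub>SAA\<^esub>j\<in>{..<length (snd (ss ! i))}.
          elt AA ?\<zeta> (tag (inl A) (inr A) (length (symbol_args (take i ss)) + j) (symbol_args ss)))"
      if i: "i < ?k" for i
    proof -
      let ?U = "map (eval_symbol AA) ?us" and ?n = "length (snd (ss ! i))"
      let ?t = "\<lambda>j. tag (inl A) (inr A) j (snd (ss ! i))"
      have U: "(\<mu>, ?U) \<in> symbols SAA" using \<mu> by (intro eval_symbols_mem[OF AA us]) simp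
      have s: "(fst (ss ! i), snd (ss ! i)) \<in> symbols A" using s_mem[OF i] by simp
      note tm = symbols_tag_inl_inr[OF A s]
      have "tag ?a ?b i ?ws = ?U[i := ?b (eval_symbol A (ss ! i))]"
        using i by (intro nth_equalityI) (simp_all add: nth_tag nth_list_update a_eval s_mem)
      also have "?b (eval_symbol A (ss ! i)) = (\<Oplus>\<^bsub>SAA\<^esub>j\<in>{..<?n}. elt AA (fst (ss ! i)) (?t j))"
        unfolding eval_symbol_def by (rule app_Schur_diff[OF A s])
      finally have tag_eq: "tag ?a ?b i ?ws = ?U[i := (\<Oplus>\<^bsub>SAA\<^esub>j\<in>{..<?n}. elt AA (fst (ss ! i)) (?t j))]" .
      have "linear_on R SAA (SP SAA) (\<lambda>w. elt SAA \<mu> (?U[i := w]))"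
        using U i by (intro sym_multilinear_on_arg[OF Schur_elem_sym_multilinear[OF SAA]]) (simp_all add: symbols_iff)
      from linear_on_compose[OF this Hom_MOD_linear[OF mAA]]
      have lin: "linear_on R SAA SAA (\<lambda>w. app (Smult AA) (elt SAA \<mu> (?U[i := w])))" .
      have "app (Smult AA) (elt SAA \<mu> (tag ?a ?b i ?ws)) =
          (\<Oplus>\<^bsub>SAA\<^esub>j\<in>{..<?n}. app (Smult AA)
            (elt SAA \<mu> (?U[i := elt AA (fst (ss ! i)) (?t j)])))"
        unfolding tag_eq by (rule linear_on_finsum[OF lin SAA SAA]) (simp_all add: Schur_elem_closed[OF AA tm])
      also have "\<dots> = (\<Oplus>\<^bsub>SAA\<^esub>j\<in>{..<?n}.
          elt AA ?\<zeta> (tag (inl A) (inr A) (length (symbol_args (take i ss)) + j) (symbol_args ss)))"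
      proof (rule SAA.finsum_cong')
        fix j assume j: "j \<in> {..<?n}"
        let ?ts = "?us[i := (fst (ss ! i), ?t j)]"
        note ts = symbols_update_tag[OF ss i, of j]
        have "?U[i := elt AA (fst (ss ! i)) (?t j)] = map (eval_symbol AA) ?ts"
          by (simp add: map_update eval_symbol_def)
        then have "app (Smult AA) (elt SAA \<mu> (?U[i := elt AA (fst (ss ! i)) (?t j)])) =
            comp_symbols AA \<mu> ?ts"
          using \<mu> j ts(1) by (simp only:) (intro app_Schur_mult[OF AA]; simp)
        also have "\<dots> = elt AA ?\<zeta> (tag (inl A) (inr A) (length (symbol_args (take i ss)) + j) (symbol_args ss))"
          using ts(2,3) j by (simp add: comp_symbols_def)
        finally show "app (Smult AA) (elt SAA \<mu> (?U[i := elt AA (fst (ss ! i)) (?t j)])) =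
          elt AA ?\<zeta> (tag (inl A) (inr A) (length (symbol_args (take i ss)) + j) (symbol_args ss))" .
      qed (use Schur_elem_closed[OF AA symbols_tag_inl_inr[OF A \<zeta>]] in auto)
      finally show ?thesis .
    qed
    have tmem: "(\<mu>, tag ?a ?b i ?ws) \<in> symbols SAA" for i
      by (rule symbols_tag[OF mem Hom_MOD_closed[OF Sin] Hom_MOD_closed[OF D]])
    have "app (Smult AA \<bullet> Smap ?\<phi> \<bullet> Sdiff SA)
        (elt SA \<mu> ?ws) =
      app (Smult AA) (\<Oplus>\<^bsub>SP SAA\<^esub>i\<in>{..<length ?ws}. elt SAA \<mu> (tag ?a ?b i ?ws))"
      using app_Schur_map_diff[OF SA \<phi> mem \<phi>_in] by (simp add: app_Comp_MOD[OF S\<phi>D x])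
    also have "\<dots> = (\<Oplus>\<^bsub>SAA\<^esub>i\<in>{..<length ?ws}. app (Smult AA) (elt SAA \<mu> (tag ?a ?b i ?ws)))"
      by (rule linear_on_finsum[OF Hom_MOD_linear[OF mAA] Schur_module[OF SAA] SAA])
        (simp_all add: Schur_elem_closed[OF SAA tmem])
    \<comment> \<open>The double sum is rewritten with the argument lists as blocks, so that
      \<open>finsum_concat\<close> applies.\<close>
    also have "\<dots> = (\<Oplus>\<^bsub>SAA\<^esub>i\<in>{..<length (map snd ss)}. \<Oplus>\<^bsub>SAA\<^esub>j\<in>{..<length (map snd ss ! i)}.
        elt AA ?\<zeta> (tag (inl A) (inr A) (length (concat (take i (map snd ss))) + j) (concat (map snd ss))))"
      using Schur_elem_closed[OF AA symbols_tag_inl_inr[OF A \<zeta>]]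
      by (intro SAA.finsum_cong') (auto simp: summand symbol_args_def take_map intro!: SAA.finsum_closed)
    also have "\<dots> = (\<Oplus>\<^bsub>SAA\<^esub>p\<in>{..<length (concat (map snd ss))}.
        elt AA ?\<zeta> (tag (inl A) (inr A) p (concat (map snd ss))))"
      by (rule SAA.finsum_concat[symmetric])
        (use Schur_elem_closed[OF AA symbols_tag_inl_inr[OF A \<zeta>]] in \<open>simp add: symbol_args_def\<close>)
    also have "\<dots> = app (Sdiff A) (comp_symbols A \<mu> ss)"
      unfolding comp_symbols_def app_Schur_diff[OF A \<zeta>] by (simp add: symbol_args_def)
    also have "\<dots> = app (Sdiff A \<bullet> Smult A) (elt SA \<mu> ?ws)"
      by (simp only: app_Comp_MOD[OF m x] app_Schur_mult[OF A \<mu> ss])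
    finally show "app (Sdiff A \<bullet> Smult A) (elt SA \<mu> ?ws) =
      app (Smult AA \<bullet> Smap ?\<phi> \<bullet> Sdiff SA)
        (elt SA \<mu> ?ws)" by simp
  qed
qed

end

lemma Schur_differential_combinator:
  "differential_combinator_transformation (MOD R)
    SP Smap Smult Sunit Sdiff"
  by (intro differential_combinator_transformation.intro differential_combinator_transformation_axioms.intro
      semi_additive_category_MOD is_cring Schur_monad)
    (simp_all only: MOD_simps mem_Collect_eq Schur_diff_in_Hom Schur_diff_natural
      Schur_DC1 Schur_DC2 Schur_DC3 Schur_DC4 Schur_DC5 Schur_DC6)

end

theorem theorem4p1p1:
  fixes R :: "('a, 'c) ring_scheme"
    and P :: "('a, 'u::infinite) operad_data"
  assumes "operad R P"
  shows "(\<forall>V \<in> Ob (MOD R). \<exists>!h. is_Schur_diff R P V h) \<and>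
    differential_combinator_transformation (MOD R)
      (Schur R P) (Schur_map R P) (Schur_mult R P) (Schur_unit R P) (Schur_diff R P) \<and>
    coCartesian_differential_monad (MOD R)
      (Schur R P) (Schur_map R P) (Schur_mult R P) (Schur_unit R P) (Schur_diff R P)"
proof -
  \<comment> \<open>The locale adds to the operad only the infinite universe, which the type of
    \<open>P\<close> supplies.\<close>
  interpret operad_universe R P by (rule operad_universe.intro[OF assms])
  note d = Schur_differential_combinator
  have "coCartesian_differential_monad (MOD R)
      (Schur R P) (Schur_map R P) (Schur_mult R P) (Schur_unit R P) (Schur_diff R P)"
    using d by (intro coCartesian_differential_monad.intro)
      (auto dest: differential_combinator_transformation.axioms)
  with d show ?thesis using is_Schur_diff_unique by simp
qed

end
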